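(* Let $\widetilde{C}$ be a smooth compact complex curve of genus greater than $1$, and let $F$ be a rank-two holomorphic vector bundle on $\widetilde{C}$ of degree $0$ such that the symmetric powers $S^m(F)$ are stable for all $m\ge 1$. Let $Y=\mathbb{P}(F)$, let $L_Y=\mathcal{O}_Y(1)$ be the relative hyperplane bundle, and let $h_{L_Y}$ be the smooth Hermitian metric on $L_Y$ with semi-positive curvature induced from a unitary-flat metric of $F^*$ (described in the context). Let $\widetilde{X}\to\widetilde{C}$ be a smooth holomorphic fiber bundle over $\widetilde{C}$ ($\widetilde{X}$ need not be compact), and let $L_{\widetilde{X}}$ be a pseudo-effective line bundle on $\widetilde{X}$. Let $\widetilde{Y}=\widetilde{X}\times_{\widetilde{C}}Y$, with first and second projections $p_1\colon\widetilde{Y}\to\widetilde{X}$ and $p_2\colon\widetilde{Y}\to Y$, and let $\widetilde{L}:=p_1^*L_{\widetilde{X}}\otimes p_2^*L_Y$. Assume that $L_{\widetilde{X}}$ admits a minimal singular metric $h_{L_{\widetilde{X}}}$. Then the metric $(p_1^*h_{L_{\widetilde{X}}})\otimes(p_2^*h_{L_Y})$ is a minimal singular metric of $\widetilde{L}$.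
   Context: Conventions: curves are connected; line bundles are holomorphic. $\mathbb{P}(F)$ is the projective bundle of rank-one quotients of $F$ (equivalently, of lines in the dual $F^*$). A bundle $F$ as in the claim exists by a result of Mumford. A smooth holomorphic fiber bundle over $\widetilde{C}$ is a holomorphic map from a complex manifold onto $\widetilde{C}$ such that each $x\in\widetilde{C}$ has an open neighborhood $\widetilde{U}\subset\widetilde{C}$ over whose preimage the map can be identified with the natural projection to $\widetilde{U}$ from the product of $\widetilde{U}$ and some complex manifold. The metric $h_{L_Y}$: by the Narasimhan--Seshadri theorem there is a representation $\rho\colon\pi_1(\widetilde{C})\to U(2)$ such that $F^*\cong(\mathbb{H}\times\mathbb{C}^2)/\pi_1(\widetilde{C})$, where $\mathbb{H}$ is the upper half-plane (universal cover of $\widetilde{C}$) and $\pi_1(\widetilde{C})$ acts on $\mathbb{C}^2$ via $\rho$. The Euclidean metric on $\mathbb{C}^2$ induces a flat Hermitian metric $h_{F^*}$ on $F^*$, with local holomorphic orthonormal frames $(s_1^*,s_2^* )$. With local coordinates $(w,x)\mapsto[s_1^*(x)+ws_2^*(x)]$ on $\mathbb{P}(F)$, $h_{L_Y}$ is the fiberwise Fubini--Study metric on $\mathcal{O}_{\mathbb{P}(F)}(1)$, with local weight $\log|s_1^*(x)+ws_2^*(x)|^2_{h_{F^*}}=\log(1+|w|^2)$; its curvature is semi-positive. Singular Hermitian metrics. Let $L$ be a line bundle on a complex manifold $X$. A singular Hermitian metric $h$ on $L$ is given in each local trivialization by $\langle \xi,\eta\rangle_z=e^{-\psi(z)}\xi\overline{\eta}$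 with $\psi$ a locally integrable function, called the local weight of $h$. The local currents $\sqrt{-1}\partial\overline{\partial}\psi$ glue to the curvature current $\sqrt{-1}\Theta_h$; $h$ has semi-positive curvature if $\sqrt{-1}\Theta_h\ge 0$, i.e. the local weights are plurisubharmonic (psh). A line bundle is pseudo-effective if it admits a singular Hermitian metric with semi-positive curvature. Minimal singular metrics. For psh functions $\varphi,\psi$ near a point $x$, write $\varphi\prec_{\rm sing}\psi$ at $x$ if there is a constant $A$ with $\varphi\le\psi+A$ at all points sufficiently near $x$. A singular Hermitian metric $h_{\min}$ of $L$ with $\sqrt{-1}\Theta_{h_{\min}}\ge0$ is a minimal singular metric if for every singular Hermitian metric $h$ of $L$ with $\sqrt{-1}\Theta_h\ge 0$ one has $\psi\prec_{\rm sing}\varphi_{\min}$ at every $x\in X$, where $\varphi_{\min},\psi$ are the local weights of $h_{\min},h$. *)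

theory Defs
  imports
    "HOL-Complex_Analysis.Complex_Analysis"
    "HOL-Library.Function_Algebras"
    "HOL-Algebra.Bij"
    "Jordan_Normal_Form.Schur_Decomposition"
begin

section \<open>Complex manifolds\<close>

text \<open>Dimensions have to vary (fibres of a bundle may be points, a fibre product has a dimension of
  its own), so $n$-space is modelled by the functions \<^typ>\<open>nat \<Rightarrow> complex\<close> that are undefined
  outside \<^term>\<open>{..<n}\<close>.\<close>

definition Cn :: "nat \<Rightarrow> (nat \<Rightarrow> complex) topology" where
  "Cn n = product_topology (\<lambda>_. euclidean) {..<n}"

definition Cn_lebesgue :: "nat \<Rightarrow> (nat \<Rightarrow> complex) measure" where
  "Cn_lebesgue n = completion (Pi\<^sub>M {..<n} (\<lambda>_. lborel))"

definition pt1 :: "complex \<Rightarrow> nat \<Rightarrow> complex" where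
  "pt1 t = (\<lambda>k\<in>{..<1}. t)"

definition join :: "nat \<Rightarrow> (nat \<Rightarrow> complex) \<Rightarrow> (nat \<Rightarrow> complex) \<Rightarrow> nat \<Rightarrow> complex" where
  "join n a b = (\<lambda>k. if k < n then a k else b (k - n))"

text \<open>Holomorphic functions of several variables: complex differentiable at every point.\<close>

definition hol_Cn :: "nat \<Rightarrow> (nat \<Rightarrow> complex) set \<Rightarrow> ((nat \<Rightarrow> complex) \<Rightarrow> complex) \<Rightarrow> bool" where
  "hol_Cn n W f \<longleftrightarrow> (\<forall>z\<in>W. \<exists>a. \<forall>e>0. \<exists>d>0. \<forall>w\<in>W.
     (\<forall>k<n. cmod (w k - z k) < d) \<longrightarrow>
     cmod (f w - f z - (\<Sum>k<n. a k * (w k - z k))) \<le> e * (\<Sum>k<n. cmod (w k - z k)))"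

type_synonym 'a chart = "'a set \<times> ('a \<Rightarrow> nat \<Rightarrow> complex)"

text \<open>The atlas need not be maximal; the topology is the one determined by the charts.\<close>

record 'a cmfd =
  points :: "'a set"
  mdim :: nat
  charts :: "'a chart set"

definition mtop :: "'a cmfd \<Rightarrow> 'a topology" where
  "mtop M = topology (\<lambda>W. W \<subseteq> points M \<and> (\<forall>(D, \<phi>)\<in>charts M. openin (Cn (mdim M)) (\<phi> ` (D \<inter> W))))"

definition hol_fun :: "'a cmfd \<Rightarrow> 'a set \<Rightarrow> ('a \<Rightarrow> complex) \<Rightarrow> bool" where
  "hol_fun M W f \<longleftrightarrow>
     (\<forall>(D, \<phi>)\<in>charts M. hol_Cn (mdim M) (\<phi> ` (D \<inter> W)) (\<lambda>z. f (inv_into D \<phi> z)))"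

definition complex_manifold :: "'a cmfd \<Rightarrow> bool" where
  "complex_manifold M \<longleftrightarrow>
     \<Union> (fst ` charts M) = points M \<and>
     (\<forall>(D, \<phi>)\<in>charts M. inj_on \<phi> D \<and> openin (Cn (mdim M)) (\<phi> ` D)) \<and>
     (\<forall>(D, \<phi>)\<in>charts M. \<forall>(E, \<psi>)\<in>charts M.
        openin (Cn (mdim M)) (\<phi> ` (D \<inter> E)) \<and> (\<forall>k<mdim M. hol_fun M (D \<inter> E) (\<lambda>p. \<psi> p k))) \<and>
     Hausdorff_space (mtop M) \<and> second_countable (mtop M)"

lemma openin_mtop:
  assumes "complex_manifold M"
  shows "openin (mtop M) W \<longleftrightarrow>
    W \<subseteq> points M \<and> (\<forall>(D, \<phi>)\<in>charts M. openin (Cn (mdim M)) (\<phi> ` (D \<inter> W)))"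
proof -
  define P where "P = (\<lambda>W. W \<subseteq> points M \<and> (\<forall>(D, \<phi>)\<in>charts M. openin (Cn (mdim M)) (\<phi> ` (D \<inter> W))))"
  have inj: "inj_on \<phi> D" if "(D, \<phi>) \<in> charts M" for D \<phi>
    using assms that by (auto simp: complex_manifold_def)
  have "istopology P"
    unfolding istopology_def
  proof (intro conjI allI impI)
    fix S T assume S: "P S" and T: "P T"
    have "openin (Cn (mdim M)) (\<phi> ` (D \<inter> (S \<inter> T)))" if c: "(D, \<phi>) \<in> charts M" for D \<phi>
    proof -
      have "\<phi> ` (D \<inter> (S \<inter> T)) = \<phi> ` (D \<inter> S) \<inter> \<phi> ` (D \<inter> T)"
        using inj[OF c] by (auto simp: inj_on_def)
      then show ?thesis using S T c by (auto simp: P_def)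
    qed
    then show "P (S \<inter> T)" using S by (auto simp: P_def)
  next
    fix K assume K: "\<forall>S\<in>K. P S"
    have "openin (Cn (mdim M)) (\<phi> ` (D \<inter> \<Union>K))" if c: "(D, \<phi>) \<in> charts M" for D \<phi>
    proof -
      have "\<phi> ` (D \<inter> \<Union>K) = \<Union> ((\<lambda>S. \<phi> ` (D \<inter> S)) ` K)" by auto
      moreover have "openin (Cn (mdim M)) (\<phi> ` (D \<inter> S))" if "S \<in> K" for S
        using K c that by (auto simp: P_def)
      ultimately show ?thesis by (auto intro: openin_Union)
    qed
    then show "P (\<Union>K)" using K by (auto simp: P_def)
  qed
  then show ?thesis
    unfolding mtop_def P_def[symmetric] by (simp add: topology_inverse' P_def)
qed

definition hol_map :: "'a cmfd \<Rightarrow> 'b cmfd \<Rightarrow> ('a \<Rightarrow> 'b) \<Rightarrow> bool" where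
  "hol_map M N f \<longleftrightarrow> continuous_map (mtop M) (mtop N) f \<and>
     (\<forall>(E, \<psi>)\<in>charts N. \<forall>k<mdim N. hol_fun M {p \<in> points M. f p \<in> E} (\<lambda>p. \<psi> (f p) k))"

definition biholomorphism :: "'a cmfd \<Rightarrow> 'b cmfd \<Rightarrow> ('a \<Rightarrow> 'b) \<Rightarrow> bool" where
  "biholomorphism M N f \<longleftrightarrow> bij_betw f (points M) (points N) \<and>
     hol_map M N f \<and> hol_map N M (inv_into (points M) f)"

definition open_submfd :: "'a cmfd \<Rightarrow> 'a set \<Rightarrow> 'a cmfd" where
  "open_submfd M W = \<lparr>points = points M \<inter> W, mdim = mdim M, charts = (\<lambda>(D, \<phi>). (D \<inter> W, \<phi>)) ` charts M\<rparr>"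

definition prod_mfd :: "'a cmfd \<Rightarrow> 'b cmfd \<Rightarrow> ('a \<times> 'b) cmfd" where
  "prod_mfd M N = \<lparr>points = points M \<times> points N, mdim = mdim M + mdim N,
     charts = {(D \<times> E, \<lambda>(p, q). join (mdim M) (\<phi> p) (\<psi> q)) | D \<phi> E \<psi>.
                 (D, \<phi>) \<in> charts M \<and> (E, \<psi>) \<in> charts N}\<rparr>"

text \<open>Smooth holomorphic fibre bundles. The model fibre can be taken to live on the type of the
  total space, because it is biholomorphic to an actual fibre.\<close>

definition hol_fibre_bundle :: "'x cmfd \<Rightarrow> 'c cmfd \<Rightarrow> ('x \<Rightarrow> 'c) \<Rightarrow> bool" where
  "hol_fibre_bundle X C f \<longleftrightarrow> complex_manifold X \<and> hol_map X C f \<and> f ` points X = points C \<and>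
     (\<forall>x\<in>points C. \<exists>U. openin (mtop C) U \<and> x \<in> U \<and>
        (\<exists>(Z :: 'x cmfd) \<Phi>. complex_manifold Z \<and>
           biholomorphism (open_submfd X {p \<in> points X. f p \<in> U}) (prod_mfd (open_submfd C U) Z) \<Phi> \<and>
           (\<forall>p\<in>points X. f p \<in> U \<longrightarrow> fst (\<Phi> p) = f p)))"

text \<open>The fibre product of \<open>f : X \<rightarrow> C\<close> and \<open>g : Y \<rightarrow> C\<close>, where \<open>Y\<close> has an atlas of charts
  \<open>\<psi>\<close> whose first \<open>dim C\<close> coordinates are coordinates of the base, i.e. \<open>\<psi> = (z \<circ> g, w)\<close> with a
  chart \<open>z\<close> of \<open>C\<close>. Then \<open>(p, y) \<mapsto> (\<phi> p, w y)\<close>, for charts \<open>\<phi>\<close> of \<open>X\<close>, are charts of the fibre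
  product.\<close>

definition fibre_product ::
  "'c cmfd \<Rightarrow> 'x cmfd \<Rightarrow> ('x \<Rightarrow> 'c) \<Rightarrow> 'y cmfd \<Rightarrow> ('y \<Rightarrow> 'c) \<Rightarrow> ('x \<times> 'y) cmfd" where
  "fibre_product C X f Y g = \<lparr>points = {(p, y). p \<in> points X \<and> y \<in> points Y \<and> f p = g y},
     mdim = mdim X + (mdim Y - mdim C),
     charts = {({(p, y). p \<in> D \<and> y \<in> E \<and> f p = g y},
                \<lambda>(p, y). join (mdim X) (\<phi> p) (\<lambda>k. \<psi> y (mdim C + k))) | D \<phi> E \<psi>.
        (D, \<phi>) \<in> charts X \<and> (E, \<psi>) \<in> charts Y \<and>
        (\<exists>(B, z)\<in>charts C. \<forall>y\<in>E. g y \<in> B \<and> (\<forall>k<mdim C. \<psi> y k = z (g y) k))}\<rparr>"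


section \<open>Compact curves and their genus\<close>

definition compact_curve :: "'c cmfd \<Rightarrow> bool" where
  "compact_curve C \<longleftrightarrow> complex_manifold C \<and> mdim C = 1 \<and>
     compact_space (mtop C) \<and> connected_space (mtop C)"

text \<open>A holomorphic 1-form is given by its coefficients \<open>\<omega> (D, \<phi>)\<close> with respect to \<open>d\<phi>\<close>, put to
  zero off the chart.\<close>

definition hol_forms :: "'c cmfd \<Rightarrow> ('c chart \<Rightarrow> 'c \<Rightarrow> complex) set" where
  "hol_forms C = {\<omega>.
     (\<forall>c x. c \<notin> charts C \<or> x \<notin> fst c \<longrightarrow> \<omega> c x = 0) \<and>
     (\<forall>(D, \<phi>)\<in>charts C. hol_fun C D (\<omega> (D, \<phi>))) \<and>
     (\<forall>(D, \<phi>)\<in>charts C. \<forall>(E, \<psi>)\<in>charts C. \<forall>x\<in>D \<inter> E.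
        \<omega> (D, \<phi>) x = \<omega> (E, \<psi>) x * deriv (\<lambda>t. \<psi> (inv_into D \<phi> (pt1 t)) 0) (\<phi> x 0))}"

definition form_scale :: "complex \<Rightarrow> ('c chart \<Rightarrow> 'c \<Rightarrow> complex) \<Rightarrow> 'c chart \<Rightarrow> 'c \<Rightarrow> complex" where
  "form_scale a \<omega> = (\<lambda>c x. a * \<omega> c x)"

lemma vector_space_form_scale: "vector_space form_scale"
  by unfold_locales (auto simp: form_scale_def fun_eq_iff algebra_simps)

definition genus :: "'c cmfd \<Rightarrow> nat" where
  "genus C = vector_space.dim form_scale (hol_forms C)"


section \<open>Line bundles and vector bundles\<close>

text \<open>Bundles are given by local trivializations over an open cover \<open>U\<^sub>i\<close> with transition functions
  \<open>g\<^sub>i\<^sub>j\<close>; fibre coordinates transform by \<open>\<xi>\<^sub>i = g\<^sub>i\<^sub>j \<xi>\<^sub>j\<close>.\<close>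

record ('a, 'i) lbundle =
  lb_idx :: "'i set"
  lb_dom :: "'i \<Rightarrow> 'a set"
  lb_trans :: "'i \<Rightarrow> 'i \<Rightarrow> 'a \<Rightarrow> complex"

record ('a, 'i) vbundle =
  vb_rank :: nat
  vb_idx :: "'i set"
  vb_dom :: "'i \<Rightarrow> 'a set"
  vb_trans :: "'i \<Rightarrow> 'i \<Rightarrow> 'a \<Rightarrow> complex Matrix.mat"

definition hol_lbundle :: "'a cmfd \<Rightarrow> ('a, 'i) lbundle \<Rightarrow> bool" where
  "hol_lbundle M L \<longleftrightarrow>
     (\<forall>i\<in>lb_idx L. openin (mtop M) (lb_dom L i)) \<and> \<Union> (lb_dom L ` lb_idx L) = points M \<and>
     (\<forall>i\<in>lb_idx L. \<forall>j\<in>lb_idx L. hol_fun M (lb_dom L i \<inter> lb_dom L j) (lb_trans L i j)) \<and>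
     (\<forall>i\<in>lb_idx L. \<forall>x\<in>lb_dom L i. lb_trans L i i x = 1) \<and>
     (\<forall>i\<in>lb_idx L. \<forall>j\<in>lb_idx L. \<forall>k\<in>lb_idx L. \<forall>x\<in>lb_dom L i \<inter> lb_dom L j \<inter> lb_dom L k.
        lb_trans L i j x * lb_trans L j k x = lb_trans L i k x)"

definition hol_vbundle :: "'a cmfd \<Rightarrow> ('a, 'i) vbundle \<Rightarrow> bool" where
  "hol_vbundle M V \<longleftrightarrow>
     (\<forall>i\<in>vb_idx V. openin (mtop M) (vb_dom V i)) \<and> \<Union> (vb_dom V ` vb_idx V) = points M \<and>
     (\<forall>i\<in>vb_idx V. \<forall>j\<in>vb_idx V.
        (\<forall>x\<in>vb_dom V i \<inter> vb_dom V j. vb_trans V i j x \<in> carrier_mat (vb_rank V) (vb_rank V)) \<and>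
        (\<forall>k<vb_rank V. \<forall>l<vb_rank V.
           hol_fun M (vb_dom V i \<inter> vb_dom V j) (\<lambda>x. vb_trans V i j x $$ (k, l)))) \<and>
     (\<forall>i\<in>vb_idx V. \<forall>x\<in>vb_dom V i. vb_trans V i i x = 1\<^sub>m (vb_rank V)) \<and>
     (\<forall>i\<in>vb_idx V. \<forall>j\<in>vb_idx V. \<forall>k\<in>vb_idx V. \<forall>x\<in>vb_dom V i \<inter> vb_dom V j \<inter> vb_dom V k.
        vb_trans V i j x * vb_trans V j k x = vb_trans V i k x)"

definition lb_pullback :: "'b cmfd \<Rightarrow> ('b \<Rightarrow> 'a) \<Rightarrow> ('a, 'i) lbundle \<Rightarrow> ('b, 'i) lbundle" where
  "lb_pullback N f L = \<lparr>lb_idx = lb_idx L, lb_dom = (\<lambda>i. {q \<in> points N. f q \<in> lb_dom L i}),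
     lb_trans = (\<lambda>i j q. lb_trans L i j (f q))\<rparr>"

definition lb_tensor :: "('a, 'i) lbundle \<Rightarrow> ('a, 'j) lbundle \<Rightarrow> ('a, 'i \<times> 'j) lbundle" where
  "lb_tensor L K = \<lparr>lb_idx = lb_idx L \<times> lb_idx K, lb_dom = (\<lambda>(i, j). lb_dom L i \<inter> lb_dom K j),
     lb_trans = (\<lambda>(i, j) (k, l) x. lb_trans L i k x * lb_trans K j l x)\<rparr>"

definition vb_det :: "('a, 'i) vbundle \<Rightarrow> ('a, 'i) lbundle" where
  "vb_det V = \<lparr>lb_idx = vb_idx V, lb_dom = vb_dom V, lb_trans = (\<lambda>i j x. Determinant.det (vb_trans V i j x))\<rparr>"

definition vb_dual :: "('a, 'i) vbundle \<Rightarrow> ('a, 'i) vbundle" where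
  "vb_dual V = V\<lparr>vb_trans := (\<lambda>i j x. transpose_mat (vb_trans V j i x))\<rparr>"

text \<open>The matrix of the \<open>m\<close>-th symmetric power of a 2-by-2 matrix in the basis
  $e_1^{m-k} e_2^k$, $0 \le k \le m$; homogeneous polynomials in $e_1, e_2$ are dehomogenized by
  $e_1 = 1$.\<close>

definition sym_mat :: "nat \<Rightarrow> complex Matrix.mat \<Rightarrow> complex Matrix.mat" where
  "sym_mat m A = Matrix.mat (m + 1) (m + 1) (\<lambda>(j, k).
     poly.coeff ([:A $$ (0, 0), A $$ (1, 0):] ^ (m - k) * [:A $$ (0, 1), A $$ (1, 1):] ^ k) j)"

text \<open>Only meaningful for bundles of rank two.\<close>

definition sym_power :: "nat \<Rightarrow> ('a, 'i) vbundle \<Rightarrow> ('a, 'i) vbundle" where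
  "sym_power m V = V\<lparr>vb_rank := m + 1, vb_trans := (\<lambda>i j x. sym_mat m (vb_trans V i j x))\<rparr>"


section \<open>Degree and stability on a curve\<close>

text \<open>\<open>s\<close> is a meromorphic section that is not identically zero (on a connected curve: not
  identically zero near any point), and \<open>\<nu> x\<close> is its order at \<open>x\<close>.\<close>

definition mero_section :: "'c cmfd \<Rightarrow> ('c, 'i) lbundle \<Rightarrow> ('i \<Rightarrow> 'c \<Rightarrow> complex) \<Rightarrow> ('c \<Rightarrow> int) \<Rightarrow> bool" where
  "mero_section C L s \<nu> \<longleftrightarrow>
     (\<forall>i\<in>lb_idx L. \<forall>j\<in>lb_idx L. \<forall>x\<in>lb_dom L i \<inter> lb_dom L j. s i x = lb_trans L i j x * s j x) \<and>
     (\<forall>i\<in>lb_idx L. \<forall>(D, \<phi>)\<in>charts C. \<forall>x\<in>D \<inter> lb_dom L i.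
        (let g = (\<lambda>t. s i (inv_into D \<phi> (pt1 t))) in
           g meromorphic_on {\<phi> x 0} \<and> (\<exists>\<^sub>F t in at (\<phi> x 0). g t \<noteq> 0) \<and> \<nu> x = zorder g (\<phi> x 0)))"

definition lb_degree :: "'c cmfd \<Rightarrow> ('c, 'i) lbundle \<Rightarrow> int" where
  "lb_degree C L = (THE d. \<exists>s \<nu>. mero_section C L s \<nu> \<and> d = (\<Sum>x | x \<in> points C \<and> \<nu> x \<noteq> 0. \<nu> x))"

definition vb_degree :: "'c cmfd \<Rightarrow> ('c, 'i) vbundle \<Rightarrow> int" where
  "vb_degree C V = lb_degree C (vb_det V)"

definition slope :: "'c cmfd \<Rightarrow> ('c, 'i) vbundle \<Rightarrow> real" where
  "slope C V = of_int (vb_degree C V) / of_nat (vb_rank V)"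

text \<open>Bundle morphisms \<open>E \<rightarrow> V\<close> that are injective on every fibre; \<open>A i j\<close> is the matrix with
  respect to the trivializations \<open>j\<close> of \<open>E\<close> and \<open>i\<close> of \<open>V\<close>. Their images are the subbundles
  of \<open>V\<close>.\<close>

definition vb_embedding :: "'a cmfd \<Rightarrow> ('a, 'j) vbundle \<Rightarrow> ('a, 'i) vbundle \<Rightarrow>
    ('i \<Rightarrow> 'j \<Rightarrow> 'a \<Rightarrow> complex Matrix.mat) \<Rightarrow> bool" where
  "vb_embedding M E V A \<longleftrightarrow>
     (\<forall>i\<in>vb_idx V. \<forall>j\<in>vb_idx E.
        (\<forall>x\<in>vb_dom V i \<inter> vb_dom E j. A i j x \<in> carrier_mat (vb_rank V) (vb_rank E) \<and>
           (\<forall>v\<in>carrier_vec (vb_rank E). A i j x *\<^sub>v v = 0\<^sub>v (vb_rank V) \<longrightarrow> v = 0\<^sub>v (vb_rank E))) \<and>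
        (\<forall>k<vb_rank V. \<forall>l<vb_rank E.
           hol_fun M (vb_dom V i \<inter> vb_dom E j) (\<lambda>x. A i j x $$ (k, l)))) \<and>
     (\<forall>i\<in>vb_idx V. \<forall>i'\<in>vb_idx V. \<forall>j\<in>vb_idx E. \<forall>j'\<in>vb_idx E.
        \<forall>x\<in>vb_dom V i \<inter> vb_dom V i' \<inter> vb_dom E j \<inter> vb_dom E j'.
          A i' j' x = vb_trans V i' i x * A i j x * vb_trans E j j' x)"

text \<open>Slope stability. Trivializations of the subbundles are indexed by points of the curve; this
  loses no generality, since one may choose one trivialization around each point.\<close>

definition stable_vbundle :: "'c cmfd \<Rightarrow> ('c, 'i) vbundle \<Rightarrow> bool" where
  "stable_vbundle C V \<longleftrightarrow> (\<forall>(E :: ('c, 'c) vbundle) A.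
     hol_vbundle C E \<and> vb_embedding C E V A \<and> 0 < vb_rank E \<and> vb_rank E < vb_rank V \<longrightarrow>
     slope C E < slope C V)"


section \<open>Fibres, and unitary-flat metrics\<close>

text \<open>A vector in the fibre over \<open>x\<close> is the family of its coordinates in all trivializations around
  \<open>x\<close> (with the dummy value \<^term>\<open>0\<^sub>v 0\<close> for the other indices).\<close>

type_synonym 'i fvec = "'i \<Rightarrow> complex Matrix.vec"

definition vb_fibre :: "('a, 'i) vbundle \<Rightarrow> 'a \<Rightarrow> 'i fvec set" where
  "vb_fibre V x = {v.
     (\<forall>i. (i \<in> vb_idx V \<and> x \<in> vb_dom V i \<longrightarrow> v i \<in> carrier_vec (vb_rank V)) \<and>
          (\<not> (i \<in> vb_idx V \<and> x \<in> vb_dom V i) \<longrightarrow> v i = 0\<^sub>v 0)) \<and>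
     (\<forall>i\<in>vb_idx V. \<forall>j\<in>vb_idx V. x \<in> vb_dom V i \<inter> vb_dom V j \<longrightarrow> v i = vb_trans V i j x *\<^sub>v v j)}"

definition fadd :: "'i fvec \<Rightarrow> 'i fvec \<Rightarrow> 'i fvec" where
  "fadd v w = (\<lambda>i. v i + w i)"

definition fscale :: "complex \<Rightarrow> 'i fvec \<Rightarrow> 'i fvec" where
  "fscale c v = (\<lambda>i. c \<cdot>\<^sub>v v i)"

definition fline :: "'i fvec \<Rightarrow> 'i fvec set" where
  "fline v = range (\<lambda>c. fscale c v)"

definition upper_half_plane :: "complex set" where
  "upper_half_plane = {z. Im z > 0}"

definition hol_universal_cover :: "'c cmfd \<Rightarrow> (complex \<Rightarrow> 'c) \<Rightarrow> bool" where
  "hol_universal_cover C u \<longleftrightarrow>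
     u ` upper_half_plane = points C \<and>
     (\<forall>(D, \<phi>)\<in>charts C. (\<lambda>z. \<phi> (u z) 0) holomorphic_on {z \<in> upper_half_plane. u z \<in> D}) \<and>
     (\<forall>x\<in>points C. \<exists>W \<S>. openin (mtop C) W \<and> x \<in> W \<and> disjoint \<S> \<and>
        \<Union>\<S> = {z \<in> upper_half_plane. u z \<in> W} \<and>
        (\<forall>S\<in>\<S>. open S \<and> homeomorphic_map (top_of_set S) (subtopology (mtop C) W) u))"

text \<open>The fundamental group, acting on the universal cover by deck transformations.\<close>

definition deck_group :: "(complex \<Rightarrow> 'c) \<Rightarrow> (complex \<Rightarrow> complex) monoid" where
  "deck_group u = (BijGroup upper_half_plane)\<lparr>carrier := {\<gamma> \<in> Bij upper_half_plane.
     \<gamma> holomorphic_on upper_half_plane \<and> (\<forall>z\<in>upper_half_plane. u (\<gamma> z) = u z)}\<rparr>"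

definition unitary_group :: "nat \<Rightarrow> complex Matrix.mat monoid" where
  "unitary_group r = \<lparr>carrier = {A \<in> carrier_mat r r. mat_adjoint A * A = 1\<^sub>m r}, mult = (*), one = 1\<^sub>m r\<rparr>"

text \<open>\<open>h\<close> is the Hermitian metric on the vector bundle \<open>V\<close> induced by the Euclidean metric through an
  isomorphism of \<open>V\<close> with the quotient of (upper half-plane) \<open>\<times> \<complex>\<^sup>r\<close> by the action
  \<open>\<gamma> (z, a) = (\<gamma> z, \<rho>(\<gamma>) a)\<close> of the fundamental group, for a unitary representation \<open>\<rho>\<close>; \<open>T z a\<close> is
  the vector of \<open>V\<close> over \<open>u z\<close> that corresponds to the class of \<open>(z, a)\<close>.\<close>

definition unitary_flat_metric ::
  "'c cmfd \<Rightarrow> ('c, 'i) vbundle \<Rightarrow> ('c \<Rightarrow> 'i fvec \<Rightarrow> 'i fvec \<Rightarrow> complex) \<Rightarrow> bool" where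
  "unitary_flat_metric C V h \<longleftrightarrow> (\<exists>u \<rho> (T :: complex \<Rightarrow> complex Matrix.vec \<Rightarrow> 'i fvec).
     hol_universal_cover C u \<and>
     \<rho> \<in> hom (deck_group u) (unitary_group (vb_rank V)) \<and>
     (\<forall>z\<in>upper_half_plane.
        bij_betw (T z) (carrier_vec (vb_rank V)) (vb_fibre V (u z)) \<and>
        (\<forall>a\<in>carrier_vec (vb_rank V). \<forall>b\<in>carrier_vec (vb_rank V). T z (a + b) = fadd (T z a) (T z b)) \<and>
        (\<forall>c. \<forall>a\<in>carrier_vec (vb_rank V). T z (c \<cdot>\<^sub>v a) = fscale c (T z a))) \<and>
     (\<forall>a\<in>carrier_vec (vb_rank V). \<forall>i\<in>vb_idx V. \<forall>k<vb_rank V.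
        (\<lambda>z. vec_index (T z a i) k) holomorphic_on {z \<in> upper_half_plane. u z \<in> vb_dom V i}) \<and>
     (\<forall>\<gamma>\<in>carrier (deck_group u). \<forall>z\<in>upper_half_plane. \<forall>a\<in>carrier_vec (vb_rank V).
        T (\<gamma> z) (\<rho> \<gamma> *\<^sub>v a) = T z a) \<and>
     (\<forall>z\<in>upper_half_plane. \<forall>a\<in>carrier_vec (vb_rank V). \<forall>b\<in>carrier_vec (vb_rank V).
        h (u z) (T z a) (T z b) = a \<bullet>c b))"


section \<open>The projective bundle of a bundle of rank two, and its relative hyperplane bundle\<close>

text \<open>A point of \<open>\<bbbP>(F)\<close> is a point \<open>x\<close> of the base together with a line in the fibre of \<open>F\<^sup>*\<close> over \<open>x\<close>.
  A holomorphic local frame \<open>(s\<^sub>1, s\<^sub>2)\<close> of \<open>F\<^sup>*\<close> over an open set \<open>W\<close> gives the affine coordinate \<open>w\<close>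
  on \<open>{[s\<^sub>1(x) + w s\<^sub>2(x)] | x \<in> W}\<close>. All frames are used, so that these sets cover \<open>\<bbbP>(F)\<close>.\<close>

type_synonym ('c, 'i) frame = "'c set \<times> ('c \<Rightarrow> 'i fvec) \<times> ('c \<Rightarrow> 'i fvec)"

definition hol_frames :: "'c cmfd \<Rightarrow> ('c, 'i) vbundle \<Rightarrow> ('c, 'i) frame set" where
  "hol_frames C V = {(W, s1, s2). openin (mtop C) W \<and>
     (\<forall>x\<in>W. s1 x \<in> vb_fibre V x \<and> s2 x \<in> vb_fibre V x \<and>
        (\<forall>a b. fadd (fscale a (s1 x)) (fscale b (s2 x)) = fscale 0 (s1 x) \<longrightarrow> a = 0 \<and> b = 0)) \<and>
     (\<forall>i\<in>vb_idx V. \<forall>k<vb_rank V.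
        hol_fun C (W \<inter> vb_dom V i) (\<lambda>x. vec_index (s1 x i) k) \<and>
        hol_fun C (W \<inter> vb_dom V i) (\<lambda>x. vec_index (s2 x i) k))}"

type_synonym ('c, 'i) ppoint = "'c \<times> 'i fvec set"

definition frame_vec :: "('c, 'i) frame \<Rightarrow> 'c \<Rightarrow> complex \<Rightarrow> 'i fvec" where
  "frame_vec = (\<lambda>(W, s1, s2) x w. fadd (s1 x) (fscale w (s2 x)))"

definition frame_dom :: "('c, 'i) frame \<Rightarrow> ('c, 'i) ppoint set" where
  "frame_dom s = {(x, fline (frame_vec s x w)) | x w. x \<in> fst s}"

definition frame_coord :: "('c, 'i) frame \<Rightarrow> ('c, 'i) ppoint \<Rightarrow> complex" where
  "frame_coord s y = (THE w. snd y = fline (frame_vec s (fst y) w))"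

text \<open>The generator \<open>s\<^sub>1(x) + w s\<^sub>2(x)\<close> of the line \<open>y\<close>, i.e. the local frame of the tautological bundle
  \<open>\<O>(-1)\<close> given by \<open>s\<close>.\<close>

definition frame_gen :: "('c, 'i) frame \<Rightarrow> ('c, 'i) ppoint \<Rightarrow> 'i fvec" where
  "frame_gen s y = frame_vec s (fst y) (frame_coord s y)"

definition proj_bundle :: "'c cmfd \<Rightarrow> ('c, 'i) vbundle \<Rightarrow> ('c, 'i) ppoint cmfd" where
  "proj_bundle C F = \<lparr>
     points = {(x, fline v) | x v. x \<in> points C \<and> v \<in> vb_fibre (vb_dual F) x \<and> v \<noteq> fscale 0 v},
     mdim = mdim C + 1,
     charts = {({y \<in> frame_dom s. fst y \<in> D}, \<lambda>y. join (mdim C) (\<phi> (fst y)) (pt1 (frame_coord s y))) | s D \<phi>.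
        s \<in> hol_frames C (vb_dual F) \<and> (D, \<phi>) \<in> charts C}\<rparr>"

text \<open>\<open>\<O>(1)\<close> is the dual of the tautological bundle: the coordinate of a linear form \<open>\<eta>\<close> on the line
  \<open>y\<close> in the trivialization \<open>s\<close> is \<open>\<eta>(frame_gen s y)\<close>.\<close>

definition O1 :: "'c cmfd \<Rightarrow> ('c, 'i) vbundle \<Rightarrow> (('c, 'i) ppoint, ('c, 'i) frame) lbundle" where
  "O1 C F = \<lparr>lb_idx = hol_frames C (vb_dual F), lb_dom = frame_dom,
     lb_trans = (\<lambda>s t y. THE c. frame_gen s y = fscale c (frame_gen t y))\<rparr>"


section \<open>Singular Hermitian metrics\<close>

text \<open>The mean of \<open>u\<close> over the circle of radius \<open>r\<close> in the complex line \<open>t \<mapsto> a + t b\<close>, as an extended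
  Lebesgue integral; for upper semicontinuous \<open>u < \<infinity>\<close> the positive part has finite integral.\<close>

definition line_pt :: "nat \<Rightarrow> (nat \<Rightarrow> complex) \<Rightarrow> (nat \<Rightarrow> complex) \<Rightarrow> complex \<Rightarrow> nat \<Rightarrow> complex" where
  "line_pt n a b t = (\<lambda>k\<in>{..<n}. a k + t * b k)"

definition circle_mean ::
  "nat \<Rightarrow> ((nat \<Rightarrow> complex) \<Rightarrow> ereal) \<Rightarrow> (nat \<Rightarrow> complex) \<Rightarrow> (nat \<Rightarrow> complex) \<Rightarrow> real \<Rightarrow> ereal" where
  "circle_mean n u a b r =
     (let v = (\<lambda>\<theta>. u (line_pt n a b (of_real r * cis (2 * pi * \<theta>)))) in
        enn2ereal (\<integral>\<^sup>+ \<theta>\<in>{0..1}. e2ennreal (v \<theta>) \<partial>lborel) - enn2ereal (\<integral>\<^sup>+ \<theta>\<in>{0..1}. e2ennreal (- v \<theta>) \<partial>lborel))"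

text \<open>Plurisubharmonic functions on an open set: upper semicontinuous, and subharmonic on every complex
  line, where subharmonicity is the local submean inequality. The function \<open>-\<infinity>\<close> is not excluded
  here; local integrability of the weights of a metric excludes it.\<close>

definition psh :: "nat \<Rightarrow> (nat \<Rightarrow> complex) set \<Rightarrow> ((nat \<Rightarrow> complex) \<Rightarrow> ereal) \<Rightarrow> bool" where
  "psh n W u \<longleftrightarrow> (\<forall>z\<in>W. u z < \<infinity>) \<and> (\<forall>c. openin (Cn n) {z \<in> W. u z < c}) \<and>
     (\<forall>a\<in>W. \<forall>b. \<exists>R>0. \<forall>r. 0 < r \<and> r < R \<longrightarrow> u a \<le> circle_mean n u a b r)"

definition loc_integrable :: "nat \<Rightarrow> (nat \<Rightarrow> complex) set \<Rightarrow> ((nat \<Rightarrow> complex) \<Rightarrow> ereal) \<Rightarrow> bool" where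
  "loc_integrable n W u \<longleftrightarrow> (\<forall>K. compactin (Cn n) K \<and> K \<subseteq> W \<longrightarrow>
     (AE z in Cn_lebesgue n. z \<in> K \<longrightarrow> \<bar>u z\<bar> \<noteq> \<infinity>) \<and>
     set_integrable (Cn_lebesgue n) K (\<lambda>z. real_of_ereal (u z)))"

text \<open>A singular Hermitian metric is given by its local weights \<open>\<psi> i\<close> on the trivializing sets,
  $|\xi|^2 = e^{-\psi_i} |\xi_i|^2$. Values of \<open>\<psi> i\<close> outside the trivializing set play no role.\<close>

type_synonym ('a, 'i) weights = "'i \<Rightarrow> 'a \<Rightarrow> ereal"

definition singular_metric :: "'a cmfd \<Rightarrow> ('a, 'i) lbundle \<Rightarrow> ('a, 'i) weights \<Rightarrow> bool" where
  "singular_metric M L \<psi> \<longleftrightarrow>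
     (\<forall>i\<in>lb_idx L. \<forall>j\<in>lb_idx L. \<forall>x\<in>lb_dom L i \<inter> lb_dom L j.
        \<psi> i x = \<psi> j x + ereal (ln ((cmod (lb_trans L i j x))\<^sup>2))) \<and>
     (\<forall>i\<in>lb_idx L. \<forall>(D, \<phi>)\<in>charts M.
        loc_integrable (mdim M) (\<phi> ` (D \<inter> lb_dom L i)) (\<lambda>z. \<psi> i (inv_into D \<phi> z)))"

definition semipositive :: "'a cmfd \<Rightarrow> ('a, 'i) lbundle \<Rightarrow> ('a, 'i) weights \<Rightarrow> bool" where
  "semipositive M L \<psi> \<longleftrightarrow> (\<forall>i\<in>lb_idx L. \<forall>(D, \<phi>)\<in>charts M.
     psh (mdim M) (\<phi> ` (D \<inter> lb_dom L i)) (\<lambda>z. \<psi> i (inv_into D \<phi> z)))"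

definition pseudo_effective :: "'a cmfd \<Rightarrow> ('a, 'i) lbundle \<Rightarrow> bool" where
  "pseudo_effective M L \<longleftrightarrow> (\<exists>\<psi>. singular_metric M L \<psi> \<and> semipositive M L \<psi>)"

definition less_sing_at :: "'a cmfd \<Rightarrow> 'a \<Rightarrow> ('a \<Rightarrow> ereal) \<Rightarrow> ('a \<Rightarrow> ereal) \<Rightarrow> bool" where
  "less_sing_at M x \<phi> \<psi> \<longleftrightarrow>
     (\<exists>(A::real) W. openin (mtop M) W \<and> x \<in> W \<and> (\<forall>y\<in>W. \<phi> y \<le> \<psi> y + ereal A))"

definition minimal_singular_metric :: "'a cmfd \<Rightarrow> ('a, 'i) lbundle \<Rightarrow> ('a, 'i) weights \<Rightarrow> bool" where
  "minimal_singular_metric M L \<phi> \<longleftrightarrow> singular_metric M L \<phi> \<and> semipositive M L \<phi> \<and>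
     (\<forall>\<psi>. singular_metric M L \<psi> \<and> semipositive M L \<psi> \<longrightarrow>
        (\<forall>i\<in>lb_idx L. \<forall>x\<in>lb_dom L i. less_sing_at M x (\<psi> i) (\<phi> i)))"

definition metric_pullback :: "('b \<Rightarrow> 'a) \<Rightarrow> ('a, 'i) weights \<Rightarrow> ('b, 'i) weights" where
  "metric_pullback f \<psi> = (\<lambda>i q. \<psi> i (f q))"

definition metric_tensor :: "('a, 'i) weights \<Rightarrow> ('a, 'j) weights \<Rightarrow> ('a, 'i \<times> 'j) weights" where
  "metric_tensor \<phi> \<psi> = (\<lambda>(i, j) x. \<phi> i x + \<psi> j x)"

text \<open>The metric on \<open>\<O>(1)\<close> induced by a Hermitian metric \<open>h\<close> on \<open>F\<^sup>*\<close>: dual to the restriction of \<open>h\<close> to the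
  tautological lines, hence with weight $\log |s_1(x) + w s_2(x)|_h^2$.\<close>

definition O1_metric :: "('c \<Rightarrow> 'i fvec \<Rightarrow> 'i fvec \<Rightarrow> complex) \<Rightarrow> (('c, 'i) ppoint, ('c, 'i) frame) weights" where
  "O1_metric h = (\<lambda>s y. ereal (ln (Re (h (fst y) (frame_gen s y) (frame_gen s y)))))"

end

theory Submission
  imports Defs
begin

text \<open>Over a small open set of the curve, a frame of \<open>F\<^sup>*\<close> that is flat and unitary identifies \<open>\<bbbP>(F)\<close> with
  a product with \<open>\<bbbP>\<^sup>1\<close>, in which the weight of \<open>h\<^bsub>L\<^sub>Y\<^esub>\<close> is the function $\log(1+|w|^2)$ of the fibre
  coordinate alone. Hence for any semi-positive metric on $\widetilde{L}$ with weight \<open>\<psi>\<close>, the slices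
  $p \mapsto \psi(p,w)-\log(1+|w|^2)$ with constant \<open>w\<close> are plurisubharmonic, and so is their supremum over the
  compact fibre \<open>\<bbbP>\<^sup>1\<close>. As $\log(1+|w|^2)$ comes from a unitary frame, this supremum does not depend on the
  frame, and it is the weight of a semi-positive metric on $L_{\widetilde{X}}$ (locally integrable because
  almost every slice is, by Fubini). Comparing it with the minimal singular metric of
  $L_{\widetilde{X}}$ bounds \<open>\<psi>\<close>.\<close>

text \<open>The supremum over a fibre has to run over a compact set of parameters: in one affine
  coordinate the fibre minus a point is the whole plane, and a supremum over the plane need not be
  upper semicontinuous. The fibre is therefore covered by two closed unit discs, one for a flat
  unitary frame and one for the same frame with its two vectors exchanged; log(1+|w|^2) is the
  weight in both, and the supremum is the maximum of two suprema over discs.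

  Charts and trivializations of the fibre product use arbitrary holomorphic frames, and the two may
  differ. To check the product metric, the generator of a line is expanded in a flat basis, which
  turns the weight of O(1) into the logarithm of the squared norm of a holomorphic pair without
  common zeros. For the suprema, the charts and trivializations given by flat frames are enough.

  The final bound is pointwise: a weight is at most the supremum plus the weight of O(1), so a
  constant found on an open set of X serves for all points of the trivialization above it.\<close>

section \<open>Topology and integration on n-space\<close>

lemma topspace_Cn: "topspace (Cn n) = PiE {..<n} (\<lambda>_. UNIV)"
  by (simp add: Cn_def)

lemma continuous_map_Cn_component: "k < n \<Longrightarrow> continuous_map (Cn n) euclidean (\<lambda>z. z k)"
  unfolding Cn_def by (rule continuous_map_product_projection) simp

lemma continuous_map_into_Cn:
  "continuous_map X (Cn n) g \<longleftrightarrow>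
     g ` topspace X \<subseteq> extensional {..<n} \<and> (\<forall>k<n. continuous_map X euclidean (\<lambda>x. g x k))"
  unfolding Cn_def by (subst continuous_map_componentwise) auto

lemma continuous_map_restrict_Cn:
  "continuous_map (Cn (Suc n)) (Cn n) (\<lambda>z. restrict z {..<n})"
  unfolding continuous_map_into_Cn
  by (auto intro: continuous_map_Cn_component)

lemma continuous_map_upd_Cn:
  assumes "continuous_map X (Cn n) g" and "continuous_map X euclidean h"
  shows "continuous_map X (Cn (Suc n)) (\<lambda>x. (g x)(n := h x))"
  using assms unfolding continuous_map_into_Cn
  by (force simp: less_Suc_eq extensional_def)

lemma continuous_map_line_pt: "continuous_map euclidean (Cn n) (line_pt n a b)"
  unfolding continuous_map_into_Cn
  by (auto simp: line_pt_def intro!: continuous_intros)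

lemma line_pt_0: "a \<in> topspace (Cn n) \<Longrightarrow> line_pt n a b 0 = a"
  by (auto simp: line_pt_def topspace_Cn fun_eq_iff PiE_def extensional_def)

lemma Hausdorff_Cn: "Hausdorff_space (Cn n)"
  unfolding Cn_def Hausdorff_space_product_topology by simp

lemma locally_compact_Cn: "locally_compact_space (Cn n)"
proof -
  have "locally_compact_space (euclidean :: complex topology)"
    by (rule locally_compact_space_euclidean)
  then show ?thesis
    unfolding Cn_def locally_compact_space_product_topology by simp
qed

lemma line_pt_in_open:
  assumes "openin (Cn n) W" "a \<in> W"
  obtains R where "R > 0" "\<And>t. cmod t < R \<Longrightarrow> line_pt n a b t \<in> W"
proof -
  have "open {t. line_pt n a b t \<in> W}"
    using openin_continuous_map_preimage[OF continuous_map_line_pt assms(1)] by simp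
  moreover have "0 \<in> {t. line_pt n a b t \<in> W}"
    using assms line_pt_0 openin_subset[OF assms(1)] by (metis mem_Collect_eq subsetD)
  ultimately obtain R where "R > 0" "ball 0 R \<subseteq> {t. line_pt n a b t \<in> W}"
    unfolding open_contains_ball by blast
  then show ?thesis using that[of R] by (auto simp: subset_iff dist_norm)
qed


subsection \<open>Lebesgue measure\<close>

abbreviation Cn_borel :: "nat \<Rightarrow> (nat \<Rightarrow> complex) measure" where
  "Cn_borel n \<equiv> Pi\<^sub>M {..<n} (\<lambda>_. lborel)"

lemma space_Cn_borel: "space (Cn_borel n) = topspace (Cn n)"
  by (simp add: topspace_Cn space_PiM)

text \<open>The plane has a countable basis, so only countably many boxes have their sides in it,
  and those inside \<open>U\<close> exhaust \<open>U\<close>. Each box is measurable, hence so is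
  their countable union.\<close>

lemma openin_Cn_sets:
  assumes U: "openin (Cn n) U"
  shows "U \<in> sets (Cn_borel n)"
proof -
  obtain B :: "complex set set" where B: "countable B" "topological_basis B"
    using ex_countable_basis by blast
  define \<B> where "\<B> = {P \<in> PiE {..<n} ` (PiE {..<n} (\<lambda>_. B)). P \<subseteq> U}"
  have "countable (PiE {..<n} (\<lambda>_::nat. B))"
    by (rule countable_PiE) (use B in auto)
  then have cnt: "countable \<B>"
    unfolding \<B>_def by (auto intro: countable_subset[of _ "PiE {..<n} ` (PiE {..<n} (\<lambda>_. B))"])
  have opB: "\<And>b. b \<in> B \<Longrightarrow> open b" using B topological_basis_open by blast
  have "U = \<Union>\<B>"
  proof
    show "\<Union>\<B> \<subseteq> U" by (auto simp: \<B>_def)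
    show "U \<subseteq> \<Union>\<B>"
    proof
      fix x assume x: "x \<in> U"
      obtain V where V: "\<forall>i\<in>{..<n}. open (V i)" "x \<in> PiE {..<n} V" "PiE {..<n} V \<subseteq> U"
        using U x unfolding Cn_def openin_product_topology_alt by (metis open_openin)
      have "\<forall>i\<in>{..<n}. \<exists>b\<in>B. x i \<in> b \<and> b \<subseteq> V i"
        using V topological_basisE[OF B(2)] by (metis PiE_mem)
      then obtain b where b: "\<And>i. i < n \<Longrightarrow> b i \<in> B \<and> x i \<in> b i \<and> b i \<subseteq> V i"
        by (metis lessThan_iff)
      \<comment> \<open>The choice of sides is made extensional, so that it belongs to the countable
        set over which \<B> is indexed.\<close>
      have "PiE {..<n} (restrict b {..<n}) = PiE {..<n} b" by (rule PiE_cong) simp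
      moreover have "PiE {..<n} b \<subseteq> PiE {..<n} V" using b by (intro PiE_mono) auto
      moreover have "x \<in> PiE {..<n} b" using b V(2) by (auto simp: PiE_iff)
      moreover have "restrict b {..<n} \<in> PiE {..<n} (\<lambda>_. B)" using b by auto
      ultimately have "PiE {..<n} b \<in> \<B>" using V(3) unfolding \<B>_def by (smt (verit) image_eqI mem_Collect_eq subset_trans)
      then show "x \<in> \<Union>\<B>" using \<open>x \<in> PiE {..<n} b\<close> by blast
    qed
  qed
  moreover have "P \<in> sets (Cn_borel n)" if "P \<in> \<B>" for P
    using that opB unfolding \<B>_def by (auto intro!: sets_PiM_I_finite simp: PiE_iff)
  ultimately show ?thesis using cnt by (metis sets.countable_Union subsetI)
qed

lemma compactin_Cn_sets:
  assumes "compactin (Cn n) K"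
  shows "K \<in> sets (Cn_borel n)"
proof -
  have "closedin (Cn n) K" using assms Hausdorff_Cn compactin_imp_closedin by blast
  then have "topspace (Cn n) - (topspace (Cn n) - K) = K" "openin (Cn n) (topspace (Cn n) - K)"
    using closedin_subset by (auto simp: closedin_def)
  then show ?thesis using openin_Cn_sets space_Cn_borel by (metis sets.compl_sets)
qed

lemma product_sigma_finite_lborel: "product_sigma_finite (\<lambda>_::nat. lborel :: complex measure)"
  by (rule product_sigma_finite.intro) (rule lborel.sigma_finite_measure_axioms)

text \<open>A compact set lies in the box of its coordinate projections, and these are compact
  subsets of the plane.\<close>

lemma compactin_Cn_emeasure:
  assumes "compactin (Cn n) K"
  shows "emeasure (Cn_borel n) K < \<infinity>"
proof -
  interpret product_sigma_finite "\<lambda>_::nat. lborel :: complex measure"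
    by (rule product_sigma_finite_lborel)
  define B where "B = (\<lambda>k. (\<lambda>z. z k) ` K)"
  have cB: "compact (B k)" if "k < n" for k
    using image_compactin[OF assms continuous_map_Cn_component[OF that]] by (simp add: B_def)
  have sub: "K \<subseteq> PiE {..<n} B"
    using compactin_subset_topspace[OF assms] by (auto simp: topspace_Cn B_def PiE_def)
  have "emeasure (Cn_borel n) K \<le> emeasure (Cn_borel n) (PiE {..<n} B)"
    using cB sub by (intro emeasure_mono sets_PiM_I_finite) (auto intro: borel_compact)
  also have "\<dots> = (\<Prod>k<n. emeasure lborel (B k))"
    using cB by (intro emeasure_PiM) (auto intro: borel_compact)
  also have "\<dots> < \<infinity>"
  proof -
    have "(\<Prod>k\<in>I. emeasure lborel (B k)) < \<infinity>" if "finite I" "I \<subseteq> {..<n}" for I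
      using that
    proof induction
      case (insert k I)
      then have "emeasure lborel (B k) < \<infinity>" using cB[of k] emeasure_compact_finite by auto
      then show ?case using insert by (simp add: ennreal_mult_less_top)
    qed simp
    then show ?thesis by blast
  qed
  finally show ?thesis .
qed


subsection \<open>Upper semicontinuity\<close>

text \<open>Sublevel sets are required to be open in all of \<open>T\<close>, as in
  \<open>psh\<close>; if \<open>u\<close> < \<infinity> on \<open>W\<close>, the case
  \<open>c\<close> = \<infinity> makes \<open>W\<close> itself open.\<close>

definition usc :: "'a topology \<Rightarrow> 'a set \<Rightarrow> ('a \<Rightarrow> ereal) \<Rightarrow> bool" where
  "usc T W u \<longleftrightarrow> (\<forall>c. openin T {z \<in> W. u z < c})"

lemma usc_cong: "(\<And>z. z \<in> W \<Longrightarrow> u z = v z) \<Longrightarrow> usc T W u \<longleftrightarrow> usc T W v"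
  unfolding usc_def by (metis (mono_tags, lifting) Collect_cong)

lemma usc_local:
  assumes "\<And>x. x \<in> W \<Longrightarrow> \<exists>A. openin T A \<and> x \<in> A \<and> A \<subseteq> W \<and> usc T A u"
  shows "usc T W u"
  unfolding usc_def
proof
  fix c
  show "openin T {z \<in> W. u z < c}"
  proof (subst openin_subopen, intro ballI)
    fix x assume x: "x \<in> {z \<in> W. u z < c}"
    then obtain A where "openin T A" "x \<in> A" "A \<subseteq> W" "usc T A u" using assms by blast
    then show "\<exists>Z. openin T Z \<and> x \<in> Z \<and> Z \<subseteq> {z \<in> W. u z < c}"
      using x unfolding usc_def by (intro exI[of _ "{z \<in> A. u z < c}"]) auto
  qed
qed

text \<open>A real number strictly between \<open>u z\<close> and \<open>c - v z\<close> splits the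
  inequality into a condition on \<open>u\<close> and one on \<open>v\<close>; as \<open>v\<close>
  is finite, it can be moved across in the extended reals.\<close>

lemma usc_add_continuous:
  assumes u: "usc T W u" and W: "openin T W" and v: "continuous_map (subtopology T W) euclidean v"
  shows "usc T W (\<lambda>z. u z + ereal (v z))"
  unfolding usc_def
proof
  fix c
  have op: "openin T {z \<in> W. v z < d}" for d :: real
  proof -
    have "openin (subtopology T W) {z \<in> topspace (subtopology T W). v z \<in> {..<d}}"
      by (rule openin_continuous_map_preimage[OF v]) simp
    moreover have "{z \<in> topspace (subtopology T W). v z \<in> {..<d}} = {z \<in> W. v z < d}"
      using openin_subset[OF W] by auto
    ultimately show ?thesis using openin_trans_full W by metis
  qed
  have op2: "openin T {z \<in> W. ereal (r + v z) < c}" for r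
  proof (cases c)
    case (real c')
    then have "{z \<in> W. ereal (r + v z) < c} = {z \<in> W. v z < c' - r}" by auto
    then show ?thesis using op by simp
  qed (use W in auto)
  have "{z \<in> W. u z + ereal (v z) < c} = (\<Union>r::real. {z \<in> W. u z < ereal r} \<inter> {z \<in> W. ereal (r + v z) < c})"
  proof (intro equalityI subsetI)
    fix z assume z: "z \<in> {z \<in> W. u z + ereal (v z) < c}"
    then have "u z < c - ereal (v z)" by (auto simp: ereal_less_minus)
    then obtain r where "u z < ereal r" "ereal r < c - ereal (v z)" using ereal_dense2 by blast
    then show "z \<in> (\<Union>r::real. {z \<in> W. u z < ereal r} \<inter> {z \<in> W. ereal (r + v z) < c})"
      using z by (auto simp: ereal_less_minus)
  next
    fix z assume "z \<in> (\<Union>r::real. {z \<in> W. u z < ereal r} \<inter> {z \<in> W. ereal (r + v z) < c})"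
    then obtain r :: real where r: "z \<in> W" "u z < ereal r" "ereal (r + v z) < c" by auto
    have "u z + ereal (v z) \<le> ereal r + ereal (v z)" using r by (intro add_right_mono) auto
    then show "z \<in> {z \<in> W. u z + ereal (v z) < c}" using r by auto
  qed
  then show "openin T {z \<in> W. u z + ereal (v z) < c}"
    using u op2 unfolding usc_def by (auto intro!: openin_Union openin_Int)
qed

lemma usc_compose:
  assumes u: "usc T W u" and g: "continuous_map S T g" and B: "openin S B" and sub: "g ` B \<subseteq> W"
  shows "usc S B (\<lambda>z. u (g z))"
  unfolding usc_def
proof
  fix c
  have "{z \<in> B. u (g z) < c} = B \<inter> {z \<in> topspace S. g z \<in> {z \<in> W. u z < c}}"
    using sub openin_subset[OF B] by auto
  moreover have "openin S {z \<in> topspace S. g z \<in> {z \<in> W. u z < c}}"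
    using u unfolding usc_def by (intro openin_continuous_map_preimage[OF g]) blast
  ultimately show "openin S {z \<in> B. u (g z) < c}"
    using B by (simp only: openin_Int)
qed

lemma usc_max:
  assumes "usc T W u" "usc T W v"
  shows "usc T W (\<lambda>z. max (u z) (v z))"
proof -
  have "{z \<in> W. max (u z) (v z) < c} = {z \<in> W. u z < c} \<inter> {z \<in> W. v z < c}" for c by auto
  then show ?thesis using assms unfolding usc_def by auto
qed

text \<open>Otherwise every point of \<open>K\<close> lies in some open set {u < u y} with
  \<open>y\<close> in \<open>K\<close>. Among the finitely many \<open>y\<close> of a subcover, the
  one with the largest value is covered by none of these sets.\<close>

lemma usc_attains_sup:
  assumes u: "usc T W u" and K: "compactin T K" "K \<subseteq> W" "K \<noteq> {}"
  obtains x where "x \<in> K" "\<And>y. y \<in> K \<Longrightarrow> u y \<le> u x"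
proof (rule ccontr)
  assume "\<not> thesis"
  then have *: "\<forall>x\<in>K. \<exists>y\<in>K. u x < u y" using that by (meson not_le)
  define \<U> where "\<U> = (\<lambda>y. {z \<in> W. u z < u y}) ` K"
  have "\<forall>U\<in>\<U>. openin T U" "K \<subseteq> \<Union>\<U>"
    using u K * unfolding \<U>_def usc_def by auto
  then obtain \<F> where F: "finite \<F>" "\<F> \<subseteq> \<U>" "K \<subseteq> \<Union>\<F>"
    using K(1) unfolding compactin_def by meson
  then obtain D where D: "finite D" "D \<subseteq> K" "\<F> = (\<lambda>y. {z \<in> W. u z < u y}) ` D"
    unfolding \<U>_def by (meson finite_subset_image)
  have "D \<noteq> {}" using F D K by auto
  have "Max (u ` D) \<in> u ` D" using D \<open>D \<noteq> {}\<close> by (intro Max_in) auto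
  then obtain x where x: "x \<in> D" "u x = Max (u ` D)" by auto
  then have "x \<in> \<Union>\<F>" using D(2) F(3) by blast
  then obtain y where "y \<in> D" "u x < u y" using D by auto
  then show False using x D by (simp add: leD)
qed

lemma usc_bounded_above:
  assumes u: "usc T W u" and K: "compactin T K" "K \<subseteq> W" and fin: "\<And>z. z \<in> K \<Longrightarrow> u z < \<infinity>"
  obtains M :: real where "\<And>z. z \<in> K \<Longrightarrow> u z \<le> ereal M"
proof (cases "K = {}")
  case True then show ?thesis using that by auto
next
  case False
  obtain x where x: "x \<in> K" "\<And>y. y \<in> K \<Longrightarrow> u y \<le> u x" using usc_attains_sup[OF u K False] by blast
  show ?thesis
  proof (rule that[of "real_of_ereal (u x)"])
    fix z assume "z \<in> K"
    then have "u z \<le> u x" using x by blast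
    then show "u z \<le> ereal (real_of_ereal (u x))" using fin[OF x(1)] by (cases "u x") auto
  qed
qed

text \<open>Weights matter only on \<open>W\<close>; extension by 0 gives a Borel function on all of
  n-space. The same extension reappears as \<open>u'\<close> in the integrability lemmas.\<close>

lemma usc_measurable:
  assumes W: "openin (Cn n) W" and u: "usc (Cn n) W u"
  shows "(\<lambda>z. if z \<in> W then u z else 0) \<in> borel_measurable (Cn_borel n)"
proof (rule borel_measurableI_less)
  fix c :: ereal
  have "{z \<in> space (Cn_borel n). (if z \<in> W then u z else 0) < c} =
      {z \<in> W. u z < c} \<union> (if 0 < c then space (Cn_borel n) - W else {})"
    using openin_subset[OF W] by (auto simp: space_Cn_borel)
  moreover have "{z \<in> W. u z < c} \<in> sets (Cn_borel n)" "W \<in> sets (Cn_borel n)"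
    using u W openin_Cn_sets unfolding usc_def by blast+
  ultimately show "{z \<in> space (Cn_borel n). (if z \<in> W then u z else 0) < c} \<in> sets (Cn_borel n)"
    by (cases "0 < c") (simp_all only: if_True if_False sets.Un sets.compl_sets sets.empty_sets)
qed


subsection \<open>Local integrability\<close>

text \<open>An integral in [0,\<infinity>] for the uncompleted product measure. For measurable
  \<open>u\<close>, its finiteness says in one condition that \<open>u\<close> is finite almost
  everywhere on \<open>K\<close> and integrable there, and it can be handled by monotonicity and
  Tonelli.\<close>

definition absint :: "nat \<Rightarrow> (nat \<Rightarrow> complex) set \<Rightarrow> ((nat \<Rightarrow> complex) \<Rightarrow> ereal) \<Rightarrow> ennreal" where
  "absint n K u = (\<integral>\<^sup>+ z. e2ennreal \<bar>u z\<bar> * indicator K z \<partial>Cn_borel n)"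

lemma absint_cong: "(\<And>z. z \<in> K \<Longrightarrow> u z = v z) \<Longrightarrow> absint n K u = absint n K v"
  unfolding absint_def by (intro nn_integral_cong) (auto simp: indicator_def)

text \<open>Finiteness of the integral of |u| forces |u| < \<infinity> almost everywhere, and where
  |u| is finite \<open>real_of_ereal\<close> loses nothing. Upper semicontinuity makes
  \<open>u\<close> Borel on \<open>W\<close>, so the completed and the uncompleted measure agree on
  it.\<close>

lemma loc_integrable_iff_absint:
  assumes W: "openin (Cn n) W" and u: "usc (Cn n) W u"
  shows "loc_integrable n W u \<longleftrightarrow> (\<forall>K. compactin (Cn n) K \<and> K \<subseteq> W \<longrightarrow> absint n K u < \<infinity>)"
proof -
  define u' where "u' = (\<lambda>z. if z \<in> W then u z else 0)"
  have [measurable]: "u' \<in> borel_measurable (Cn_borel n)"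
    unfolding u'_def by (rule usc_measurable[OF W u])
  have "((AE z in Cn_lebesgue n. z \<in> K \<longrightarrow> \<bar>u z\<bar> \<noteq> \<infinity>) \<and>
      set_integrable (Cn_lebesgue n) K (\<lambda>z. real_of_ereal (u z))) \<longleftrightarrow> absint n K u < \<infinity>"
    (is "?L \<longleftrightarrow> ?R") if K: "compactin (Cn n) K" "K \<subseteq> W" for K
  proof -
    note [measurable] = compactin_Cn_sets[OF K(1)]
    have eq: "u z = u' z" if "z \<in> K" for z using that K by (auto simp: u'_def)
    have "(AE z in Cn_lebesgue n. z \<in> K \<longrightarrow> \<bar>u z\<bar> \<noteq> \<infinity>) \<longleftrightarrow> (AE z in Cn_lebesgue n. z \<in> K \<longrightarrow> \<bar>u' z\<bar> \<noteq> \<infinity>)"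
      by (rule AE_cong) (use eq in auto)
    also have "\<dots> \<longleftrightarrow> (AE z in Cn_borel n. z \<in> K \<longrightarrow> \<bar>u' z\<bar> \<noteq> \<infinity>)"
      unfolding Cn_lebesgue_def by (rule AE_completion_iff)
    finally have 1: "(AE z in Cn_lebesgue n. z \<in> K \<longrightarrow> \<bar>u z\<bar> \<noteq> \<infinity>) \<longleftrightarrow> (AE z in Cn_borel n. z \<in> K \<longrightarrow> \<bar>u' z\<bar> \<noteq> \<infinity>)" .
    have "(\<lambda>z. indicator K z *\<^sub>R real_of_ereal (u z)) = (\<lambda>z. indicator K z *\<^sub>R real_of_ereal (u' z))"
      using eq by (auto simp: indicator_def)
    then have "set_integrable (Cn_lebesgue n) K (\<lambda>z. real_of_ereal (u z)) \<longleftrightarrow>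
        integrable (Cn_borel n) (\<lambda>z. indicator K z *\<^sub>R real_of_ereal (u' z))"
      unfolding set_integrable_def Cn_lebesgue_def by (simp add: integrable_completion)
    also have "\<dots> \<longleftrightarrow> (\<integral>\<^sup>+ z. ennreal (norm (indicator K z *\<^sub>R real_of_ereal (u' z))) \<partial>Cn_borel n) < \<infinity>"
      by (subst integrable_iff_bounded) simp
    finally have 2: "set_integrable (Cn_lebesgue n) K (\<lambda>z. real_of_ereal (u z)) \<longleftrightarrow>
        (\<integral>\<^sup>+ z. ennreal (norm (indicator K z *\<^sub>R real_of_ereal (u' z))) \<partial>Cn_borel n) < \<infinity>" .
    have 3: "absint n K u = (\<integral>\<^sup>+ z. e2ennreal \<bar>u' z\<bar> * indicator K z \<partial>Cn_borel n)"
      using absint_cong[OF eq] by (simp add: absint_def)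
    have 4: "(\<integral>\<^sup>+ z. e2ennreal \<bar>u' z\<bar> * indicator K z \<partial>Cn_borel n) =
        (\<integral>\<^sup>+ z. ennreal (norm (indicator K z *\<^sub>R real_of_ereal (u' z))) \<partial>Cn_borel n)"
      if "AE z in Cn_borel n. z \<in> K \<longrightarrow> \<bar>u' z\<bar> \<noteq> \<infinity>"
    proof (rule nn_integral_cong_AE)
      show "AE z in Cn_borel n. e2ennreal \<bar>u' z\<bar> * indicator K z = ennreal (norm (indicator K z *\<^sub>R real_of_ereal (u' z)))"
        using that
      proof eventually_elim
        fix z assume "z \<in> K \<longrightarrow> \<bar>u' z\<bar> \<noteq> \<infinity>"
        then show "e2ennreal \<bar>u' z\<bar> * indicator K z = ennreal (norm (indicator K z *\<^sub>R real_of_ereal (u' z)))"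
          by (cases "u' z") (auto simp: indicator_def)
      qed
    qed
    have 5: "AE z in Cn_borel n. z \<in> K \<longrightarrow> \<bar>u' z\<bar> \<noteq> \<infinity>" if ?R
    proof -
      have "AE z in Cn_borel n. e2ennreal \<bar>u' z\<bar> * indicator K z \<noteq> \<infinity>"
        using that unfolding 3 by (intro nn_integral_PInf_AE) auto
      then show ?thesis
      proof eventually_elim
        fix z assume "e2ennreal \<bar>u' z\<bar> * indicator K z \<noteq> \<infinity>"
        then show "z \<in> K \<longrightarrow> \<bar>u' z\<bar> \<noteq> \<infinity>" by (auto simp: indicator_def)
      qed
    qed
    show ?thesis
    proof
      assume L: ?L
      then show ?R using 1 2 3 4 by simp
    next
      assume R: ?R
      then show ?L using 1 2 3 4[OF 5[OF R]] 5[OF R] by simp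
    qed
  qed
  then show ?thesis
    unfolding loc_integrable_def by (intro all_cong1 imp_cong refl) (erule conjE, assumption)
qed

text \<open>By local compactness each point of \<open>K\<close> has a compact neighbourhood with
  finite integral; finitely many of them cover \<open>K\<close>, and the integral over
  \<open>K\<close> is at most the sum of theirs.\<close>

lemma absint_local:
  assumes W: "openin (Cn n) W" and u: "usc (Cn n) W u"
    and loc: "\<And>x. x \<in> W \<Longrightarrow> \<exists>A. openin (Cn n) A \<and> x \<in> A \<and> A \<subseteq> W \<and>
        (\<forall>K. compactin (Cn n) K \<and> K \<subseteq> A \<longrightarrow> absint n K u < \<infinity>)"
    and K: "compactin (Cn n) K" "K \<subseteq> W"
  shows "absint n K u < \<infinity>"
proof -
  have nb: "neighbourhood_base_of (compactin (Cn n)) (Cn n)"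
    using locally_compact_Cn Hausdorff_Cn locally_compact_space_neighbourhood_base by blast
  have "\<exists>U N. openin (Cn n) U \<and> x \<in> U \<and> U \<subseteq> N \<and> N \<subseteq> W \<and> compactin (Cn n) N \<and> absint n N u < \<infinity>" if "x \<in> K" for x
  proof -
    from loc[OF subsetD[OF K(2) that]] obtain A where A: "openin (Cn n) A \<and> x \<in> A \<and> A \<subseteq> W \<and>
        (\<forall>K. compactin (Cn n) K \<and> K \<subseteq> A \<longrightarrow> absint n K u < \<infinity>)"
      by (rule exE)
    then have "\<exists>U N. openin (Cn n) U \<and> compactin (Cn n) N \<and> x \<in> U \<and> U \<subseteq> N \<and> N \<subseteq> A"
      using nb[unfolded neighbourhood_base_of, rule_format, of A x] by simp
    then obtain U N where UN: "openin (Cn n) U" "compactin (Cn n) N" "x \<in> U" "U \<subseteq> N" "N \<subseteq> A"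
      by (elim exE conjE)
    moreover have "absint n N u < \<infinity>" using A UN by simp
    moreover have "N \<subseteq> W" using A UN by (meson subset_trans)
    ultimately show ?thesis by (intro exI[of _ U] exI[of _ N]) simp
  qed
  then obtain U N where UN: "\<And>x. x \<in> K \<Longrightarrow> openin (Cn n) (U x) \<and> x \<in> U x \<and> U x \<subseteq> N x \<and> N x \<subseteq> W \<and>
       compactin (Cn n) (N x) \<and> absint n (N x) u < \<infinity>"
    by metis
  then have "\<forall>V\<in>U ` K. openin (Cn n) V" "K \<subseteq> \<Union>(U ` K)" by auto
  then obtain \<F> where F: "finite \<F>" "\<F> \<subseteq> U ` K" "K \<subseteq> \<Union>\<F>"
    using K(1) unfolding compactin_def by meson
  then obtain D where D: "finite D" "D \<subseteq> K" "\<F> = U ` D" by (meson finite_subset_image)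
  define u' where "u' = (\<lambda>z. if z \<in> W then u z else 0)"
  have [measurable]: "u' \<in> borel_measurable (Cn_borel n)"
    unfolding u'_def by (rule usc_measurable[OF W u])
  have [measurable]: "N x \<in> sets (Cn_borel n)" if "x \<in> D" for x
    using UN D that compactin_Cn_sets by blast
  have eq: "absint n (N x) u = (\<integral>\<^sup>+ z. e2ennreal \<bar>u' z\<bar> * indicator (N x) z \<partial>Cn_borel n)" if "x \<in> D" for x
    using UN D that absint_cong[of "N x" u u' n] unfolding u'_def absint_def by (auto simp: subset_iff)
  have "absint n K u = absint n K u'"
    using K by (intro absint_cong) (auto simp: u'_def)
  also have "\<dots> \<le> (\<integral>\<^sup>+ z. (\<Sum>x\<in>D. e2ennreal \<bar>u' z\<bar> * indicator (N x) z) \<partial>Cn_borel n)"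
    unfolding absint_def
  proof (rule nn_integral_mono)
    fix z
    show "e2ennreal \<bar>u' z\<bar> * indicator K z \<le> (\<Sum>x\<in>D. e2ennreal \<bar>u' z\<bar> * indicator (N x) z)"
    proof (cases "z \<in> K")
      case True
      then obtain x where "x \<in> D" "z \<in> U x" using F(3) D(3) by auto
      then have "z \<in> N x" using UN[of x] D(2) by (meson subsetD)
      have "e2ennreal \<bar>u' z\<bar> * indicator (N x) z \<le> (\<Sum>x\<in>D. e2ennreal \<bar>u' z\<bar> * indicator (N x) z)"
        using D(1) \<open>x \<in> D\<close> by (intro member_le_sum) auto
      then show ?thesis using True \<open>z \<in> N x\<close> by simp
    qed simp
  qed
  also have "\<dots> = (\<Sum>x\<in>D. absint n (N x) u)"
    using D(1) by (subst nn_integral_sum) (auto simp: eq)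
  also have "\<dots> < \<infinity>"
  proof -
    have "absint n (N x) u < \<infinity>" if "x \<in> D" for x
      using UN[of x] D(2) that by (meson subsetD)
    then show ?thesis using D(1) by (simp add: less_top)
  qed
  finally show ?thesis .
qed

section \<open>Plurisubharmonic functions on n-space\<close>

subsection \<open>Means over circles\<close>

text \<open>The mean as a functional of the boundary values alone, so that it can be studied in one
  real variable.\<close>

definition ext_mean :: "(real \<Rightarrow> ereal) \<Rightarrow> ereal" where
  "ext_mean v = enn2ereal (\<integral>\<^sup>+ \<theta>\<in>{0..1}. e2ennreal (v \<theta>) \<partial>lborel) - enn2ereal (\<integral>\<^sup>+ \<theta>\<in>{0..1}. e2ennreal (- v \<theta>) \<partial>lborel)"

lemma circle_mean_eq_ext_mean:
  "circle_mean n u a b r = ext_mean (\<lambda>\<theta>. u (line_pt n a b (of_real r * cis (2 * pi * \<theta>))))"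
  by (simp add: circle_mean_def ext_mean_def Let_def)

text \<open>Monotonicity of the nonnegative integral holds for arbitrary functions. The mean of a
  supremum can thus be bounded below by the mean of a slice with no measurability argument for the
  supremum.\<close>

lemma ext_mean_mono:
  assumes "\<And>\<theta>. v \<theta> \<le> w \<theta>"
  shows "ext_mean v \<le> ext_mean w"
  unfolding ext_mean_def
proof (rule ereal_minus_mono)
  show "enn2ereal (\<integral>\<^sup>+ \<theta>\<in>{0..1}. e2ennreal (v \<theta>) \<partial>lborel) \<le> enn2ereal (\<integral>\<^sup>+ \<theta>\<in>{0..1}. e2ennreal (w \<theta>) \<partial>lborel)"
    using assms by (auto simp: less_eq_ennreal.rep_eq[symmetric] intro!: nn_integral_mono mult_right_mono e2ennreal_mono)
  show "enn2ereal (\<integral>\<^sup>+ \<theta>\<in>{0..1}. e2ennreal (- w \<theta>) \<partial>lborel) \<le> enn2ereal (\<integral>\<^sup>+ \<theta>\<in>{0..1}. e2ennreal (- v \<theta>) \<partial>lborel)"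
    using assms by (auto simp: less_eq_ennreal.rep_eq[symmetric] intro!: nn_integral_mono mult_right_mono e2ennreal_mono)
qed

text \<open>\<open>ennreal\<close> of a real number is its positive part. This is the decomposition
  of x, y and x + y into positive and negative parts with all negative parts moved across, so that
  nothing is subtracted in [0,\<infinity>].\<close>

lemma ennreal_parts_add:
  "ennreal (x + y) + ennreal (- x) + ennreal (- y) = ennreal (- (x + y)) + ennreal x + ennreal y"
proof -
  have "ennreal t = ennreal (max 0 t)" for t by (cases "t \<ge> 0") (auto simp: ennreal_neg max_def)
  then have "ennreal (x + y) + ennreal (- x) + ennreal (- y) = ennreal (max 0 (x + y) + max 0 (-x) + max 0 (- y))"
    "ennreal (- (x + y)) + ennreal x + ennreal y = ennreal (max 0 (- (x + y)) + max 0 x + max 0 y)"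
    by (metis ennreal_plus max.cobounded1 add_nonneg_nonneg)+
  moreover have "max 0 (x + y) + max 0 (-x) + max 0 (- y) = max 0 (- (x + y)) + max 0 x + max 0 y"
    by (auto simp: max_def)
  ultimately show ?thesis by simp
qed

lemma e2ennreal_parts_add:
  "e2ennreal (v + ereal y) + e2ennreal (- v) + ennreal (- y) = e2ennreal (- (v + ereal y)) + e2ennreal v + ennreal y"
proof (cases v)
  case (real x)
  then show ?thesis using ennreal_parts_add[of x y] by simp
qed auto

text \<open>The integrals of the positive and negative parts of the continuous function
  \<open>h\<close> are finite, so infinite values come from \<open>v\<close> alone. A bound through
  \<open>u0\<close> is what a submean inequality asks for, and it keeps the infinite cases
  short.\<close>

lemma ext_mean_add:
  assumes v[measurable]: "v \<in> borel_measurable borel" and h: "continuous_on UNIV h" and h0: "(h has_integral h0) {0..1}"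
    and u0: "u0 \<le> ext_mean v"
  shows "u0 + ereal h0 \<le> ext_mean (\<lambda>\<theta>. v \<theta> + ereal (h \<theta>))"
proof -
  have [measurable]: "h \<in> borel_measurable borel"
    using h by (rule borel_measurable_continuous_onI)
  let ?I = "indicator {0..1::real} :: real \<Rightarrow> ennreal"
  define P where "P = (\<integral>\<^sup>+ \<theta>. e2ennreal (v \<theta>) * ?I \<theta> \<partial>lborel)"
  define N where "N = (\<integral>\<^sup>+ \<theta>. e2ennreal (- v \<theta>) * ?I \<theta> \<partial>lborel)"
  define P' where "P' = (\<integral>\<^sup>+ \<theta>. e2ennreal (v \<theta> + ereal (h \<theta>)) * ?I \<theta> \<partial>lborel)"
  define N' where "N' = (\<integral>\<^sup>+ \<theta>. e2ennreal (- (v \<theta> + ereal (h \<theta>))) * ?I \<theta> \<partial>lborel)"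
  define Ph where "Ph = (\<integral>\<^sup>+ \<theta>. ennreal (h \<theta>) * ?I \<theta> \<partial>lborel)"
  define Nh where "Nh = (\<integral>\<^sup>+ \<theta>. ennreal (- h \<theta>) * ?I \<theta> \<partial>lborel)"
  have int: "set_integrable lborel {0..1} h"
    using h by (intro borel_integrable_atLeastAtMost') (auto intro: continuous_on_subset)
  then have int': "integrable lborel (\<lambda>\<theta>. indicator {0..1} \<theta> * h \<theta>)" by (simp add: set_integrable_def)
  have eqs: "(\<lambda>\<theta>. ennreal (indicator {0..1} \<theta> * h \<theta>)) = (\<lambda>\<theta>. ennreal (h \<theta>) * ?I \<theta>)"
    "(\<lambda>\<theta>. ennreal (- (indicator {0..1} \<theta> * h \<theta>))) = (\<lambda>\<theta>. ennreal (- h \<theta>) * ?I \<theta>)"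
    by (auto simp: indicator_def)
  have fin: "Ph \<noteq> \<infinity>" "Nh \<noteq> \<infinity>"
    using int' unfolding real_integrable_def eqs Ph_def Nh_def by auto
  have "h0 = integral {0..1} h" using h0 by (simp add: integral_unique)
  also have "\<dots> = (LINT \<theta>:{0..1}|lborel. h \<theta>)"
    using set_borel_integral_eq_integral(2)[OF int] by simp
  also have "\<dots> = enn2real Ph - enn2real Nh"
    using real_lebesgue_integral_def[OF int'] unfolding eqs Ph_def Nh_def set_lebesgue_integral_def by simp
  finally have h0': "h0 = enn2real Ph - enn2real Nh" .
  \<comment> \<open>The integrated form of \<open>e2ennreal_parts_add\<close>; once all terms are
    finite, it reads P' - N' = (P - N) + (Ph - Nh).\<close>
  have id: "P' + N + Nh = N' + P + Ph"
    unfolding P'_def N_def Nh_def N'_def P_def Ph_def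
    by (subst nn_integral_add[symmetric], measurable)+
      (intro nn_integral_cong, simp flip: distrib_right add: e2ennreal_parts_add)
  \<comment> \<open>The positive part of v is at most that of v + h plus the negative part of h. As
    \<open>Nh\<close> is finite, an infinite \<open>P\<close> makes \<open>P'\<close>
    infinite.\<close>
  have le: "P \<le> P' + Nh"
    unfolding P_def P'_def Nh_def
  proof (subst nn_integral_add[symmetric], measurable, rule nn_integral_mono)
    fix \<theta>
    have "e2ennreal (v \<theta>) \<le> e2ennreal (v \<theta> + ereal (h \<theta>)) + ennreal (- h \<theta>)"
    proof (cases "v \<theta>")
      case (real x)
      have "ennreal x \<le> ennreal (max 0 (x + h \<theta>) + max 0 (- h \<theta>))" by (intro ennreal_leI) (auto simp: max_def)
      also have "\<dots> = ennreal (x + h \<theta>) + ennreal (- h \<theta>)"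
        by (subst ennreal_plus) (auto simp: max_def ennreal_neg)
      finally show ?thesis using real by simp
    qed auto
    then show "e2ennreal (v \<theta>) * ?I \<theta> \<le> e2ennreal (v \<theta> + ereal (h \<theta>)) * ?I \<theta> + ennreal (- h \<theta>) * ?I \<theta>"
      by (auto simp: indicator_def)
  qed
  obtain ph nh where ph: "Ph = ennreal ph" "ph \<ge> 0" "Nh = ennreal nh" "nh \<ge> 0"
    using fin by (cases Ph; cases Nh) auto
  have h0'': "h0 = ph - nh" using h0' ph by simp
  have u0': "u0 \<le> enn2ereal P - enn2ereal N"
    using u0 unfolding ext_mean_def P_def N_def .
  \<comment> \<open>If \<open>P'\<close> is infinite, the right-hand side is \<infinity> whatever
    \<open>N'\<close> is, because \<infinity> - \<infinity> = \<infinity> in \<open>ereal\<close>.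
    If \<open>P\<close> is finite and \<open>N\<close> infinite, then \<open>u0\<close> =
    -\<infinity>.\<close>
  have "u0 + ereal h0 \<le> enn2ereal P' - enn2ereal N'"
  proof (cases "P = \<infinity>")
    case True
    then have "P' = \<infinity>" using le ph by (cases P') (auto simp flip: ennreal_plus simp: top_unique)
    then show ?thesis by simp
  next
    case False
    then obtain p where p: "P = ennreal p" "p \<ge> 0" by (cases P) auto
    show ?thesis
    proof (cases "N = \<infinity>")
      case True
      then have "u0 = -\<infinity>" using u0' p by simp
      then show ?thesis by simp
    next
      case False
      then obtain nn where nn: "N = ennreal nn" "nn \<ge> 0" by (cases N) auto
      show ?thesis
      proof (cases P')
        case top
        then show ?thesis by simp
      next
        case (real p')
        then have "N' \<noteq> \<infinity>" using id nn ph p by (auto simp flip: ennreal_plus)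
        then obtain n' where n': "N' = ennreal n'" "n' \<ge> 0" by (cases N') auto
        have "p' + nn + nh = n' + p + ph"
          using id real nn ph p n' by (simp flip: ennreal_plus)
        moreover have "u0 \<le> ereal (p - nn)" using u0' p nn by (simp add: enn2ereal_ennreal)
        ultimately show ?thesis using real n' h0'' by (cases u0) (auto simp: enn2ereal_ennreal)
      qed
    qed
  qed
  then show ?thesis unfolding ext_mean_def P'_def N'_def .
qed

text \<open>On the circle, dz/z is 2 pi i times the differential of the parameter in [0,1]; so
  Cauchy's formula at the centre becomes the mean value property after cancelling 2 pi i.\<close>

lemma mean_value_Re_holomorphic:
  assumes k: "k holomorphic_on ball 0 R" and r: "0 < r" "r < R"
  shows "((\<lambda>\<theta>. Re (k (of_real r * cis (2 * pi * \<theta>)))) has_integral Re (k 0)) {0..1}"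
proof -
  have "k holomorphic_on cball 0 r"
    by (rule holomorphic_on_subset[OF k]) (use r in auto)
  then have "((\<lambda>u. k u / (u - 0)) has_contour_integral (2 * of_real pi * \<i> * k 0)) (circlepath 0 r)"
    using r by (intro Cauchy_integral_circlepath_simple) auto
  then have "((\<lambda>x. k (circlepath 0 r x) / circlepath 0 r x * vector_derivative (circlepath 0 r) (at x within {0..1}))
      has_integral (2 * of_real pi * \<i> * k 0)) {0..1}"
    unfolding has_contour_integral_def by simp
  then have "((\<lambda>x. (2 * of_real pi * \<i>) * k (of_real r * cis (2 * pi * x))) has_integral (2 * of_real pi * \<i> * k 0)) {0..1}"
  proof (rule has_integral_eq[rotated])
    fix x :: real assume "x \<in> {0..1}"
    then show "k (circlepath 0 r x) / circlepath 0 r x * vector_derivative (circlepath 0 r) (at x within {0..1})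
       = (2 * of_real pi * \<i>) * k (of_real r * cis (2 * pi * x))"
    proof -
      have "vector_derivative (circlepath 0 r) (at x within {0..1}) = 2 * of_real pi * \<i> * r * exp (2 * of_real pi * \<i> * x)"
        using \<open>x \<in> {0..1}\<close> by (subst vector_derivative_circlepath01) auto
      moreover have c: "circlepath 0 r x = of_real r * cis (2 * pi * x)"
        by (simp add: circlepath cis_conv_exp mult_ac)
      moreover have "of_real r * exp (2 * of_real pi * \<i> * x) = circlepath 0 r x"
        by (simp add: circlepath)
      moreover have "circlepath 0 r x \<noteq> 0" using r by (simp add: circlepath)
      ultimately show ?thesis by (simp add: field_simps)
    qed
  qed
  from has_integral_mult_right[OF this, of "inverse (2 * of_real pi * \<i>)"]
  have "((\<lambda>x. k (of_real r * cis (2 * pi * x))) has_integral k 0) {0..1}"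
    by (simp add: field_simps)
  from has_integral_linear[OF this bounded_linear_Re] show ?thesis by (simp add: o_def)
qed


subsection \<open>Submean inequality and local character\<close>

lemma psh_iff:
  "psh n W u \<longleftrightarrow> (\<forall>z\<in>W. u z < \<infinity>) \<and> usc (Cn n) W u \<and>
     (\<forall>a\<in>W. \<forall>b. \<exists>R>0. \<forall>r. 0 < r \<and> r < R \<longrightarrow> u a \<le> circle_mean n u a b r)"
  by (simp add: psh_def usc_def)

text \<open>The common source of \<open>psh_local\<close>, \<open>psh_compact_sup\<close> and
  \<open>psh_restrict_add\<close>: if, along a complex line, \<open>w\<close> lies above a
  plurisubharmonic function plus the harmonic function Re k, the value of that sum at the centre is
  a lower bound for the mean of \<open>w\<close>. The two lines may lie in different dimensions,
  because one function will be a slice or a projection of the other.\<close>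

lemma submean_add_harmonic:
  assumes u: "psh n A u" and A: "openin (Cn n) A" and x: "x \<in> A"
    and k: "k holomorphic_on ball 0 R0" "R0 > 0"
    and le: "\<And>t. cmod t < R0 \<Longrightarrow> u (line_pt n x y t) + ereal (Re (k t)) \<le> w (line_pt m a b t)"
  shows "\<exists>R>0. \<forall>r. 0 < r \<and> r < R \<longrightarrow> u x + ereal (Re (k 0)) \<le> circle_mean m w a b r"
proof -
  obtain R1 where R1: "R1 > 0" "\<And>r. 0 < r \<Longrightarrow> r < R1 \<Longrightarrow> u x \<le> circle_mean n u x y r"
    using u x unfolding psh_iff by blast
  obtain R2 where R2: "R2 > 0" "\<And>t. cmod t < R2 \<Longrightarrow> line_pt n x y t \<in> A"
    using line_pt_in_open[OF A x] by blast
  have "u x + ereal (Re (k 0)) \<le> circle_mean m w a b r" if r: "0 < r" "r < min R0 (min R1 R2)" for r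
  proof -
    define c where "c = (\<lambda>\<theta>. of_real r * cis (2 * pi * \<theta>))"
    have cr: "cmod (c \<theta>) = r" for \<theta> using r by (simp add: c_def norm_mult)
    have cc: "continuous_on UNIV c"
      unfolding c_def cis_conv_exp by (intro continuous_intros)
    \<comment> \<open>Sublevel sets of \<open>u\<close> are known to be open only inside
      \<open>A\<close>; a radius below \<open>R2\<close> keeps the circle there.\<close>
    have "(\<lambda>\<theta>. u (line_pt n x y (c \<theta>))) \<in> borel_measurable borel"
    proof (rule borel_measurableI_less)
      fix d
      have "open {t. line_pt n x y t \<in> {z \<in> A. u z < d}}"
        using openin_continuous_map_preimage[OF continuous_map_line_pt, of n "{z \<in> A. u z < d}" x y] u
        unfolding psh_iff usc_def by simp
      then have "open (c -` {t. line_pt n x y t \<in> {z \<in> A. u z < d}})"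
        by (rule open_vimage[OF _ cc])
      moreover have "{\<theta> \<in> space borel. u (line_pt n x y (c \<theta>)) < d} = c -` {t. line_pt n x y t \<in> {z \<in> A. u z < d}}"
        using R2 cr r by auto
      ultimately show "{\<theta> \<in> space borel. u (line_pt n x y (c \<theta>)) < d} \<in> sets borel" by simp
    qed
    moreover have "continuous_on UNIV (\<lambda>\<theta>. Re (k (c \<theta>)))"
    proof (intro continuous_intros continuous_on_compose2[of "ball 0 R0" k UNIV c] cc)
      show "continuous_on (ball 0 R0) k" using k by (simp add: holomorphic_on_imp_continuous_on)
      show "range c \<subseteq> ball 0 R0" using cr r by auto
    qed
    moreover have "((\<lambda>\<theta>. Re (k (c \<theta>))) has_integral Re (k 0)) {0..1}"
      unfolding c_def using mean_value_Re_holomorphic[OF k(1)] r by simp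
    moreover have "u x \<le> ext_mean (\<lambda>\<theta>. u (line_pt n x y (c \<theta>)))"
      using R1(2)[of r] r unfolding circle_mean_eq_ext_mean c_def by simp
    ultimately have "u x + ereal (Re (k 0)) \<le> ext_mean (\<lambda>\<theta>. u (line_pt n x y (c \<theta>)) + ereal (Re (k (c \<theta>))))"
      by (rule ext_mean_add)
    also have "\<dots> \<le> ext_mean (\<lambda>\<theta>. w (line_pt m a b (c \<theta>)))"
      by (rule ext_mean_mono, rule le) (use cr r in auto)
    finally show ?thesis unfolding circle_mean_eq_ext_mean c_def .
  qed
  then show ?thesis using k(2) R1(1) R2(1) by (intro exI[of _ "min R0 (min R1 R2)"]) simp
qed

text \<open>The radius in the submean inequality may depend on the point and the direction, so it
  can be shrunk until the disc stays where \<open>u\<close> and \<open>v\<close> agree.\<close>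

lemma psh_local:
  assumes "\<And>x. x \<in> W \<Longrightarrow> \<exists>A v. openin (Cn n) A \<and> x \<in> A \<and> A \<subseteq> W \<and> (\<forall>z\<in>A. u z = v z) \<and> psh n A v"
  shows "psh n W u"
  unfolding psh_iff
proof (intro conjI ballI allI)
  fix x assume "x \<in> W"
  from assms[OF this] obtain A v where A: "openin (Cn n) A" "x \<in> A" "A \<subseteq> W" "\<forall>z\<in>A. u z = v z" "psh n A v"
    by (elim exE conjE)
  then show "u x < \<infinity>" unfolding psh_iff by metis
  fix b
  obtain R where R: "R > 0" "\<And>t. cmod t < R \<Longrightarrow> line_pt n x b t \<in> A"
    using line_pt_in_open[OF A(1,2)] by blast
  have "\<exists>R>0. \<forall>r. 0 < r \<and> r < R \<longrightarrow> v x + ereal (Re 0) \<le> circle_mean n u x b r"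
    by (rule submean_add_harmonic[OF A(5,1,2), of "\<lambda>_. 0" R b u n x b]) (use R A(4) in \<open>auto simp: zero_ereal_def[symmetric]\<close>)
  then show "\<exists>R>0. \<forall>r. 0 < r \<and> r < R \<longrightarrow> u x \<le> circle_mean n u x b r"
    using A(2,4) by (simp add: zero_ereal_def[symmetric])
next
  show "usc (Cn n) W u"
  proof (rule usc_local)
    fix x assume "x \<in> W"
    from assms[OF this] obtain A v where A: "openin (Cn n) A" "x \<in> A" "A \<subseteq> W" "\<forall>z\<in>A. u z = v z" "psh n A v"
      by (elim exE conjE)
    then have "usc (Cn n) A u" using usc_cong[of A u v "Cn n"] unfolding psh_iff by simp
    then show "\<exists>A. openin (Cn n) A \<and> x \<in> A \<and> A \<subseteq> W \<and> usc (Cn n) A u" using A by blast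
  qed
qed

lemma psh_max:
  assumes u: "psh n W u" and v: "psh n W v"
  shows "psh n W (\<lambda>z. max (u z) (v z))"
  unfolding psh_iff
proof (intro conjI ballI allI)
  show "max (u z) (v z) < \<infinity>" if "z \<in> W" for z using u v that unfolding psh_iff by (simp add: max_def)
  show "usc (Cn n) W (\<lambda>z. max (u z) (v z))" using u v unfolding psh_iff by (simp add: usc_max)
  fix a b assume a: "a \<in> W"
  obtain R1 where R1: "R1 > 0" "\<And>r. 0 < r \<Longrightarrow> r < R1 \<Longrightarrow> u a \<le> circle_mean n u a b r"
    using u a unfolding psh_iff by blast
  obtain R2 where R2: "R2 > 0" "\<And>r. 0 < r \<Longrightarrow> r < R2 \<Longrightarrow> v a \<le> circle_mean n v a b r"
    using v a unfolding psh_iff by blast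
  let ?m = "\<lambda>z. max (u z) (v z)"
  have "max (u a) (v a) \<le> circle_mean n ?m a b r" if "0 < r" "r < min R1 R2" for r
  proof -
    have "circle_mean n u a b r \<le> circle_mean n ?m a b r" "circle_mean n v a b r \<le> circle_mean n ?m a b r"
      unfolding circle_mean_eq_ext_mean by (rule ext_mean_mono, simp)+
    then show ?thesis using R1(2)[of r] R2(2)[of r] that by (meson max.boundedI min_less_iff_conj order_trans)
  qed
  then show "\<exists>R>0. \<forall>r. 0 < r \<and> r < R \<longrightarrow> max (u a) (v a) \<le> circle_mean n ?m a b r"
    using R1(1) R2(1) by (intro exI[of _ "min R1 R2"]) simp
qed

section \<open>Between n and n+1 variables: cylinders, suprema over slices, pullback under
  projection\<close>

definition cyl :: "nat \<Rightarrow> (nat \<Rightarrow> complex) set \<Rightarrow> (nat \<Rightarrow> complex) set" where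
  "cyl n A = {z \<in> topspace (Cn (Suc n)). restrict z {..<n} \<in> A}"

lemma openin_cyl: "openin (Cn n) A \<Longrightarrow> openin (Cn (Suc n)) (cyl n A)"
  unfolding cyl_def by (rule openin_continuous_map_preimage[OF continuous_map_restrict_Cn])

lemma restrict_upd_Cn: "v \<in> topspace (Cn n) \<Longrightarrow> restrict (v(n := w)) {..<n} = v"
  by (auto simp: topspace_Cn fun_eq_iff PiE_def extensional_def)

lemma restrict_id_Cn: "v \<in> topspace (Cn n) \<Longrightarrow> restrict v {..<n} = v"
  by (auto simp: topspace_Cn fun_eq_iff PiE_def extensional_def)

lemma upd_in_topspace: "v \<in> topspace (Cn n) \<Longrightarrow> v(n := w) \<in> topspace (Cn (Suc n))"
  by (auto simp: topspace_Cn PiE_def extensional_def)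

lemma upd_in_cyl: "openin (Cn n) A \<Longrightarrow> v \<in> A \<Longrightarrow> v(n := w) \<in> cyl n A"
  using openin_subset[of "Cn n" A] restrict_upd_Cn[of v n w] upd_in_topspace[of v n w]
  unfolding cyl_def by auto

lemma line_pt_upd: "line_pt (Suc n) (a(n := w)) (b(n := c)) t = (line_pt n a b t)(n := w + t * c)"
  by (auto simp: line_pt_def fun_eq_iff)

lemma restrict_line_pt: "restrict (line_pt (Suc n) a b t) {..<n} = line_pt n (restrict a {..<n}) b t"
  by (auto simp: line_pt_def fun_eq_iff)

lemma continuous_map_last: 
  assumes "continuous_on UNIV c"
  shows "continuous_map (Cn (Suc n)) euclidean (\<lambda>z. c (z n))"
  using continuous_map_compose[OF continuous_map_Cn_component[of n "Suc n"], of euclidean c] assms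
  by (simp add: o_def)

lemma continuous_map_upd_fst: "continuous_map (prod_topology (Cn n) euclidean) (Cn (Suc n)) (\<lambda>p. (fst p)(n := snd p))"
  by (rule continuous_map_upd_Cn[OF continuous_map_fst continuous_map_snd])

lemma continuous_map_upd_const:
  assumes "x \<in> topspace (Cn n)"
  shows "continuous_map euclidean (Cn (Suc n)) (\<lambda>w. x(n := w))"
  by (rule continuous_map_upd_Cn) (use assms in auto)

text \<open>At \<open>x\<close> the supremum is attained at some \<open>w\<close>; the slice with
  this constant \<open>w\<close> stays below the supremum and meets it at \<open>x\<close>, so its
  submean inequality, shifted by the constant \<open>c w\<close>, is inherited. Compactness of
  \<open>K\<close> gives both the attained value and, through the tube lemma, upper
  semicontinuity.\<close>

lemma psh_compact_sup:
  assumes A: "openin (Cn n) A" and u: "psh (Suc n) (cyl n A) u"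
    and K: "compact K" "K \<noteq> {}" and c: "continuous_on UNIV c"
  shows "psh n A (\<lambda>v. SUP w\<in>K. u (v(n := w)) + ereal (c w))"
proof -
  define U where "U = (\<lambda>z. u z + ereal (c (z n)))"
  define S where "S = (\<lambda>v. SUP w\<in>K. U (v(n := w)))"
  have U: "usc (Cn (Suc n)) (cyl n A) U"
    unfolding U_def
  proof (rule usc_add_continuous)
    show "usc (Cn (Suc n)) (cyl n A) u" using u unfolding psh_iff by simp
    show "openin (Cn (Suc n)) (cyl n A)" by (rule openin_cyl[OF A])
    show "continuous_map (subtopology (Cn (Suc n)) (cyl n A)) euclidean (\<lambda>z. c (z n))"
      by (rule continuous_map_from_subtopology[OF continuous_map_last[OF c]])
  qed
  have top: "x \<in> topspace (Cn n)" if "x \<in> A" for x using that openin_subset[OF A] by auto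
  have att: "\<exists>w\<in>K. S x = U (x(n := w))" if x: "x \<in> A" for x
  proof -
    have "compactin (Cn (Suc n)) ((\<lambda>w. x(n := w)) ` K)"
      by (rule image_compactin[OF _ continuous_map_upd_const[OF top[OF x]]]) (use K in simp)
    moreover have "(\<lambda>w. x(n := w)) ` K \<subseteq> cyl n A" using upd_in_cyl[OF A x] by auto
    ultimately obtain z where z: "z \<in> (\<lambda>w. x(n := w)) ` K" "\<And>y. y \<in> (\<lambda>w. x(n := w)) ` K \<Longrightarrow> U y \<le> U z"
      using usc_attains_sup[OF U] K(2) by (metis image_is_empty)
    then obtain w where w: "w \<in> K" "z = x(n := w)" by auto
    have "S x = U (x(n := w))"
      unfolding S_def using z(2) w by (intro antisym SUP_least SUP_upper) auto
    then show ?thesis using w by auto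
  qed
  have "psh n A S"
    unfolding psh_iff
  proof (intro conjI ballI allI)
    fix x assume x: "x \<in> A"
    obtain w where w: "w \<in> K" "S x = U (x(n := w))" using att[OF x] by auto
    have "u (x(n := w)) < \<infinity>" using u upd_in_cyl[OF A x] unfolding psh_iff by simp
    then show "S x < \<infinity>" unfolding w U_def by simp
    fix b
    \<comment> \<open>The direction \<open>b(n := 0)\<close> keeps the last coordinate at
      \<open>w\<close>, and the harmonic function is the constant \<open>c w\<close>.\<close>
    have "\<exists>R>0. \<forall>r. 0 < r \<and> r < R \<longrightarrow> u (x(n := w)) + ereal (Re (of_real (c w))) \<le> circle_mean n S x b r"
    proof (rule submean_add_harmonic[OF u openin_cyl[OF A] upd_in_cyl[OF A x],
          where k = "\<lambda>_. of_real (c w)" and ?R0.0 = 1 and y = "b(n := 0)"])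
      fix t :: complex
      show "u (line_pt (Suc n) (x(n := w)) (b(n := 0)) t) + ereal (Re (of_real (c w))) \<le> S (line_pt n x b t)"
        unfolding S_def line_pt_upd by (rule SUP_upper2[OF w(1)]) (simp add: U_def)
    qed auto
    then show "\<exists>R>0. \<forall>r. 0 < r \<and> r < R \<longrightarrow> S x \<le> circle_mean n S x b r"
      unfolding w U_def by simp
  next
    show "usc (Cn n) A S"
      unfolding usc_def
    proof (intro allI, subst openin_subopen, intro ballI)
      fix d x assume x: "x \<in> {v \<in> A. S v < d}"
      \<comment> \<open>Room for a non-strict bound: values below \<open>e\<close> bound the
        supremum only by \<open>e\<close>, which is still less than \<open>d\<close>.\<close>
      then obtain e where e: "S x < e" "e < d" using dense by blast
      define W where "W = {p \<in> topspace (prod_topology (Cn n) euclidean). (fst p)(n := snd p) \<in> {z \<in> cyl n A. U z < e}}"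
      have W: "openin (prod_topology (Cn n) euclidean) W"
        unfolding W_def
        by (rule openin_continuous_map_preimage[OF continuous_map_upd_fst]) (use U in \<open>simp add: usc_def\<close>)
      have "U (x(n := w)) < e" if "w \<in> K" for w
        using e(1) SUP_upper[OF that, of "\<lambda>w. U (x(n := w))"] unfolding S_def by simp
      then have "{x} \<times> K \<subseteq> W"
        using x top[of x] upd_in_cyl[OF A, of x] unfolding W_def by auto
      then obtain V V' where V: "openin (Cn n) V" "x \<in> V" "K \<subseteq> V'" "V \<times> V' \<subseteq> W"
        using tube_lemma_right[OF W, of K x] K(1) x top[of x] by auto
      have "V \<subseteq> {v \<in> A. S v < d}"
      proof
        fix v assume v: "v \<in> V"
        have *: "v(n := w) \<in> cyl n A \<and> U (v(n := w)) < e" if "w \<in> K" for w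
        proof -
          have "(v, w) \<in> W" using V v that by blast
          then show ?thesis unfolding W_def by simp
        qed
        have vt: "v \<in> topspace (Cn n)" using v openin_subset[OF V(1)] by auto
        obtain w where "w \<in> K" using K by auto
        then have "v \<in> A" using *[of w] restrict_upd_Cn[OF vt, of w] unfolding cyl_def by simp
        moreover have "S v \<le> e" unfolding S_def using * by (intro SUP_least) (simp add: less_imp_le)
        ultimately show "v \<in> {v \<in> A. S v < d}" using e(2) by simp
      qed
      then show "\<exists>T. openin (Cn n) T \<and> x \<in> T \<and> T \<subseteq> {v \<in> A. S v < d}" using V by blast
    qed
  qed
  then show ?thesis unfolding S_def U_def by simp
qed

text \<open>By Fubini the slice over \<open>L\<close> is integrable for almost every last
  coordinate, and a set \<open>K\<close> of positive measure contains a good one. The supremum lies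
  between that slice, shifted by a constant, and its own upper bound on the compact set
  \<open>L\<close>.\<close>

lemma absint_compact_sup:
  assumes A: "openin (Cn n) A" and u: "psh (Suc n) (cyl n A) u"
    and ai: "\<And>L. compactin (Cn (Suc n)) L \<Longrightarrow> L \<subseteq> cyl n A \<Longrightarrow> absint (Suc n) L u < \<infinity>"
    and K: "compact K" "emeasure lborel K > 0" and c: "continuous_on UNIV c"
    and L: "compactin (Cn n) L" "L \<subseteq> A"
  shows "absint n L (\<lambda>v. SUP w\<in>K. u (v(n := w)) + ereal (c w)) < \<infinity>"
proof -
  interpret product_sigma_finite "\<lambda>_::nat. lborel :: complex measure"
    by (rule product_sigma_finite_lborel)
  define S where "S = (\<lambda>v. SUP w\<in>K. u (v(n := w)) + ereal (c w))"
  have "K \<noteq> {}" using K by auto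
  have S: "psh n A S" unfolding S_def by (rule psh_compact_sup[OF A u K(1) \<open>K \<noteq> {}\<close> c])
  obtain M where M: "\<And>z. z \<in> L \<Longrightarrow> S z \<le> ereal M"
    using usc_bounded_above[of "Cn n" A S L] S L unfolding psh_iff by (meson subsetD)
  define L' where "L' = (\<lambda>p. (fst p)(n := snd p)) ` (L \<times> K)"
  have L': "compactin (Cn (Suc n)) L'"
    unfolding L'_def by (rule image_compactin[OF _ continuous_map_upd_fst]) (use L K in \<open>simp add: compactin_Times\<close>)
  have L's: "L' \<subseteq> cyl n A" unfolding L'_def using upd_in_cyl[OF A] L by auto
  note cA = openin_cyl[OF A]
  define u' where "u' = (\<lambda>z. if z \<in> cyl n A then u z else 0)"
  have [measurable]: "u' \<in> borel_measurable (Cn_borel (Suc n))"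
    unfolding u'_def using u by (intro usc_measurable[OF cA]) (simp add: psh_iff)
  have [measurable]: "L' \<in> sets (Cn_borel (Suc n))" by (rule compactin_Cn_sets[OF L'])
  have [measurable]: "L \<in> sets (Cn_borel n)" by (rule compactin_Cn_sets[OF L(1)])
  define f where "f = (\<lambda>z. e2ennreal \<bar>u' z\<bar> * indicator L' z)"
  have fm: "f \<in> borel_measurable (Cn_borel (Suc n))" unfolding f_def by measurable
  then have fm': "f \<in> borel_measurable (Pi\<^sub>M (insert n {..<n}) (\<lambda>_. lborel))" by (simp add: lessThan_Suc)
  have "absint (Suc n) L' u = integral\<^sup>N (Cn_borel (Suc n)) f"
    unfolding absint_def f_def using L's by (intro nn_integral_cong) (auto simp: u'_def indicator_def)
  also have "\<dots> = (\<integral>\<^sup>+ y. (\<integral>\<^sup>+ x. f (x(n := y)) \<partial>Cn_borel n) \<partial>lborel)"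
    using product_nn_integral_insert_rev[OF _ _ fm'] by (simp add: lessThan_Suc)
  finally have fin: "(\<integral>\<^sup>+ y. (\<integral>\<^sup>+ x. f (x(n := y)) \<partial>Cn_borel n) \<partial>lborel) \<noteq> \<infinity>"
    using ai[OF L' L's] by simp
  have upm[measurable]: "(\<lambda>x. x(n := y)) \<in> measurable (Cn_borel n) (Cn_borel (Suc n))" for y
    by (rule measurable_fun_upd[where J = "{..<n}"]) (auto simp: lessThan_Suc)
  have "(\<lambda>y. \<integral>\<^sup>+ x. f (x(n := y)) \<partial>Cn_borel n) \<in> borel_measurable lborel"
  proof -
    interpret I: finite_product_sigma_finite "\<lambda>_::nat. lborel :: complex measure" "{..<n}" by standard auto
    have "(\<lambda>p. f ((snd p)(n := fst p))) \<in> borel_measurable (lborel \<Otimes>\<^sub>M Cn_borel n)"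
      by (rule measurable_compose[OF _ fm], rule measurable_fun_upd[where J = "{..<n}"]) (auto simp: lessThan_Suc)
    then show ?thesis
      by (intro I.borel_measurable_nn_integral) (simp add: case_prod_beta')
  qed
  from nn_integral_PInf_AE[OF this fin]
  have ae: "AE y in lborel. (\<integral>\<^sup>+ x. f (x(n := y)) \<partial>Cn_borel n) \<noteq> \<infinity>" .
  have "\<exists>y\<in>K. (\<integral>\<^sup>+ x. f (x(n := y)) \<partial>Cn_borel n) \<noteq> \<infinity>"
  proof (rule ccontr)
    assume neg: "\<not> ?thesis"
    have "AE y in lborel. y \<notin> K" by (rule AE_mp[OF ae]) (use neg in auto)
    then have "emeasure lborel K = 0"
      using AE_iff_measurable[of K lborel "\<lambda>y. y \<notin> K"] K(1) borel_compact by auto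
    then show False using K(2) by simp
  qed
  then obtain y where y: "y \<in> K" "(\<integral>\<^sup>+ x. f (x(n := y)) \<partial>Cn_borel n) < \<infinity>"
    by (auto simp: less_top)
  have "absint n L S \<le> (\<integral>\<^sup>+ x. f (x(n := y)) + ennreal (\<bar>c y\<bar> + \<bar>M\<bar>) * indicator L x \<partial>Cn_borel n)"
    unfolding absint_def
  proof (rule nn_integral_mono)
    fix x
    show "e2ennreal \<bar>S x\<bar> * indicator L x \<le> f (x(n := y)) + ennreal (\<bar>c y\<bar> + \<bar>M\<bar>) * indicator L x"
    proof (cases "x \<in> L")
      case True
      have xL: "x(n := y) \<in> L'" unfolding L'_def using True y(1) by force
      have "u (x(n := y)) + ereal (c y) \<le> S x" unfolding S_def by (rule SUP_upper[OF y(1)])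
      moreover have "S x \<le> ereal M" by (rule M[OF True])
      ultimately have "\<bar>S x\<bar> \<le> \<bar>u (x(n := y))\<bar> + ereal (\<bar>c y\<bar> + \<bar>M\<bar>)"
        by (cases "S x"; cases "u (x(n := y))") auto
      then have "e2ennreal \<bar>S x\<bar> \<le> e2ennreal (\<bar>u (x(n := y))\<bar> + ereal (\<bar>c y\<bar> + \<bar>M\<bar>))"
        by (rule e2ennreal_mono)
      also have "\<dots> = e2ennreal \<bar>u (x(n := y))\<bar> + ennreal (\<bar>c y\<bar> + \<bar>M\<bar>)"
        by (cases "u (x(n := y))") (auto simp flip: ennreal_plus)
      finally show ?thesis using xL True L's by (auto simp: f_def u'_def)
    qed simp
  qed
  also have "\<dots> = (\<integral>\<^sup>+ x. f (x(n := y)) \<partial>Cn_borel n) + ennreal (\<bar>c y\<bar> + \<bar>M\<bar>) * emeasure (Cn_borel n) L"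
    using measurable_compose[OF upm fm] by (subst nn_integral_add) (auto simp: nn_integral_cmult_indicator)
  also have "\<dots> < \<infinity>"
    using y(2) compactin_Cn_emeasure[OF L(1)] by (simp add: ennreal_mult_less_top)
  finally show ?thesis unfolding S_def .
qed

text \<open>Plurisubharmonicity of \<open>v\<close> enters through support functions: along every
  line through \<open>a\<close> some harmonic function lies below \<open>v\<close> and touches it at
  \<open>a\<close>. \<open>submean_add_harmonic\<close> adds it to the submean inequality of
  \<open>u\<close>; \<open>lhol_log_norm\<close> supplies such functions.\<close>

lemma psh_restrict_add:
  assumes A: "openin (Cn n) A" and u: "psh n A u"
    and B: "openin (Cn (Suc n)) B" "B \<subseteq> cyl n A"
    and v: "continuous_map (subtopology (Cn (Suc n)) B) euclidean v"
    and supp: "\<And>a b. a \<in> B \<Longrightarrow> \<exists>R>0. \<exists>k. k holomorphic_on ball 0 R \<and> Re (k 0) = v a \<and>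
        (\<forall>t. cmod t < R \<longrightarrow> Re (k t) \<le> v (line_pt (Suc n) a b t))"
  shows "psh (Suc n) B (\<lambda>z. u (restrict z {..<n}) + ereal (v z))"
  unfolding psh_iff
proof (intro conjI ballI allI)
  fix a assume a: "a \<in> B"
  then have aA: "restrict a {..<n} \<in> A" using B by (auto simp: cyl_def)
  then show "u (restrict a {..<n}) + ereal (v a) < \<infinity>" using u unfolding psh_iff by auto
  fix b
  obtain R k where k: "R > 0" "k holomorphic_on ball 0 R" "Re (k 0) = v a"
      "\<And>t. cmod t < R \<Longrightarrow> Re (k t) \<le> v (line_pt (Suc n) a b t)"
    using supp[OF a, of b] by blast
  have "\<exists>R>0. \<forall>r. 0 < r \<and> r < R \<longrightarrow> u (restrict a {..<n}) + ereal (Re (k 0)) \<le>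
      circle_mean (Suc n) (\<lambda>z. u (restrict z {..<n}) + ereal (v z)) a b r"
  proof (rule submean_add_harmonic[OF u A aA k(2,1)])
    fix t assume "cmod t < R"
    then show "u (line_pt n (restrict a {..<n}) b t) + ereal (Re (k t)) \<le>
        u (restrict (line_pt (Suc n) a b t) {..<n}) + ereal (v (line_pt (Suc n) a b t))"
      unfolding restrict_line_pt by (intro add_left_mono) (simp add: k(4))
  qed
  then show "\<exists>R>0. \<forall>r. 0 < r \<and> r < R \<longrightarrow> u (restrict a {..<n}) + ereal (v a) \<le>
      circle_mean (Suc n) (\<lambda>z. u (restrict z {..<n}) + ereal (v z)) a b r"
    unfolding k(3) .
next
  show "usc (Cn (Suc n)) B (\<lambda>z. u (restrict z {..<n}) + ereal (v z))"
  proof (rule usc_add_continuous[OF _ B(1) v])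
    have "usc (Cn n) A u" using u by (simp add: psh_iff)
    then show "usc (Cn (Suc n)) B (\<lambda>z. u (restrict z {..<n}))"
      by (rule usc_compose[OF _ continuous_map_restrict_Cn B(1)]) (use B(2) in \<open>auto simp: cyl_def\<close>)
  qed
qed

text \<open>\<open>L\<close> lies in the product of its two projections, and \<open>v\<close> is
  bounded on \<open>L\<close>. The dominating function \<open>g\<close> is a product, so Tonelli
  turns its integral into a product of finite factors.\<close>

lemma absint_restrict_add:
  assumes A: "openin (Cn n) A" and u: "usc (Cn n) A u"
    and B: "openin (Cn (Suc n)) B" "B \<subseteq> cyl n A"
    and v: "continuous_map (subtopology (Cn (Suc n)) B) euclidean v"
    and ai: "\<And>L. compactin (Cn n) L \<Longrightarrow> L \<subseteq> A \<Longrightarrow> absint n L u < \<infinity>"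
    and L: "compactin (Cn (Suc n)) L" "L \<subseteq> B"
  shows "absint (Suc n) L (\<lambda>z. u (restrict z {..<n}) + ereal (v z)) < \<infinity>"
proof -
  interpret product_sigma_finite "\<lambda>_::nat. lborel :: complex measure"
    by (rule product_sigma_finite_lborel)
  define L1 where "L1 = (\<lambda>z. restrict z {..<n}) ` L"
  define L2 where "L2 = (\<lambda>z. z n) ` L"
  have L1: "compactin (Cn n) L1"
    unfolding L1_def by (rule image_compactin[OF L(1) continuous_map_restrict_Cn])
  have L2: "compact L2"
    using image_compactin[OF L(1) continuous_map_Cn_component[of n "Suc n"]] by (simp add: L2_def)
  have L1A: "L1 \<subseteq> A" using L B by (auto simp: L1_def cyl_def)
  have "compactin (subtopology (Cn (Suc n)) B) L" using L by (simp add: compactin_subtopology)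
  from image_compactin[OF this v] have "compact (v ` L)" by simp
  then obtain M where M: "\<And>z. z \<in> L \<Longrightarrow> \<bar>v z\<bar> \<le> M"
    using compact_imp_bounded[of "v ` L"] unfolding bounded_iff by auto
  define u' where "u' = (\<lambda>z. if z \<in> A then u z else 0)"
  have [measurable]: "u' \<in> borel_measurable (Cn_borel n)"
    unfolding u'_def by (rule usc_measurable[OF A u])
  have [measurable]: "L1 \<in> sets (Cn_borel n)" by (rule compactin_Cn_sets[OF L1])
  have L2m[measurable]: "L2 \<in> sets borel" using L2 by (rule borel_compact)
  define g1 where "g1 = (\<lambda>x. e2ennreal \<bar>u' x\<bar> * indicator L1 x + ennreal M * indicator L1 x)"
  have g1[measurable]: "g1 \<in> borel_measurable (Cn_borel n)" unfolding g1_def by measurable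
  define g where "g = (\<lambda>z. g1 (restrict z {..<n}) * indicator L2 (z n))"
  have r: "(\<lambda>z. restrict z {..<n}) \<in> measurable (Cn_borel (Suc n)) (Cn_borel n)"
    by (rule measurable_restrict_subset) auto
  have rn: "(\<lambda>z. z n) \<in> measurable (Cn_borel (Suc n)) lborel"
    by (rule measurable_component_singleton) auto
  have "g \<in> borel_measurable (Cn_borel (Suc n))"
    unfolding g_def using measurable_compose[OF r g1] measurable_compose[OF rn, of "indicator L2"]
    by (intro borel_measurable_times_ennreal) auto
  then have g: "g \<in> borel_measurable (Pi\<^sub>M (insert n {..<n}) (\<lambda>_. lborel))" by (simp add: lessThan_Suc)
  have "absint (Suc n) L (\<lambda>z. u (restrict z {..<n}) + ereal (v z)) \<le> integral\<^sup>N (Cn_borel (Suc n)) g"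
    unfolding absint_def
  proof (rule nn_integral_mono)
    fix z
    show "e2ennreal \<bar>u (restrict z {..<n}) + ereal (v z)\<bar> * indicator L z \<le> g z"
    proof (cases "z \<in> L")
      case True
      then have z: "restrict z {..<n} \<in> L1" "z n \<in> L2" by (auto simp: L1_def L2_def)
      then have z': "u' (restrict z {..<n}) = u (restrict z {..<n})" using L1A by (auto simp: u'_def)
      have "\<bar>u (restrict z {..<n}) + ereal (v z)\<bar> \<le> \<bar>u (restrict z {..<n})\<bar> + ereal M"
        using M[OF True] by (cases "u (restrict z {..<n})") auto
      then have "e2ennreal \<bar>u (restrict z {..<n}) + ereal (v z)\<bar> \<le> e2ennreal (\<bar>u (restrict z {..<n})\<bar> + ereal M)"
        by (rule e2ennreal_mono)
      also have "\<dots> = e2ennreal \<bar>u (restrict z {..<n})\<bar> + ennreal M"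
        using M[OF True] by (cases "u (restrict z {..<n})") (auto simp flip: ennreal_plus)
      finally show ?thesis using True z z' by (simp add: g_def g1_def)
    qed simp
  qed
  also have "\<dots> = (\<integral>\<^sup>+ y. (\<integral>\<^sup>+ x. g (x(n := y)) \<partial>Cn_borel n) \<partial>lborel)"
    using product_nn_integral_insert_rev[OF _ _ g] by (simp add: lessThan_Suc)
  also have "\<dots> = (\<integral>\<^sup>+ y. (\<integral>\<^sup>+ x. g1 x * indicator L2 y \<partial>Cn_borel n) \<partial>lborel)"
    by (intro nn_integral_cong) (simp add: g_def space_Cn_borel restrict_id_Cn)
  also have "\<dots> = (\<integral>\<^sup>+ y. integral\<^sup>N (Cn_borel n) g1 * indicator L2 y \<partial>lborel)"
    by (intro nn_integral_cong nn_integral_multc g1)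
  also have "\<dots> = integral\<^sup>N (Cn_borel n) g1 * emeasure lborel L2"
    by (rule nn_integral_cmult_indicator) (simp add: L2m)
  also have "integral\<^sup>N (Cn_borel n) g1 = absint n L1 u' + ennreal M * emeasure (Cn_borel n) L1"
    unfolding g1_def absint_def by (subst nn_integral_add) (auto simp: nn_integral_cmult_indicator)
  also have "absint n L1 u' = absint n L1 u"
    using L1A by (intro absint_cong) (auto simp: u'_def)
  also have "(absint n L1 u + ennreal M * emeasure (Cn_borel n) L1) * emeasure lborel L2 < \<infinity>"
    using ai[OF L1 L1A] compactin_Cn_emeasure[OF L1] emeasure_compact_finite[OF L2]
    by (simp add: ennreal_mult_less_top)
  finally show ?thesis .
qed

text \<open>The logarithm of the norm of a holomorphic vector is supported from below, at a given point, by
  the harmonic function obtained by projecting to the value at that point (Cauchy--Schwarz).\<close>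

lemma log_norm_support:
  assumes g: "g1 holomorphic_on ball 0 R" "g2 holomorphic_on ball 0 R" and R: "R > 0"
    and nz: "g1 0 \<noteq> 0 \<or> g2 0 \<noteq> 0"
  obtains R' k where "R' > 0" "R' \<le> R" "k holomorphic_on ball 0 R'"
    "Re (k 0) = ln ((cmod (g1 0))\<^sup>2 + (cmod (g2 0))\<^sup>2)"
    "\<And>t. cmod t < R' \<Longrightarrow> Re (k t) \<le> ln ((cmod (g1 t))\<^sup>2 + (cmod (g2 t))\<^sup>2)"
proof -
  define s where "s = (cmod (g1 0))\<^sup>2 + (cmod (g2 0))\<^sup>2"
  have s: "s > 0" using nz by (auto simp: s_def intro: add_pos_nonneg add_nonneg_pos)
  define m where "m = (\<lambda>t. cnj (g1 0) * g1 t + cnj (g2 0) * g2 t)"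
  have m: "m holomorphic_on ball 0 R" unfolding m_def by (intro holomorphic_intros g)
  have m0: "m 0 = of_real s"
    by (simp add: m_def s_def complex_norm_square[symmetric] mult.commute flip: of_real_power)
  have "open (ball 0 R \<inter> m -` {z. Re z > 0})"
    using m by (intro continuous_open_preimage) (auto simp: holomorphic_on_imp_continuous_on open_halfspace_Re_gt)
  moreover have "0 \<in> ball 0 R \<inter> m -` {z. Re z > 0}" using m0 s R by simp
  ultimately obtain R1 where R1: "R1 > 0" "ball 0 R1 \<subseteq> ball 0 R \<inter> m -` {z. Re z > 0}"
    unfolding open_contains_ball by blast
  define R' where "R' = min R1 R"
  \<comment> \<open>Re k is ln (|m|^2 / s). At 0 this is ln s, as \<open>m\<close> equals
    \<open>s\<close> there; elsewhere |m|^2 is at most \<open>s\<close> times the squared norm of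
    the vector.\<close>
  define k where "k = (\<lambda>t. 2 * Ln (m t) - of_real (ln s))"
  have pos: "Re (m t) > 0" if "cmod t < R'" for t
  proof -
    have "t \<in> ball 0 R1" using that by (simp add: R'_def)
    then show ?thesis using R1 by auto
  qed
  show ?thesis
  proof (rule that[of R' k])
    show "R' > 0" "R' \<le> R" using R1 R by (auto simp: R'_def)
    show "k holomorphic_on ball 0 R'"
      unfolding k_def
    proof (intro holomorphic_intros)
      show "m holomorphic_on ball 0 R'" by (rule holomorphic_on_subset[OF m]) (auto simp: R'_def)
      show "m z \<notin> \<real>\<^sub>\<le>\<^sub>0" if "z \<in> ball 0 R'" for z
        using pos[of z] that by (auto simp: complex_nonpos_Reals_iff)
    qed
    show "Re (k 0) = ln ((cmod (g1 0))\<^sup>2 + (cmod (g2 0))\<^sup>2)"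
      using s unfolding k_def m0 by (simp flip: s_def add: Ln_of_real)
    fix t assume t: "cmod t < R'"
    have mt: "m t \<noteq> 0" using pos[OF t] by auto
    define q where "q = (cmod (g1 t))\<^sup>2 + (cmod (g2 t))\<^sup>2"
    have "cmod (m t) \<le> cmod (g1 0) * cmod (g1 t) + cmod (g2 0) * cmod (g2 t)"
      unfolding m_def by (rule order_trans[OF norm_triangle_ineq]) (simp add: norm_mult)
    then have "(cmod (m t))\<^sup>2 \<le> (cmod (g1 0) * cmod (g1 t) + cmod (g2 0) * cmod (g2 t))\<^sup>2"
      by (intro power_mono) auto
    \<comment> \<open>Lagrange's identity: the difference of the two sides is the square named in
      the next line.\<close>
    also have "\<dots> \<le> s * q"
      using zero_le_power2[of "cmod (g1 0) * cmod (g2 t) - cmod (g2 0) * cmod (g1 t)"]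
      unfolding s_def q_def by (simp add: power2_eq_square algebra_simps)
    finally have le: "(cmod (m t))\<^sup>2 \<le> s * q" .
    moreover have "0 < (cmod (m t))\<^sup>2" using mt by simp
    ultimately have "s * q > 0" by linarith
    then have q: "q > 0" using s by (simp add: zero_less_mult_iff)
    have "Re (k t) = ln ((cmod (m t))\<^sup>2) - ln s"
      unfolding k_def using mt by (simp add: Re_Ln ln_realpow)
    also have "\<dots> \<le> ln (s * q) - ln s"
      using le \<open>0 < (cmod (m t))\<^sup>2\<close> by (simp add: ln_mono)
    also have "\<dots> = ln q" using s q by (simp add: ln_mult)
    finally show "Re (k t) \<le> ln ((cmod (g1 t))\<^sup>2 + (cmod (g2 t))\<^sup>2)" unfolding q_def .
  qed
qed

lemma absint_max:
  assumes W: "openin (Cn n) W" and u: "usc (Cn n) W u" and v: "usc (Cn n) W v"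
    and K: "compactin (Cn n) K" "K \<subseteq> W" and ai: "absint n K u < \<infinity>" "absint n K v < \<infinity>"
  shows "absint n K (\<lambda>z. max (u z) (v z)) < \<infinity>"
proof -
  define u' where "u' = (\<lambda>z. if z \<in> W then u z else 0)"
  define v' where "v' = (\<lambda>z. if z \<in> W then v z else 0)"
  have [measurable]: "u' \<in> borel_measurable (Cn_borel n)" "v' \<in> borel_measurable (Cn_borel n)"
    unfolding u'_def v'_def by (rule usc_measurable[OF W u], rule usc_measurable[OF W v])
  have [measurable]: "K \<in> sets (Cn_borel n)" by (rule compactin_Cn_sets[OF K(1)])
  have eq: "u z = u' z" "v z = v' z" if "z \<in> K" for z using that K(2) by (auto simp: u'_def v'_def)
  have "absint n K (\<lambda>z. max (u z) (v z)) = absint n K (\<lambda>z. max (u' z) (v' z))"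
    by (rule absint_cong) (simp add: eq)
  also have "\<dots> \<le> (\<integral>\<^sup>+ z. e2ennreal \<bar>u' z\<bar> * indicator K z + e2ennreal \<bar>v' z\<bar> * indicator K z \<partial>Cn_borel n)"
    unfolding absint_def
    by (intro nn_integral_mono) (auto simp: max_def indicator_def)
  also have "\<dots> = absint n K u' + absint n K v'"
    unfolding absint_def by (rule nn_integral_add) auto
  also have "\<dots> = absint n K u + absint n K v"
    using absint_cong[of K u u' n] absint_cong[of K v v' n] eq by simp
  also have "\<dots> < \<infinity>" using ai by simp
  finally show ?thesis .
qed

lemma psh_cong:
  assumes "openin (Cn n) W" "\<And>z. z \<in> W \<Longrightarrow> u z = v z" "psh n W v"
  shows "psh n W u"
  by (rule psh_local, rule exI[of _ W], rule exI[of _ v]) (use assms in auto)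


subsection \<open>Holomorphic functions on lines\<close>

text \<open>All that is used of holomorphy in several variables.\<close>

definition lhol :: "nat \<Rightarrow> (nat \<Rightarrow> complex) set \<Rightarrow> ((nat \<Rightarrow> complex) \<Rightarrow> complex) \<Rightarrow> bool" where
  "lhol n W g \<longleftrightarrow> continuous_map (subtopology (Cn n) W) euclidean g \<and>
     (\<forall>a b. (\<lambda>t. g (line_pt n a b t)) holomorphic_on {t. line_pt n a b t \<in> W})"

lemma lhol_subset: "lhol n W g \<Longrightarrow> A \<subseteq> W \<Longrightarrow> lhol n A g"
  unfolding lhol_def
  by (auto intro: continuous_map_from_subtopology_mono holomorphic_on_subset)

lemma lhol_cong:
  assumes "lhol n W g" and eq: "\<And>z. z \<in> W \<Longrightarrow> f z = g z"
  shows "lhol n W f"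
  unfolding lhol_def
proof (intro conjI allI)
  show "continuous_map (subtopology (Cn n) W) euclidean f"
    using assms(1) unfolding lhol_def by (auto intro: continuous_map_eq simp: eq)
  fix a b
  have "(\<lambda>t. g (line_pt n a b t)) holomorphic_on {t. line_pt n a b t \<in> W}"
    using assms(1) unfolding lhol_def by blast
  then show "(\<lambda>t. f (line_pt n a b t)) holomorphic_on {t. line_pt n a b t \<in> W}"
    by (rule holomorphic_transform) (simp add: eq)
qed

lemma lhol_add: "lhol n W f \<Longrightarrow> lhol n W g \<Longrightarrow> lhol n W (\<lambda>z. f z + g z)"
  unfolding lhol_def by (auto intro!: continuous_map_add holomorphic_intros)

lemma lhol_diff: "lhol n W f \<Longrightarrow> lhol n W g \<Longrightarrow> lhol n W (\<lambda>z. f z - g z)"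
  unfolding lhol_def by (auto intro!: continuous_map_diff holomorphic_intros)

lemma continuous_map_compose2:
  assumes "continuous_map T euclidean f" "continuous_map T euclidean g" "continuous_on UNIV h"
  shows "continuous_map T euclidean (\<lambda>x. h (f x, g x))"
proof -
  have "continuous_map T euclidean (\<lambda>x. (f x, g x))"
    using assms(1,2) continuous_map_pairedI[of T euclidean f euclidean g] by simp
  from continuous_map_compose[OF this, of euclidean h] show ?thesis
    using assms(3) by (simp add: o_def)
qed

lemma lhol_mult: "lhol n W f \<Longrightarrow> lhol n W g \<Longrightarrow> lhol n W (\<lambda>z. f z * g z)"
proof -
  have "continuous_on UNIV (\<lambda>p :: complex \<times> complex. fst p * snd p)" by (intro continuous_intros)
  from continuous_map_compose2[OF _ _ this]
  show "lhol n W f \<Longrightarrow> lhol n W g \<Longrightarrow> lhol n W (\<lambda>z. f z * g z)"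
    unfolding lhol_def by (auto intro!: holomorphic_intros)
qed

lemma lhol_compose:
  assumes f: "lhol n W f" and G: "G holomorphic_on O'" "f ` W \<subseteq> O'"
  shows "lhol n W (\<lambda>z. G (f z))"
  unfolding lhol_def
proof (intro conjI allI)
  have "continuous_map (top_of_set O') euclidean G"
    using G(1) by (simp add: holomorphic_on_imp_continuous_on)
  moreover have "continuous_map (subtopology (Cn n) W) (top_of_set O') f"
    using f G(2) unfolding lhol_def by (auto simp: continuous_map_in_subtopology)
  ultimately show "continuous_map (subtopology (Cn n) W) euclidean (\<lambda>z. G (f z))"
    using continuous_map_compose[of _ "top_of_set O'" f euclidean G] by (simp add: o_def)
  fix a b
  have "(\<lambda>t. f (line_pt n a b t)) holomorphic_on {t. line_pt n a b t \<in> W}"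
    using f unfolding lhol_def by blast
  from holomorphic_on_compose_gen[OF this G(1)]
  show "(\<lambda>t. G (f (line_pt n a b t))) holomorphic_on {t. line_pt n a b t \<in> W}"
    using G(2) by (auto simp: o_def)
qed

lemma lhol_divide:
  assumes "lhol n W f" "lhol n W g" "\<And>z. z \<in> W \<Longrightarrow> g z \<noteq> 0"
  shows "lhol n W (\<lambda>z. f z / g z)"
proof -
  have "lhol n W (\<lambda>z. inverse (g z))"
    by (rule lhol_compose[OF assms(2), of inverse "- {0}"]) (use assms(3) in \<open>auto intro!: holomorphic_intros\<close>)
  from lhol_mult[OF assms(1) this] show ?thesis by (simp add: divide_inverse)
qed

lemma lhol_restrict:
  assumes "lhol n A g"
  shows "lhol (Suc n) (cyl n A) (\<lambda>z. g (restrict z {..<n}))"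
  unfolding lhol_def
proof (intro conjI allI)
  have "continuous_map (subtopology (Cn (Suc n)) (cyl n A)) (subtopology (Cn n) A) (\<lambda>z. restrict z {..<n})"
    using continuous_map_from_subtopology[OF continuous_map_restrict_Cn]
    by (auto simp: continuous_map_in_subtopology cyl_def)
  then show "continuous_map (subtopology (Cn (Suc n)) (cyl n A)) euclidean (\<lambda>z. g (restrict z {..<n}))"
    using assms continuous_map_compose[of _ "subtopology (Cn n) A" "\<lambda>z. restrict z {..<n}" euclidean g]
    unfolding lhol_def by (simp add: o_def)
  fix a b
  have "(\<lambda>t. g (line_pt n (restrict a {..<n}) b t)) holomorphic_on {t. line_pt n (restrict a {..<n}) b t \<in> A}"
    using assms unfolding lhol_def by blast
  then show "(\<lambda>t. g (restrict (line_pt (Suc n) a b t) {..<n})) holomorphic_on {t. line_pt (Suc n) a b t \<in> cyl n A}"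
    unfolding restrict_line_pt cyl_def by (rule holomorphic_on_subset) (auto simp: restrict_line_pt)
qed

lemma lhol_last: "lhol (Suc n) W (\<lambda>z. z n)"
  unfolding lhol_def
proof (intro conjI allI)
  show "continuous_map (subtopology (Cn (Suc n)) W) euclidean (\<lambda>z. z n)"
    by (intro continuous_map_from_subtopology continuous_map_Cn_component) simp
  show "(\<lambda>t. line_pt (Suc n) a b t n) holomorphic_on {t. line_pt (Suc n) a b t \<in> W}" for a b
    by (simp add: line_pt_def) (intro holomorphic_intros)
qed

lemma continuous_map_euclideanI:
  assumes "\<And>x e. x \<in> topspace T \<Longrightarrow> e > (0::real) \<Longrightarrow> \<exists>U. openin T U \<and> x \<in> U \<and> (\<forall>y\<in>U. dist (g y) (g x) < e)"
  shows "continuous_map T euclidean (g :: _ \<Rightarrow> 'b :: metric_space)"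
  unfolding continuous_map_def
proof (intro conjI allI impI)
  fix V :: "'b set" assume V: "openin euclidean V"
  show "openin T {x \<in> topspace T. g x \<in> V}"
  proof (subst openin_subopen, intro ballI)
    fix x assume x: "x \<in> {x \<in> topspace T. g x \<in> V}"
    then obtain e where e: "e > 0" "\<And>y. dist y (g x) < e \<Longrightarrow> y \<in> V"
      using V by (metis (mono_tags, lifting) mem_Collect_eq open_dist open_openin)
    obtain U where "openin T U" "x \<in> U" "\<forall>y\<in>U. dist (g y) (g x) < e"
      using assms[of x e] x e(1) by auto
    then show "\<exists>U. openin T U \<and> x \<in> U \<and> U \<subseteq> {x \<in> topspace T. g x \<in> V}"
      using e(2) openin_subset[of T U] by (intro exI[of _ U]) auto
  qed
qed auto

lemma openin_polydisc:
  assumes "openin (Cn n) W"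
  shows "openin (Cn n) {w \<in> W. \<forall>k<n. cmod (w k - z k) < d}"
proof -
  have *: "openin (Cn n) {w \<in> topspace (Cn n). w k \<in> ball (z k) d}" if "k < n" for k
    by (rule openin_continuous_map_preimage[OF continuous_map_Cn_component[OF that]]) simp
  have "openin (Cn n) (W \<inter> {w \<in> W. \<forall>k\<in>I. cmod (w k - z k) < d})" if "finite I" "I \<subseteq> {..<n}" for I
    using that
  proof (induction I)
    case empty
    then show ?case using assms by simp
  next
    case (insert k I)
    have "W \<inter> {w \<in> W. \<forall>k\<in>insert k I. cmod (w k - z k) < d} =
        (W \<inter> {w \<in> W. \<forall>k\<in>I. cmod (w k - z k) < d}) \<inter> {w \<in> topspace (Cn n). w k \<in> ball (z k) d}"
      using openin_subset[OF assms] by (auto simp: dist_norm norm_minus_commute)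
    then show ?case using insert *[of k] by auto
  qed
  from this[of "{..<n}"] show ?thesis
    by (auto simp: Int_absorb1 Collect_conj_eq[symmetric] intro: back_subst[of "openin (Cn n)"])
qed

text \<open>The linear approximation at a point yields both halves of \<open>lhol\<close>: it bounds
  differences of values, hence continuity, and along a line it is the chain rule.\<close>

lemma hol_Cn_imp_lhol:
  assumes f: "hol_Cn n W f" and W: "openin (Cn n) W"
  shows "lhol n W f"
  unfolding lhol_def
proof (intro conjI allI)
  show "continuous_map (subtopology (Cn n) W) euclidean f"
  proof (rule continuous_map_euclideanI)
    fix z and e :: real assume "z \<in> topspace (subtopology (Cn n) W)" and e: "e > 0"
    then have z: "z \<in> W" by simp
    obtain a where a: "\<forall>e>0. \<exists>d>0. \<forall>w\<in>W. (\<forall>k<n. cmod (w k - z k) < d) \<longrightarrow>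
        cmod (f w - f z - (\<Sum>k<n. a k * (w k - z k))) \<le> e * (\<Sum>k<n. cmod (w k - z k))"
      using f z unfolding hol_Cn_def by blast
    obtain d where d: "d > 0" "\<And>w. w \<in> W \<Longrightarrow> (\<forall>k<n. cmod (w k - z k) < d) \<Longrightarrow>
        cmod (f w - f z - (\<Sum>k<n. a k * (w k - z k))) \<le> 1 * (\<Sum>k<n. cmod (w k - z k))"
      using a[rule_format, of 1] by auto
    \<comment> \<open>In the maximum norm, values differ by at most \<open>s\<close> times the
      distance: the sum of the |a_k| comes from the linear term, and \<open>n\<close> from the error
      term taken with e = 1.\<close>
    define s where "s = (\<Sum>k<n. cmod (a k)) + real n"
    have s: "s \<ge> 0" by (auto simp: s_def intro!: add_nonneg_nonneg sum_nonneg)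
    define d' where "d' = min d (e / (s + 1))"
    have d': "d' > 0" "d' \<le> d" "s * d' < e"
    proof -
      show "d' > 0" "d' \<le> d" using d e s by (auto simp: d'_def)
      have "s * d' \<le> s * (e / (s + 1))" using s by (intro mult_left_mono) (auto simp: d'_def)
      also have "\<dots> < e" using s e by (simp add: field_simps)
      finally show "s * d' < e" .
    qed
    define U where "U = {w \<in> W. \<forall>k<n. cmod (w k - z k) < d'}"
    have "dist (f w) (f z) < e" if w: "w \<in> U" for w
    proof -
      have w': "w \<in> W" "\<And>k. k < n \<Longrightarrow> cmod (w k - z k) < d'" using w by (auto simp: U_def)
      have "f w - f z = (f w - f z - (\<Sum>k<n. a k * (w k - z k))) + (\<Sum>k<n. a k * (w k - z k))" by simp
      then have "cmod (f w - f z) \<le> cmod (f w - f z - (\<Sum>k<n. a k * (w k - z k))) + cmod (\<Sum>k<n. a k * (w k - z k))"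
        by (metis norm_triangle_ineq)
      also have "\<dots> \<le> (\<Sum>k<n. cmod (w k - z k)) + (\<Sum>k<n. cmod (a k) * cmod (w k - z k))"
      proof (rule add_mono)
        show "cmod (f w - f z - (\<Sum>k<n. a k * (w k - z k))) \<le> (\<Sum>k<n. cmod (w k - z k))"
          using d(2)[of w] w' d' by force
        show "cmod (\<Sum>k<n. a k * (w k - z k)) \<le> (\<Sum>k<n. cmod (a k) * cmod (w k - z k))"
          by (rule order_trans[OF norm_sum]) (simp add: norm_mult)
      qed
      also have "\<dots> \<le> (\<Sum>k<n. d') + (\<Sum>k<n. cmod (a k) * d')"
        using w'(2) by (intro add_mono sum_mono mult_left_mono) (auto simp: less_imp_le)
      also have "\<dots> = s * d'" by (simp add: s_def distrib_right flip: sum_distrib_right)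
      also have "\<dots> < e" by (rule d'(3))
      finally show ?thesis by (simp add: dist_norm)
    qed
    moreover have "openin (subtopology (Cn n) W) U"
      using openin_polydisc[OF W] unfolding U_def by (auto simp: openin_open_subtopology W)
    moreover have "z \<in> U" using z d' by (simp add: U_def)
    ultimately show "\<exists>U. openin (subtopology (Cn n) W) U \<and> z \<in> U \<and> (\<forall>y\<in>U. dist (f y) (f z) < e)" by blast
  qed
next
  fix a0 b
  show "(\<lambda>t. f (line_pt n a0 b t)) holomorphic_on {t. line_pt n a0 b t \<in> W}"
    unfolding holomorphic_on_def
  proof
    fix t0 assume "t0 \<in> {t. line_pt n a0 b t \<in> W}"
    then have z: "line_pt n a0 b t0 \<in> W" by simp
    let ?z = "line_pt n a0 b t0"
    obtain a where a: "\<forall>e>0. \<exists>d>0. \<forall>w\<in>W. (\<forall>k<n. cmod (w k - ?z k) < d) \<longrightarrow>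
        cmod (f w - f ?z - (\<Sum>k<n. a k * (w k - ?z k))) \<le> e * (\<Sum>k<n. cmod (w k - ?z k))"
      using f z unfolding hol_Cn_def by blast
    define D where "D = (\<Sum>k<n. a k * b k)"
    define s where "s = (\<Sum>k<n. cmod (b k))"
    have s: "s \<ge> 0" by (simp add: s_def sum_nonneg)
    have bs: "cmod (b k) \<le> s" if "k < n" for k
      unfolding s_def using that by (intro member_le_sum) auto
    have "((\<lambda>t. f (line_pt n a0 b t)) has_field_derivative D) (at t0 within {t. line_pt n a0 b t \<in> W})"
      unfolding has_field_derivative_def has_derivative_within_alt
    proof (intro conjI allI impI)
      show "bounded_linear ((*) D)" by (rule bounded_linear_mult_right)
      fix e :: real assume e: "e > 0"
      \<comment> \<open>Dividing by s + 1 rather than s allows for the zero direction, where s =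
        0.\<close>
      have "e / (s + 1) > 0" using e s by simp
      then obtain d where d: "d > 0" "\<And>w. w \<in> W \<Longrightarrow> (\<forall>k<n. cmod (w k - ?z k) < d) \<Longrightarrow>
        cmod (f w - f ?z - (\<Sum>k<n. a k * (w k - ?z k))) \<le> e / (s + 1) * (\<Sum>k<n. cmod (w k - ?z k))"
        using a by meson
      have "cmod (f (line_pt n a0 b t) - f ?z - D * (t - t0)) \<le> e * cmod (t - t0)"
        if t: "line_pt n a0 b t \<in> W" "cmod (t - t0) < d / (s + 1)" for t
      proof -
        have df: "line_pt n a0 b t k - ?z k = (t - t0) * b k" if "k < n" for k
          using that by (simp add: line_pt_def algebra_simps)
        have "cmod (line_pt n a0 b t k - ?z k) < d" if "k < n" for k
        proof -
          have "cmod (line_pt n a0 b t k - ?z k) \<le> cmod (t - t0) * (s + 1)"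
            using bs[OF that] by (simp add: df[OF that] norm_mult mult_left_mono)
          also have "\<dots> < d" using t(2) s by (simp add: field_simps)
          finally show ?thesis .
        qed
        then have "cmod (f (line_pt n a0 b t) - f ?z - (\<Sum>k<n. a k * (line_pt n a0 b t k - ?z k)))
            \<le> e / (s + 1) * (\<Sum>k<n. cmod (line_pt n a0 b t k - ?z k))"
          using d(2)[OF t(1)] by blast
        also have "(\<Sum>k<n. a k * (line_pt n a0 b t k - ?z k)) = D * (t - t0)"
          by (simp add: df D_def sum_distrib_left sum_distrib_right mult_ac)
        also have "(\<Sum>k<n. cmod (line_pt n a0 b t k - ?z k)) = s * cmod (t - t0)"
          by (simp add: df s_def norm_mult sum_distrib_left sum_distrib_right mult_ac)
        also have "e / (s + 1) * (s * cmod (t - t0)) \<le> e * cmod (t - t0)"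
        proof -
          have "e / (s + 1) * s \<le> e" using e s by (simp add: field_simps)
          from mult_right_mono[OF this norm_ge_zero[of "t - t0"]] show ?thesis by (simp add: mult_ac)
        qed
        finally show ?thesis .
      qed
      moreover have "d / (s + 1) > 0" using d(1) s by simp
      ultimately show "\<exists>d>0. \<forall>t\<in>{t. line_pt n a0 b t \<in> W}. cmod (t - t0) < d \<longrightarrow>
          cmod (f (line_pt n a0 b t) - f ?z - D * (t - t0)) \<le> e * cmod (t - t0)" by blast
    qed
    then show "(\<lambda>t. f (line_pt n a0 b t)) field_differentiable at t0 within {t. line_pt n a0 b t \<in> W}"
      unfolding field_differentiable_def by blast
  qed
qed

text \<open>The converse in one variable; it serves to show that flat sections are holomorphic in
  the charts of the curve.\<close>

lemma hol_Cn_1I: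
  assumes G: "G holomorphic_on V" "open V" and eq: "\<And>z. z \<in> A \<Longrightarrow> z 0 \<in> V \<and> f z = G (z 0)"
  shows "hol_Cn 1 A f"
  unfolding hol_Cn_def
proof
  fix z assume z: "z \<in> A"
  obtain D where "(G has_field_derivative D) (at (z 0))"
    using G eq[OF z] holomorphic_on_imp_differentiable_at field_differentiable_def by blast
  then have D: "\<forall>e>0. \<exists>d>0. \<forall>y. cmod (y - z 0) < d \<longrightarrow> cmod (G y - G (z 0) - D * (y - z 0)) \<le> e * cmod (y - z 0)"
    unfolding has_field_derivative_def has_derivative_at_alt by blast
  show "\<exists>a. \<forall>e>0. \<exists>d>0. \<forall>w\<in>A. (\<forall>k<1. cmod (w k - z k) < d) \<longrightarrow>
       cmod (f w - f z - (\<Sum>k<1. a k * (w k - z k))) \<le> e * (\<Sum>k<1. cmod (w k - z k))"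
    using D eq z by (intro exI[of _ "\<lambda>_. D"]) (simp, meson)
qed

text \<open>\<open>log_norm_support\<close>, applied along the line through \<open>a\<close>. The
  two conclusions have the form of the premises of \<open>psh_restrict_add\<close>.\<close>

lemma lhol_log_norm:
  assumes g: "lhol n B g1" "lhol n B g2" and B: "openin (Cn n) B" and nz: "\<And>z. z \<in> B \<Longrightarrow> g1 z \<noteq> 0 \<or> g2 z \<noteq> 0"
  defines "v \<equiv> \<lambda>z. ln ((cmod (g1 z))\<^sup>2 + (cmod (g2 z))\<^sup>2)"
  shows "continuous_map (subtopology (Cn n) B) euclidean v"
    and "a \<in> B \<Longrightarrow> \<exists>R>0. \<exists>k. k holomorphic_on ball 0 R \<and> Re (k 0) = v a \<and>
        (\<forall>t. cmod t < R \<longrightarrow> Re (k t) \<le> v (line_pt n a b t))"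
proof -
  let ?w = "\<lambda>p. (cmod (fst p))\<^sup>2 + (cmod (snd p))\<^sup>2"
  have w: "continuous_on UNIV ?w" by (intro continuous_intros)
  have c2: "continuous_map (subtopology (Cn n) B) (top_of_set {0<..}) (\<lambda>z. ?w (g1 z, g2 z))"
    unfolding continuous_map_in_subtopology
  proof
    show "continuous_map (subtopology (Cn n) B) euclidean (\<lambda>z. ?w (g1 z, g2 z))"
      using g by (intro continuous_map_compose2[OF _ _ w]) (auto simp: lhol_def)
    show "(\<lambda>z. ?w (g1 z, g2 z)) \<in> topspace (subtopology (Cn n) B) \<rightarrow> {0<..}"
    proof -
      have "0 < ?w (g1 z, g2 z)" if "z \<in> B" for z
        using nz[OF that] by (auto intro: add_pos_nonneg add_nonneg_pos)
      then show ?thesis by auto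
    qed
  qed
  have "continuous_map (top_of_set {0<..}) euclidean (ln :: real \<Rightarrow> real)"
    by (simp, intro continuous_intros) auto
  from continuous_map_compose[OF c2 this] show "continuous_map (subtopology (Cn n) B) euclidean v"
    unfolding v_def by (simp add: o_def)
  assume a: "a \<in> B"
  obtain R where R: "R > 0" "\<And>t. cmod t < R \<Longrightarrow> line_pt n a b t \<in> B"
    using line_pt_in_open[OF B a] by blast
  have h: "(\<lambda>t. g (line_pt n a b t)) holomorphic_on ball 0 R" if "lhol n B g" for g
    by (rule holomorphic_on_subset[of _ "{t. line_pt n a b t \<in> B}"]) (use that R in \<open>auto simp: lhol_def\<close>)
  have a0: "line_pt n a b 0 = a" using line_pt_0 a openin_subset[OF B] by blast
  obtain R' k where k: "R' > 0" "R' \<le> R" "k holomorphic_on ball 0 R'"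
    "Re (k 0) = ln ((cmod (g1 (line_pt n a b 0)))\<^sup>2 + (cmod (g2 (line_pt n a b 0)))\<^sup>2)"
    "\<And>t. cmod t < R' \<Longrightarrow> Re (k t) \<le> ln ((cmod (g1 (line_pt n a b t)))\<^sup>2 + (cmod (g2 (line_pt n a b t)))\<^sup>2)"
    using log_norm_support[OF h[OF g(1)] h[OF g(2)] R(1)] nz[OF a] a0 by metis
  then show "\<exists>R>0. \<exists>k. k holomorphic_on ball 0 R \<and> Re (k 0) = v a \<and>
        (\<forall>t. cmod t < R \<longrightarrow> Re (k t) \<le> v (line_pt n a b t))"
    unfolding v_def a0 by blast
qed

section \<open>Charts and flat unitary frames\<close>

subsection \<open>Charts\<close>

text \<open>Injectivity makes images of intersections under charts the intersections of the images,
  which is all that the chartwise description of the topology rests on. This form is applied to the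
  fibre product.\<close>

lemma openin_mtop_inj:
  assumes inj: "\<And>D \<phi>. (D, \<phi>) \<in> charts M \<Longrightarrow> inj_on \<phi> D"
  shows "openin (mtop M) W \<longleftrightarrow>
    W \<subseteq> points M \<and> (\<forall>(D, \<phi>)\<in>charts M. openin (Cn (mdim M)) (\<phi> ` (D \<inter> W)))"
proof -
  define P where "P = (\<lambda>W. W \<subseteq> points M \<and> (\<forall>(D, \<phi>)\<in>charts M. openin (Cn (mdim M)) (\<phi> ` (D \<inter> W))))"
  have "istopology P"
    unfolding istopology_def
  proof (intro conjI allI impI)
    fix S T assume S: "P S" and T: "P T"
    have "openin (Cn (mdim M)) (\<phi> ` (D \<inter> (S \<inter> T)))" if c: "(D, \<phi>) \<in> charts M" for D \<phi>
    proof -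
      have "\<phi> ` (D \<inter> (S \<inter> T)) = \<phi> ` (D \<inter> S) \<inter> \<phi> ` (D \<inter> T)"
        using inj[OF c] by (auto simp: inj_on_def)
      then show ?thesis using S T c by (auto simp: P_def)
    qed
    then show "P (S \<inter> T)" using S by (auto simp: P_def)
  next
    fix K assume K: "\<forall>S\<in>K. P S"
    have "openin (Cn (mdim M)) (\<phi> ` (D \<inter> \<Union>K))" if c: "(D, \<phi>) \<in> charts M" for D \<phi>
    proof -
      have "\<phi> ` (D \<inter> \<Union>K) = \<Union> ((\<lambda>S. \<phi> ` (D \<inter> S)) ` K)" by auto
      moreover have "openin (Cn (mdim M)) (\<phi> ` (D \<inter> S))" if "S \<in> K" for S
        using K c that by (auto simp: P_def)
      ultimately show ?thesis by (auto intro: openin_Union)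
    qed
    then show "P (\<Union>K)" using K by (auto simp: P_def)
  qed
  then show ?thesis
    unfolding mtop_def P_def[symmetric] by (simp add: topology_inverse' P_def)
qed

context
  fixes M :: "'a cmfd" and D :: "'a set" and \<phi> :: "'a \<Rightarrow> nat \<Rightarrow> complex"
  assumes M: "complex_manifold M" and c: "(D, \<phi>) \<in> charts M"
begin

lemma chart_inj: "inj_on \<phi> D"
  using M c by (auto simp: complex_manifold_def)

lemma chart_inv: "p \<in> D \<Longrightarrow> inv_into D \<phi> (\<phi> p) = p"
  using chart_inj by simp

lemma chart_open_image: "openin (Cn (mdim M)) (\<phi> ` D)"
  using M c by (auto simp: complex_manifold_def)

lemma chart_image_topspace: "p \<in> D \<Longrightarrow> \<phi> p \<in> topspace (Cn (mdim M))"
  using openin_subset[OF chart_open_image] by auto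

lemma chart_subset: "D \<subseteq> points M"
  using M c unfolding complex_manifold_def by force

lemma openin_chart_image: "openin (mtop M) W \<Longrightarrow> openin (Cn (mdim M)) (\<phi> ` (D \<inter> W))"
  using openin_mtop[OF M] c by auto

lemma openin_chart: "openin (mtop M) D"
proof -
  have "openin (Cn (mdim M)) (\<psi> ` (E \<inter> D))" if "(E, \<psi>) \<in> charts M" for E \<psi>
    using M c that unfolding complex_manifold_def by blast
  then show ?thesis using openin_mtop[OF M] chart_subset by auto
qed

end

lemma chart_exists:
  assumes "complex_manifold M" "p \<in> points M"
  obtains D \<phi> where "(D, \<phi>) \<in> charts M" "p \<in> D"
proof -
  have "p \<in> \<Union> (fst ` charts M)" using assms unfolding complex_manifold_def by blast
  then show thesis using that by auto
qed

lemma topspace_mtop: 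
  assumes "complex_manifold M"
  shows "topspace (mtop M) = points M"
proof
  show "topspace (mtop M) \<subseteq> points M" using openin_mtop[OF assms, of "topspace (mtop M)"] by auto
  have "\<phi> ` (D \<inter> points M) = \<phi> ` D" if "(D, \<phi>) \<in> charts M" for D \<phi>
    using chart_subset[OF assms that] by (simp add: Int_absorb2)
  then have "openin (mtop M) (points M)"
    using openin_mtop[OF assms] chart_open_image[OF assms] by auto
  then show "points M \<subseteq> topspace (mtop M)" by (rule openin_subset)
qed

lemma pt1_0: "z \<in> topspace (Cn 1) \<Longrightarrow> pt1 (z 0) = z"
  by (auto simp: pt1_def topspace_Cn fun_eq_iff PiE_def extensional_def)

lemma pt1_eq_line_pt: "pt1 t = line_pt 1 (pt1 0) (\<lambda>_. 1) t"
  by (auto simp: pt1_def line_pt_def fun_eq_iff)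

text \<open>Holomorphy read in a single chart of the curve: quotients and compositions are then
  those of functions of one complex variable, and no change of chart intervenes.\<close>

definition chol :: "'c set \<Rightarrow> ('c \<Rightarrow> nat \<Rightarrow> complex) \<Rightarrow> 'c set \<Rightarrow> ('c \<Rightarrow> complex) \<Rightarrow> bool" where
  "chol B z W a \<longleftrightarrow> (\<lambda>t. a (inv_into B z (pt1 t))) holomorphic_on {t. pt1 t \<in> z ` W}"

lemma chol_subset: "chol B z W a \<Longrightarrow> A \<subseteq> W \<Longrightarrow> chol B z A a"
  unfolding chol_def by (rule holomorphic_on_subset) auto

lemma chol_diff: "chol B z W a \<Longrightarrow> chol B z W b \<Longrightarrow> chol B z W (\<lambda>x. a x - b x)"
  unfolding chol_def by (rule holomorphic_on_diff)

lemma chol_mult: "chol B z W a \<Longrightarrow> chol B z W b \<Longrightarrow> chol B z W (\<lambda>x. a x * b x)"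
  unfolding chol_def by (rule holomorphic_on_mult)

lemma chol_divide:
  assumes "chol B z W a" "chol B z W b" and "inj_on z B" "W \<subseteq> B" and "\<And>x. x \<in> W \<Longrightarrow> b x \<noteq> 0"
  shows "chol B z W (\<lambda>x. a x / b x)"
  unfolding chol_def
proof (rule holomorphic_on_divide)
  show "(\<lambda>t. a (inv_into B z (pt1 t))) holomorphic_on {t. pt1 t \<in> z ` W}"
    "(\<lambda>t. b (inv_into B z (pt1 t))) holomorphic_on {t. pt1 t \<in> z ` W}"
    using assms(1,2) by (simp_all add: chol_def)
  fix t assume "t \<in> {t. pt1 t \<in> z ` W}"
  then obtain x where x: "x \<in> W" "pt1 t = z x" by auto
  then have "inv_into B z (pt1 t) = x" using assms(3,4) by auto
  then show "b (inv_into B z (pt1 t)) \<noteq> 0" using assms(5) x by simp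
qed

lemma hol_fun_imp_chol:
  assumes C: "complex_manifold C" "mdim C = 1" and c: "(B, z) \<in> charts C"
    and W: "openin (mtop C) W" "W \<subseteq> B" and a: "hol_fun C W a"
  shows "chol B z W a"
proof -
  have BW: "B \<inter> W = W" using W by auto
  have "hol_Cn 1 (z ` W) (\<lambda>v. a (inv_into B z v))"
    using a c C(2) BW unfolding hol_fun_def by fastforce
  moreover have "openin (Cn 1) (z ` W)" using openin_chart_image[OF C(1) c W(1)] C(2) BW by simp
  ultimately have "lhol 1 (z ` W) (\<lambda>v. a (inv_into B z v))" by (rule hol_Cn_imp_lhol)
  then have "(\<lambda>t. a (inv_into B z (line_pt 1 (pt1 0) (\<lambda>_. 1) t))) holomorphic_on {t. line_pt 1 (pt1 0) (\<lambda>_. 1) t \<in> z ` W}"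
    unfolding lhol_def by blast
  then show ?thesis unfolding chol_def by (simp only: pt1_eq_line_pt[symmetric])
qed

text \<open>Holomorphy of \<open>f\<close> is available through the coordinate
  \<open>\<zeta>\<close> of its image, so the pullback of \<open>a\<close> is a one-variable
  holomorphic function composed with \<open>\<zeta>\<close>.\<close>

lemma chol_pullback:
  assumes X: "complex_manifold X" and C: "complex_manifold C" "mdim C = 1" and f: "hol_map X C f"
    and cX: "(D, \<phi>) \<in> charts X" and c: "(B, z) \<in> charts C" and W: "W \<subseteq> B" and a: "chol B z W a"
  shows "lhol (mdim X) (\<phi> ` (D \<inter> {p \<in> points X. f p \<in> W})) (\<lambda>v. a (f (inv_into D \<phi> v)))"
proof -
  let ?A = "\<phi> ` (D \<inter> {p \<in> points X. f p \<in> B})" and ?A' = "\<phi> ` (D \<inter> {p \<in> points X. f p \<in> W})"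
  define \<zeta> where "\<zeta> = (\<lambda>v. z (f (inv_into D \<phi> v)) 0)"
  have "hol_fun X {p \<in> points X. f p \<in> B} (\<lambda>p. z (f p) 0)"
    using f c C(2) unfolding hol_map_def by force
  then have "hol_Cn (mdim X) ?A \<zeta>"
    using cX unfolding hol_fun_def \<zeta>_def by fastforce
  moreover have "openin (Cn (mdim X)) ?A"
  proof (rule openin_chart_image[OF X cX])
    have "continuous_map (mtop X) (mtop C) f" using f unfolding hol_map_def by blast
    from openin_continuous_map_preimage[OF this openin_chart[OF C(1) c]]
    show "openin (mtop X) {p \<in> points X. f p \<in> B}" by (simp add: topspace_mtop[OF X])
  qed
  ultimately have "lhol (mdim X) ?A \<zeta>" by (rule hol_Cn_imp_lhol)
  then have z: "lhol (mdim X) ?A' \<zeta>" by (rule lhol_subset) (use W in auto)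
  have v: "pt1 (\<zeta> v) = z (f (inv_into D \<phi> v)) \<and> f (inv_into D \<phi> v) \<in> W" if vA: "v \<in> ?A'" for v
  proof -
    obtain p where p: "p \<in> D" "v = \<phi> p" "f p \<in> W" using vA by auto
    then have "z (f p) \<in> topspace (Cn 1)" using chart_image_topspace[OF C(1) c, of "f p"] W C(2) by auto
    then show ?thesis using p pt1_0 chart_inv[OF X cX] by (simp add: \<zeta>_def)
  qed
  have "lhol (mdim X) ?A' (\<lambda>v. a (inv_into B z (pt1 (\<zeta> v))))"
    by (rule lhol_compose[OF z a[unfolded chol_def]]) (use v in auto)
  then show ?thesis
  proof (rule lhol_cong)
    fix v assume "v \<in> ?A'"
    from v[OF this] show "a (f (inv_into D \<phi> v)) = a (inv_into B z (pt1 (\<zeta> v)))"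
      using chart_inv[OF C(1) c] W by auto
  qed
qed


subsection \<open>Flat unitary frames\<close>

text \<open>A unitary basis, encoded as the coordinate map from pairs of numbers onto the fibre,
  linear and norm-preserving. Vectors, lines and frames thereby become statements about pairs (a,
  b).\<close>

definition unit_basis :: "('c, 'i) vbundle \<Rightarrow> ('c \<Rightarrow> 'i fvec \<Rightarrow> 'i fvec \<Rightarrow> complex) \<Rightarrow> 'c \<Rightarrow>
    (complex \<Rightarrow> complex \<Rightarrow> 'i fvec) \<Rightarrow> bool" where
  "unit_basis V h x e \<longleftrightarrow> (\<forall>a b. e a b \<in> vb_fibre V x) \<and> (\<forall>v\<in>vb_fibre V x. \<exists>a b. v = e a b) \<and>
     (\<forall>a b a' b'. e a b = e a' b' \<longrightarrow> a = a' \<and> b = b') \<and>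
     (\<forall>a b a' b'. fadd (e a b) (e a' b') = e (a + a') (b + b')) \<and>
     (\<forall>c a b. fscale c (e a b) = e (c * a) (c * b)) \<and>
     (\<forall>a b. h x (e a b) (e a b) = of_real ((cmod a)\<^sup>2 + (cmod b)\<^sup>2))"

text \<open>Flatness is expressed by fixing (a, b): the section with constant coordinates is
  holomorphic and has constant norm on \<open>W\<close>. \<open>W\<close> stays in one chart of the
  curve and one trivialization of \<open>V\<close>, where coefficients of other frames can be
  computed.\<close>

definition flat_chart :: "'c cmfd \<Rightarrow> ('c, 'i) vbundle \<Rightarrow> ('c \<Rightarrow> 'i fvec \<Rightarrow> 'i fvec \<Rightarrow> complex) \<Rightarrow>
    'c set \<Rightarrow> ('c \<Rightarrow> complex \<Rightarrow> complex \<Rightarrow> 'i fvec) \<Rightarrow> 'c set \<Rightarrow> ('c \<Rightarrow> nat \<Rightarrow> complex) \<Rightarrow> bool" where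
  "flat_chart C V h W E B z \<longleftrightarrow> openin (mtop C) W \<and> (B, z) \<in> charts C \<and> W \<subseteq> B \<and>
     (\<exists>i\<in>vb_idx V. W \<subseteq> vb_dom V i) \<and> (\<forall>x\<in>W. unit_basis V h x (E x)) \<and>
     (\<forall>a b. \<forall>i\<in>vb_idx V. \<forall>k<2. hol_fun C (W \<inter> vb_dom V i) (\<lambda>x. vec_index (E x a b i) k))"

definition vec2 :: "complex \<Rightarrow> complex \<Rightarrow> complex Matrix.vec" where
  "vec2 a b = Matrix.vec 2 (\<lambda>k. if k = 0 then a else b)"

lemma vec2_carrier: "vec2 a b \<in> carrier_vec 2"
  by (simp add: vec2_def)

lemma vec2_add: "vec2 a b + vec2 a' b' = vec2 (a + a') (b + b')"
  by (rule eq_vecI) (auto simp: vec2_def)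

lemma vec2_smult: "c \<cdot>\<^sub>v vec2 a b = vec2 (c * a) (c * b)"
  by (rule eq_vecI) (auto simp: vec2_def)

lemma vec2_index: "vec_index (vec2 a b) 0 = a" "vec_index (vec2 a b) 1 = b"
  by (simp_all add: vec2_def)

lemma vec2_inj: "vec2 a b = vec2 a' b' \<Longrightarrow> a = a' \<and> b = b'"
  by (metis vec2_index)

lemma vec2_surj: "v \<in> carrier_vec 2 \<Longrightarrow> v = vec2 (vec_index v 0) (vec_index v 1)"
  by (rule eq_vecI) (auto simp: vec2_def less_2_cases_iff)

lemma vec2_norm: "vec2 a b \<bullet>c vec2 a b = of_real ((cmod a)\<^sup>2 + (cmod b)\<^sup>2)"
proof -
  have "vec2 a b \<bullet>c vec2 a b = a * cnj a + b * cnj b"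
    by (simp add: vec2_def scalar_prod_def numeral_2_eq_2)
  then show ?thesis by (simp only: of_real_add complex_norm_square)
qed

text \<open>Over an evenly covered neighbourhood, a sheet \<open>S\<close> of the universal cover
  gives a section \<open>\<sigma>\<close> of \<open>u\<close>, and \<open>T (\<sigma> y) a\<close>
  with fixed \<open>a\<close> is a flat section. It is holomorphic in charts of the curve because
  \<open>u\<close> followed by a chart is injective and holomorphic on the part of \<open>S\<close>
  over that chart, so that its inverse is holomorphic too.\<close>

lemma flat_chart_exists:
  assumes C: "complex_manifold C" "mdim C = 1" and V: "vb_rank V = 2"
    and dom: "\<And>i. i \<in> vb_idx V \<Longrightarrow> openin (mtop C) (vb_dom V i)" "points C \<subseteq> \<Union> (vb_dom V ` vb_idx V)"
    and h: "unitary_flat_metric C V h" and x: "x \<in> points C"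
  obtains W E B z where "x \<in> W" "flat_chart C V h W E B z"
proof -
  let ?H = upper_half_plane
  obtain u \<rho> and T :: "complex \<Rightarrow> complex Matrix.vec \<Rightarrow> 'b fvec" where uc: "hol_universal_cover C u"
    and T: "\<forall>z\<in>?H. bij_betw (T z) (carrier_vec 2) (vb_fibre V (u z)) \<and>
        (\<forall>a\<in>carrier_vec 2. \<forall>b\<in>carrier_vec 2. T z (a + b) = fadd (T z a) (T z b)) \<and>
        (\<forall>c. \<forall>a\<in>carrier_vec 2. T z (c \<cdot>\<^sub>v a) = fscale c (T z a))"
    and Th: "\<forall>a\<in>carrier_vec 2. \<forall>i\<in>vb_idx V. \<forall>k<2.
        (\<lambda>z. vec_index (T z a i) k) holomorphic_on {z \<in> ?H. u z \<in> vb_dom V i}"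
    and Tn: "\<forall>z\<in>?H. \<forall>a\<in>carrier_vec 2. \<forall>b\<in>carrier_vec 2. h (u z) (T z a) (T z b) = a \<bullet>c b"
    using h unfolding unitary_flat_metric_def V by (elim exE conjE) (rule that; assumption)
  have ub: "unit_basis V h (u \<zeta>) (\<lambda>a b. T \<zeta> (vec2 a b))" if \<zeta>: "\<zeta> \<in> ?H" for \<zeta>
  proof -
    have bij: "bij_betw (T \<zeta>) (carrier_vec 2) (vb_fibre V (u \<zeta>))" using T \<zeta> by blast
    show ?thesis
      unfolding unit_basis_def
    proof (intro conjI allI ballI impI)
      show "T \<zeta> (vec2 a b) \<in> vb_fibre V (u \<zeta>)" for a b
        using bij vec2_carrier bij_betw_apply by metis
      show "\<exists>a b. v = T \<zeta> (vec2 a b)" if "v \<in> vb_fibre V (u \<zeta>)" for v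
        using bij that vec2_surj unfolding bij_betw_def by (metis imageE)
      show "a = a'" "b = b'" if "T \<zeta> (vec2 a b) = T \<zeta> (vec2 a' b')" for a b a' b'
      proof -
        have "vec2 a b = vec2 a' b'"
          using bij that vec2_carrier unfolding bij_betw_def inj_on_def by blast
        then show "a = a'" "b = b'" using vec2_inj by blast+
      qed
      show "fadd (T \<zeta> (vec2 a b)) (T \<zeta> (vec2 a' b')) = T \<zeta> (vec2 (a + a') (b + b'))" for a b a' b'
        using T \<zeta> vec2_carrier by (simp flip: vec2_add)
      show "fscale c (T \<zeta> (vec2 a b)) = T \<zeta> (vec2 (c * a) (c * b))" for c a b
        using T \<zeta> vec2_carrier by (simp flip: vec2_smult)
      show "h (u \<zeta>) (T \<zeta> (vec2 a b)) (T \<zeta> (vec2 a b)) = of_real ((cmod a)\<^sup>2 + (cmod b)\<^sup>2)" for a b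
        using Tn \<zeta> vec2_carrier vec2_norm by metis
    qed
  qed
  obtain W0 \<S> where W0: "openin (mtop C) W0" "x \<in> W0" "\<Union>\<S> = {z \<in> ?H. u z \<in> W0}"
      "\<And>S. S \<in> \<S> \<Longrightarrow> open S \<and> homeomorphic_map (top_of_set S) (subtopology (mtop C) W0) u"
    using uc x unfolding hol_universal_cover_def by meson
  \<comment> \<open>A preimage of \<open>x\<close> only shows that some sheet exists; each sheet is
    mapped homeomorphically onto \<open>W0\<close>.\<close>
  obtain \<zeta>0 where "\<zeta>0 \<in> ?H" "u \<zeta>0 = x"
    using uc x unfolding hol_universal_cover_def by (metis imageE)
  then have "\<zeta>0 \<in> \<Union>\<S>" using W0 by simp
  then obtain S where S: "S \<in> \<S>" by blast
  have So: "open S" and hm: "homeomorphic_map (top_of_set S) (subtopology (mtop C) W0) u"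
    using W0(4)[OF S] by auto
  have SH: "S \<subseteq> ?H" using W0(3) S by blast
  have uS: "u ` S = W0" and injS: "inj_on u S" and uc': "continuous_map (top_of_set S) (mtop C) u"
    using hm openin_subset[OF W0(1)] unfolding homeomorphic_eq_everything_map
    by (auto simp: continuous_map_in_subtopology Int_absorb1)
  define \<sigma> where "\<sigma> = inv_into S u"
  have \<sigma>: "\<sigma> y \<in> S" "u (\<sigma> y) = y" if "y \<in> W0" for y
    using that uS unfolding \<sigma>_def by (auto simp: inv_into_into f_inv_into_f)
  have \<sigma>u: "\<sigma> (u \<zeta>) = \<zeta>" if "\<zeta> \<in> S" for \<zeta>
    unfolding \<sigma>_def using that injS by simp
  obtain B z where B: "(B, z) \<in> charts C" "x \<in> B" using chart_exists[OF C(1) x] by blast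
  obtain i where i: "i \<in> vb_idx V" "x \<in> vb_dom V i" using dom(2) x by auto
  define W where "W = W0 \<inter> B \<inter> vb_dom V i"
  define E where "E = (\<lambda>y a b. T (\<sigma> y) (vec2 a b))"
  have Wo: "openin (mtop C) W"
    unfolding W_def by (intro openin_Int W0(1) openin_chart[OF C(1) B(1)] dom(1) i(1))
  have "hol_fun C (W \<inter> vb_dom V j) (\<lambda>y. vec_index (E y a b j) k)" if j: "j \<in> vb_idx V" "k < 2" for a b j k
    unfolding hol_fun_def
  proof clarify
    fix D \<phi> assume c: "(D, \<phi>) \<in> charts C"
    define Q where "Q = D \<inter> (W \<inter> vb_dom V j)"
    have Qo: "openin (mtop C) Q"
      unfolding Q_def by (intro openin_Int openin_chart[OF C(1) c] Wo dom(1) j(1))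
    define O' where "O' = {\<zeta> \<in> S. u \<zeta> \<in> Q}"
    have "openin (top_of_set S) O'"
      using openin_continuous_map_preimage[OF uc' Qo] by (simp add: O'_def)
    then have O'o: "open O'" using So openin_open_eq by blast
    \<comment> \<open>The coordinate of the curve read on the sheet; its inverse \<open>g\<close> is
      \<open>\<sigma>\<close> expressed in that coordinate.\<close>
    define \<kappa> where "\<kappa> = (\<lambda>\<zeta>. \<phi> (u \<zeta>) 0)"
    have "(\<lambda>\<zeta>. \<phi> (u \<zeta>) 0) holomorphic_on {\<zeta> \<in> ?H. u \<zeta> \<in> D}"
      using uc c unfolding hol_universal_cover_def by blast
    then have \<kappa>: "\<kappa> holomorphic_on O'"
      unfolding \<kappa>_def by (rule holomorphic_on_subset) (use SH in \<open>auto simp: O'_def Q_def\<close>)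
    have \<kappa>i: "inj_on \<kappa> O'"
    proof (rule inj_onI)
      fix \<zeta> \<xi> assume o: "\<zeta> \<in> O'" "\<xi> \<in> O'" and eq: "\<kappa> \<zeta> = \<kappa> \<xi>"
      then have d: "u \<zeta> \<in> D" "u \<xi> \<in> D" by (auto simp: O'_def Q_def)
      then have "\<phi> (u \<zeta>) = \<phi> (u \<xi>)"
        using eq chart_image_topspace[OF C(1) c] pt1_0 C(2) unfolding \<kappa>_def by metis
      then have "u \<zeta> = u \<xi>" using chart_inv[OF C(1) c] d by metis
      then show "\<zeta> = \<xi>" using injS o by (auto simp: O'_def inj_on_def)
    qed
    obtain g where g: "g holomorphic_on (\<kappa> ` O')" "\<And>\<zeta>. \<zeta> \<in> O' \<Longrightarrow> g (\<kappa> \<zeta>) = \<zeta>"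
      using holomorphic_has_inverse[OF \<kappa> O'o \<kappa>i] by metis
    have ko: "open (\<kappa> ` O')" by (rule open_mapping_thm3[OF \<kappa> O'o \<kappa>i])
    have Gh: "(\<lambda>\<zeta>. vec_index (T \<zeta> (vec2 a b) j) k) holomorphic_on {\<zeta> \<in> ?H. u \<zeta> \<in> vb_dom V j}"
      using Th j vec2_carrier by blast
    have "((\<lambda>\<zeta>. vec_index (T \<zeta> (vec2 a b) j) k) \<circ> g) holomorphic_on (\<kappa> ` O')"
      by (rule holomorphic_on_compose_gen[OF g(1) Gh]) (use g(2) SH in \<open>auto simp: O'_def Q_def\<close>)
    then have "hol_Cn 1 (\<phi> ` Q) (\<lambda>v. vec_index (E (inv_into D \<phi> v) a b j) k)"
    proof (rule hol_Cn_1I[OF _ ko])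
      fix v assume "v \<in> \<phi> ` Q"
      then obtain p where p: "p \<in> Q" "v = \<phi> p" by auto
      then have pW: "p \<in> W0" "p \<in> D" by (auto simp: Q_def W_def)
      have so: "\<sigma> p \<in> O'" using \<sigma>[OF pW(1)] p by (simp add: O'_def)
      have eq: "\<kappa> (\<sigma> p) = v 0" using \<sigma>[OF pW(1)] p by (simp add: \<kappa>_def)
      have "v 0 \<in> \<kappa> ` O'" using imageI[OF so, of \<kappa>] unfolding eq .
      with eq show "v 0 \<in> \<kappa> ` O' \<and> vec_index (E (inv_into D \<phi> v) a b j) k =
          ((\<lambda>\<zeta>. vec_index (T \<zeta> (vec2 a b) j) k) \<circ> g) (v 0)"
        using so g(2)[OF so] chart_inv[OF C(1) c pW(2)] p by (simp add: E_def)
    qed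
    then show "hol_Cn (mdim C) (\<phi> ` (D \<inter> (W \<inter> vb_dom V j))) (\<lambda>v. vec_index (E (inv_into D \<phi> v) a b j) k)"
      by (simp add: C(2) Q_def)
  qed
  moreover have "unit_basis V h y (E y)" if "y \<in> W" for y
  proof -
    have y: "y \<in> W0" using that by (simp add: W_def)
    show ?thesis using ub[of "\<sigma> y"] \<sigma>[OF y] SH unfolding E_def by auto
  qed
  ultimately have "flat_chart C V h W E B z"
    unfolding flat_chart_def using Wo B(1) i(1) by (auto simp: W_def)
  moreover have "x \<in> W" using W0(2) B(2) i(2) by (simp add: W_def)
  ultimately show thesis by (rule that[rotated])
qed

subsection \<open>Local frames in a unitary basis\<close>

text \<open>A frame at one point as an invertible 2-by-2 matrix. The affine coordinate of a line
  [a : b] in this frame is then a Moebius transform of [a : b].\<close>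

definition frame_at :: "(complex \<Rightarrow> complex \<Rightarrow> 'i fvec) \<Rightarrow> ('c, 'i) frame \<Rightarrow> 'c \<Rightarrow>
    complex \<Rightarrow> complex \<Rightarrow> complex \<Rightarrow> complex \<Rightarrow> bool" where
  "frame_at e s x p1 p2 q1 q2 \<longleftrightarrow> x \<in> fst s \<and> fst (snd s) x = e p1 p2 \<and> snd (snd s) x = e q1 q2 \<and>
     p1 * q2 - p2 * q1 \<noteq> 0"

context
  fixes V :: "('c, 'i) vbundle" and h :: "'c \<Rightarrow> 'i fvec \<Rightarrow> 'i fvec \<Rightarrow> complex" and x :: 'c
    and e :: "complex \<Rightarrow> complex \<Rightarrow> 'i fvec"
  assumes ub: "unit_basis V h x e"
begin

lemma ub_mem: "e a b \<in> vb_fibre V x" and ub_ex: "v \<in> vb_fibre V x \<Longrightarrow> \<exists>a b. v = e a b"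
  and ub_inj: "e a b = e a' b' \<longleftrightarrow> a = a' \<and> b = b'"
  and ub_add: "fadd (e a b) (e a' b') = e (a + a') (b + b')"
  and ub_scale: "fscale c (e a b) = e (c * a) (c * b)"
  and ub_norm: "h x (e a b) (e a b) = of_real ((cmod a)\<^sup>2 + (cmod b)\<^sup>2)"
  using ub unfolding unit_basis_def by blast+

text \<open>A vector lies on its own line, so equal lines have proportional generators; the factor
  is nonzero because the second generator is.\<close>

lemma ub_fline:
  assumes nz: "a' \<noteq> 0 \<or> b' \<noteq> 0"
  shows "fline (e a b) = fline (e a' b') \<longleftrightarrow> (\<exists>c. c \<noteq> 0 \<and> a' = c * a \<and> b' = c * b)"
proof
  assume eq: "fline (e a b) = fline (e a' b')"
  have "e a' b' = fscale 1 (e a' b')" by (simp add: ub_scale)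
  then have "e a' b' \<in> fline (e a' b')" unfolding fline_def by blast
  then have "e a' b' \<in> fline (e a b)" by (simp only: eq)
  then obtain c where "e a' b' = e (c * a) (c * b)" unfolding fline_def by (auto simp: ub_scale)
  then have "a' = c * a" "b' = c * b" by (auto simp: ub_inj)
  then show "\<exists>c. c \<noteq> 0 \<and> a' = c * a \<and> b' = c * b" using nz by auto
next
  assume "\<exists>c. c \<noteq> 0 \<and> a' = c * a \<and> b' = c * b"
  then obtain c where c: "c \<noteq> 0" "a' = c * a" "b' = c * b" by blast
  show "fline (e a b) = fline (e a' b')"
  proof
    show "fline (e a b) \<subseteq> fline (e a' b')"
    proof
      fix v assume "v \<in> fline (e a b)"
      then obtain k where "v = e (k * a) (k * b)" unfolding fline_def by (auto simp: ub_scale)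
      then have "v = fscale (k / c) (e a' b')" using c by (simp add: ub_scale)
      then show "v \<in> fline (e a' b')" unfolding fline_def by blast
    qed
    show "fline (e a' b') \<subseteq> fline (e a b)"
    proof
      fix v assume "v \<in> fline (e a' b')"
      then obtain k where "v = e (k * a') (k * b')" unfolding fline_def by (auto simp: ub_scale)
      then have "v = fscale (k * c) (e a b)" using c by (simp add: ub_scale mult.assoc)
      then show "v \<in> fline (e a b)" unfolding fline_def by blast
    qed
  qed
qed

lemma frame_at_exists:
  assumes s: "s \<in> hol_frames C V" and x: "x \<in> fst s"
  shows "\<exists>p1 p2 q1 q2. frame_at e s x p1 p2 q1 q2"
proof -
  obtain W s1 s2 where ss: "s = (W, s1, s2)" by (cases s)
  have x': "s1 x \<in> vb_fibre V x" "s2 x \<in> vb_fibre V x"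
    "\<And>a b. fadd (fscale a (s1 x)) (fscale b (s2 x)) = fscale 0 (s1 x) \<Longrightarrow> a = 0 \<and> b = 0"
    using s x unfolding hol_frames_def ss by auto
  obtain p1 p2 q1 q2 where p: "s1 x = e p1 p2" "s2 x = e q1 q2" using ub_ex x' by metis
  have ind: "a = 0 \<and> b = 0" if "a * p1 + b * q1 = 0" "a * p2 + b * q2 = 0" for a b
    using x'(3)[of a b] that by (simp add: p ub_scale ub_add)
  have "p1 * q2 - p2 * q1 \<noteq> 0"
  proof
    assume d: "p1 * q2 - p2 * q1 = 0"
    \<comment> \<open>If the determinant vanishes, (q1, -p1) and (q2, -p2) are the coefficients of
      linear relations between the two vectors. Independence makes them zero, and then the first
      vector vanishes.\<close>
    have "q1 = 0 \<and> - p1 = 0" by (rule ind) (use d in \<open>auto simp: algebra_simps\<close>)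
    moreover have "q2 = 0 \<and> - p2 = 0" by (rule ind) (use d in \<open>auto simp: algebra_simps\<close>)
    ultimately show False using ind[of 1 0] by simp
  qed
  then show ?thesis using x p unfolding frame_at_def ss by auto
qed

context
  fixes s :: "('c, 'i) frame" and p1 p2 q1 q2 :: complex
  assumes fa: "frame_at e s x p1 p2 q1 q2"
begin

lemma frame_at_vec: "frame_vec s x w = e (p1 + w * q1) (p2 + w * q2)"
  using fa unfolding frame_at_def frame_vec_def by (cases s) (simp add: ub_scale ub_add)

text \<open>A column operation. It shows that the generator of a line never vanishes, and it
  determines the proportionality factor in \<open>frame_at_coord\<close>.\<close>

lemma frame_at_det: "(p1 + w * q1) * q2 - (p2 + w * q2) * q1 = p1 * q2 - p2 * q1"
  by (simp add: algebra_simps)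

lemma frame_at_nz: "p1 + w * q1 \<noteq> 0 \<or> p2 + w * q2 \<noteq> 0"
  using frame_at_det[of w] fa unfolding frame_at_def by (metis diff_zero mult_zero_left)

lemma frame_at_coord: "frame_coord s (x, fline (frame_vec s x w)) = w"
  unfolding frame_coord_def
proof (rule the_equality)
  fix w' assume "snd (x, fline (frame_vec s x w)) = fline (frame_vec s (fst (x, fline (frame_vec s x w))) w')"
  then have "fline (e (p1 + w * q1) (p2 + w * q2)) = fline (e (p1 + w' * q1) (p2 + w' * q2))"
    by (simp add: frame_at_vec)
  then obtain c where c: "p1 + w' * q1 = c * (p1 + w * q1)" "p2 + w' * q2 = c * (p2 + w * q2)"
    using ub_fline[OF frame_at_nz[of w']] by blast
  have d: "p1 * q2 - p2 * q1 \<noteq> 0" using fa unfolding frame_at_def by blast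
  \<comment> \<open>The determinant with (q1, q2) eliminates both coordinates and leaves c =
    1.\<close>
  have "(p1 + w' * q1) * q2 - (p2 + w' * q2) * q1 = c * ((p1 + w * q1) * q2 - (p2 + w * q2) * q1)"
    unfolding c by (simp add: algebra_simps)
  then have "p1 * q2 - p2 * q1 = c * (p1 * q2 - p2 * q1)" unfolding frame_at_det .
  then have "c = 1" using d by simp
  then have "(w' - w) * q1 = 0" "(w' - w) * q2 = 0" using c by (auto simp: algebra_simps)
  then show "w' = w" using d by auto
qed simp

text \<open>Cramer's rule: the affine chart misses exactly the line of the second frame vector (q1,
  q2), where the denominator vanishes.\<close>

lemma frame_at_dom:
  assumes nz: "a \<noteq> 0 \<or> b \<noteq> 0"
  shows "(x, fline (e a b)) \<in> frame_dom s \<longleftrightarrow> a * q2 - b * q1 \<noteq> 0" (is "?L \<longleftrightarrow> ?R")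
    and "a * q2 - b * q1 \<noteq> 0 \<Longrightarrow>
      fline (e a b) = fline (frame_vec s x ((p1 * b - p2 * a) / (a * q2 - b * q1)))"
proof -
  have d: "p1 * q2 - p2 * q1 \<noteq> 0" and x: "x \<in> fst s" using fa unfolding frame_at_def by blast+
  have RL: "fline (e a b) = fline (frame_vec s x ((p1 * b - p2 * a) / (a * q2 - b * q1)))" if R: ?R
  proof -
    let ?w = "(p1 * b - p2 * a) / (a * q2 - b * q1)" and ?c = "(p1 * q2 - p2 * q1) / (a * q2 - b * q1)"
    have "p1 + ?w * q1 = ?c * a" "p2 + ?w * q2 = ?c * b" using R by (auto simp: field_simps)
    moreover have "?c \<noteq> 0" using d R by simp
    ultimately show ?thesis unfolding frame_at_vec using ub_fline[OF frame_at_nz[of ?w]] by blast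
  qed
  then show "?R \<Longrightarrow> fline (e a b) = fline (frame_vec s x ((p1 * b - p2 * a) / (a * q2 - b * q1)))" .
  show "?L \<longleftrightarrow> ?R"
  proof
    assume ?L
    then obtain w where "fline (frame_vec s x w) = fline (e a b)" unfolding frame_dom_def by auto
    then obtain c where c: "c \<noteq> 0" "a = c * (p1 + w * q1)" "b = c * (p2 + w * q2)"
      using ub_fline[OF nz] unfolding frame_at_vec by blast
    have "a * q2 - b * q1 = c * ((p1 + w * q1) * q2 - (p2 + w * q2) * q1)"
      unfolding c by (simp add: algebra_simps)
    then show ?R using c d unfolding frame_at_det by simp
  next
    assume ?R
    then show ?L using RL x unfolding frame_dom_def by blast
  qed
qed

text \<open>\<open>\<delta>\<close> is the factor that carries a representative (a, b) of the line
  to the normalized generator; as the basis is unitary, the weight is the logarithm of a squared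
  Euclidean norm.\<close>

lemma frame_at_gen:
  assumes nz: "a \<noteq> 0 \<or> b \<noteq> 0" and d: "a * q2 - b * q1 \<noteq> 0"
  defines "\<delta> \<equiv> (p1 * q2 - p2 * q1) / (a * q2 - b * q1)"
  shows "frame_gen s (x, fline (e a b)) = e (a * \<delta>) (b * \<delta>)"
    and "O1_metric h s (x, fline (e a b)) = ereal (ln ((cmod (a * \<delta>))\<^sup>2 + (cmod (b * \<delta>))\<^sup>2))"
    and "a * \<delta> \<noteq> 0 \<or> b * \<delta> \<noteq> 0"
proof -
  let ?w = "(p1 * b - p2 * a) / (a * q2 - b * q1)"
  have y: "(x, fline (e a b)) = (x, fline (frame_vec s x ?w))" using frame_at_dom(2)[OF nz d] by simp
  have "frame_gen s (x, fline (e a b)) = frame_vec s x ?w"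
    unfolding y frame_gen_def frame_at_coord by simp
  moreover have "p1 + ?w * q1 = a * \<delta>" "p2 + ?w * q2 = b * \<delta>"
    using d by (auto simp: \<delta>_def field_simps)
  ultimately show g: "frame_gen s (x, fline (e a b)) = e (a * \<delta>) (b * \<delta>)" unfolding frame_at_vec by simp
  show "O1_metric h s (x, fline (e a b)) = ereal (ln ((cmod (a * \<delta>))\<^sup>2 + (cmod (b * \<delta>))\<^sup>2))"
    unfolding O1_metric_def g by (simp only: fst_conv ub_norm Re_complex_of_real)
  have "\<delta> \<noteq> 0" using d fa unfolding \<delta>_def frame_at_def by simp
  then show "a * \<delta> \<noteq> 0 \<or> b * \<delta> \<noteq> 0" using nz by simp
qed

end

text \<open>The generators for \<open>s\<close> and \<open>t\<close> are multiples of one vector (a,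
  b), so the transition function is the quotient of the two factors.\<close>

lemma O1_metric_trans:
  assumes s: "s \<in> hol_frames C V" and t: "t \<in> hol_frames C V"
    and y: "y \<in> frame_dom s" "y \<in> frame_dom t" "fst y = x"
  shows "lb_trans (O1 C F) s t y \<noteq> 0"
    and "O1_metric h s y = O1_metric h t y + ereal (ln ((cmod (lb_trans (O1 C F) s t y))\<^sup>2))"
proof -
  have xs: "x \<in> fst s" "x \<in> fst t" using y unfolding frame_dom_def by auto
  obtain p1 p2 q1 q2 where fs: "frame_at e s x p1 p2 q1 q2" using frame_at_exists[OF s xs(1)] by blast
  obtain p1' p2' q1' q2' where ft: "frame_at e t x p1' p2' q1' q2'" using frame_at_exists[OF t xs(2)] by blast
  obtain w where w: "y = (x, fline (frame_vec s x w))" using y unfolding frame_dom_def by auto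
  define a b where "a = p1 + w * q1" and "b = p2 + w * q2"
  have yab: "y = (x, fline (e a b))" unfolding w frame_at_vec[OF fs] a_def b_def ..
  have nz: "a \<noteq> 0 \<or> b \<noteq> 0" unfolding a_def b_def by (rule frame_at_nz[OF fs])
  define ds dt where "ds = a * q2 - b * q1" and "dt = a * q2' - b * q1'"
  have d: "ds \<noteq> 0" "dt \<noteq> 0"
    using y(1,2) frame_at_dom(1)[OF fs nz] frame_at_dom(1)[OF ft nz] unfolding yab ds_def dt_def by auto
  define \<delta>s \<delta>t where "\<delta>s = (p1 * q2 - p2 * q1) / ds" and "\<delta>t = (p1' * q2' - p2' * q1') / dt"
  have \<delta>: "\<delta>s \<noteq> 0" "\<delta>t \<noteq> 0" using d fs ft unfolding frame_at_def \<delta>s_def \<delta>t_def by auto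
  have gs: "frame_gen s y = e (a * \<delta>s) (b * \<delta>s)"
    "O1_metric h s y = ereal (ln ((cmod (a * \<delta>s))\<^sup>2 + (cmod (b * \<delta>s))\<^sup>2))"
    using frame_at_gen[OF fs nz] d(1) unfolding yab \<delta>s_def ds_def by auto
  have gt: "frame_gen t y = e (a * \<delta>t) (b * \<delta>t)"
    "O1_metric h t y = ereal (ln ((cmod (a * \<delta>t))\<^sup>2 + (cmod (b * \<delta>t))\<^sup>2))"
    using frame_at_gen[OF ft nz] d(2) unfolding yab \<delta>t_def dt_def by auto
  have "(THE c. frame_gen s y = fscale c (frame_gen t y)) = \<delta>s / \<delta>t"
  proof (rule the_equality)
    show "frame_gen s y = fscale (\<delta>s / \<delta>t) (frame_gen t y)"
      unfolding gs gt ub_scale ub_inj using \<delta> by simp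
    fix c assume "frame_gen s y = fscale c (frame_gen t y)"
    then have "a * \<delta>s = c * (a * \<delta>t)" "b * \<delta>s = c * (b * \<delta>t)" unfolding gs gt ub_scale ub_inj by auto
    then have "\<delta>s = c * \<delta>t" using nz by auto
    then show "c = \<delta>s / \<delta>t" using \<delta> by simp
  qed
  then have tr: "lb_trans (O1 C F) s t y = \<delta>s / \<delta>t" by (simp add: O1_def)
  then show "lb_trans (O1 C F) s t y \<noteq> 0" using \<delta> by simp
  define r where "r = (cmod a)\<^sup>2 + (cmod b)\<^sup>2"
  have r: "r > 0" using nz unfolding r_def by (auto intro: add_pos_nonneg add_nonneg_pos)
  have sq: "(cmod (a * k))\<^sup>2 + (cmod (b * k))\<^sup>2 = r * (cmod k)\<^sup>2" for k
    by (simp add: r_def norm_mult power_mult_distrib distrib_right)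
  have "r * (cmod \<delta>s)\<^sup>2 = (r * (cmod \<delta>t)\<^sup>2) * (cmod (\<delta>s / \<delta>t))\<^sup>2"
    using \<delta> by (simp add: norm_divide power_divide)
  moreover have "ln ((r * (cmod \<delta>t)\<^sup>2) * (cmod (\<delta>s / \<delta>t))\<^sup>2) = ln (r * (cmod \<delta>t)\<^sup>2) + ln ((cmod (\<delta>s / \<delta>t))\<^sup>2)"
    using r \<delta> by (intro ln_mult_pos mult_pos_pos) auto
  ultimately show "O1_metric h s y = O1_metric h t y + ereal (ln ((cmod (lb_trans (O1 C F) s t y))\<^sup>2))"
    unfolding tr gs(2) gt(2) sq by (simp only: plus_ereal.simps)
qed

end

section \<open>Flat unitary frames over a curve, for a bundle in the role of the dual of F\<close>

locale flat_bundle =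
  fixes C :: "'c cmfd" and V :: "('c, 'i) vbundle" and h :: "'c \<Rightarrow> 'i fvec \<Rightarrow> 'i fvec \<Rightarrow> complex"
  assumes C: "complex_manifold C" and C1: "mdim C = 1" and V: "vb_rank V = 2"
    and dom_open: "i \<in> vb_idx V \<Longrightarrow> openin (mtop C) (vb_dom V i)"
    and dom_cover: "points C \<subseteq> \<Union> (vb_dom V ` vb_idx V)"
    and flat: "unitary_flat_metric C V h"
begin

lemma flat_chart_at:
  assumes "x \<in> points C"
  obtains W E B z where "x \<in> W" "flat_chart C V h W E B z"
  using flat_chart_exists[OF C C1 V dom_open dom_cover flat assms] by blast

lemma unit_basis_at:
  assumes "x \<in> points C"
  obtains e where "unit_basis V h x e"
proof -
  obtain W E B z where "x \<in> W" "flat_chart C V h W E B z" using flat_chart_at[OF assms] .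
  then show thesis using that unfolding flat_chart_def by blast
qed

lemma frame_open: "s \<in> hol_frames C V \<Longrightarrow> openin (mtop C) (fst s)"
  unfolding hol_frames_def by auto

lemma frame_points: "s \<in> hol_frames C V \<Longrightarrow> x \<in> fst s \<Longrightarrow> x \<in> points C"
  using openin_subset[OF frame_open] topspace_mtop[OF C] by blast

lemma frame_coord_vec:
  assumes s: "s \<in> hol_frames C V" and x: "x \<in> fst s"
  shows "frame_coord s (x, fline (frame_vec s x w)) = w"
proof -
  obtain e where e: "unit_basis V h x e" using unit_basis_at[OF frame_points[OF s x]] .
  obtain p1 p2 q1 q2 where "frame_at e s x p1 p2 q1 q2" using frame_at_exists[OF e s x] by blast
  from frame_at_coord[OF e this] show ?thesis .
qed

lemma fibre_eqI:
  assumes v: "v \<in> vb_fibre V x" and w: "w \<in> vb_fibre V x" and i: "i \<in> vb_idx V" "x \<in> vb_dom V i" and eq: "v i = w i"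
  shows "v = w"
proof
  fix j
  show "v j = w j"
  proof (cases "j \<in> vb_idx V \<and> x \<in> vb_dom V j")
    case True
    have "v j = vb_trans V j i x *\<^sub>v v i" "w j = vb_trans V j i x *\<^sub>v w i"
      using v w i True unfolding vb_fibre_def by blast+
    then show ?thesis using eq by simp
  next
    case False
    then have "v j = 0\<^sub>v 0" "w j = 0\<^sub>v 0" using v w unfolding vb_fibre_def by blast+
    then show ?thesis by simp
  qed
qed

text \<open>In a trivialization containing \<open>W\<close>, the frame and the flat basis are
  holomorphic vectors; by Cramer's rule the coefficients are quotients of holomorphic functions with
  denominator \<open>m\<close>, the determinant of the flat basis.\<close>

lemma frame_coefficients_hol:
  assumes fc: "flat_chart C V h W E B z" and s: "s \<in> hol_frames C V"
  obtains p1 p2 q1 q2 where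
    "\<And>x. x \<in> W \<Longrightarrow> x \<in> fst s \<Longrightarrow> frame_at (E x) s x (p1 x) (p2 x) (q1 x) (q2 x)"
    "chol B z (W \<inter> fst s) p1" "chol B z (W \<inter> fst s) p2" "chol B z (W \<inter> fst s) q1" "chol B z (W \<inter> fst s) q2"
proof -
  obtain Ws s1 s2 where ss: "s = (Ws, s1, s2)" by (cases s)
  obtain i where i: "i \<in> vb_idx V" "W \<subseteq> vb_dom V i" using fc unfolding flat_chart_def by blast
  have cB: "(B, z) \<in> charts C" and Wo: "openin (mtop C) W" and WB: "W \<subseteq> B"
    and ub: "\<And>x. x \<in> W \<Longrightarrow> unit_basis V h x (E x)"
    and Eh: "\<And>a b k. k < 2 \<Longrightarrow> hol_fun C (W \<inter> vb_dom V i) (\<lambda>x. vec_index (E x a b i) k)"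
    using fc i(1) unfolding flat_chart_def by blast+
  have sh: "hol_fun C (Ws \<inter> vb_dom V i) (\<lambda>x. vec_index (s1 x i) k)"
    "hol_fun C (Ws \<inter> vb_dom V i) (\<lambda>x. vec_index (s2 x i) k)" if "k < 2" for k
    using s i(1) that V unfolding hol_frames_def ss by auto
  define U where "U = W \<inter> Ws"
  have Wso: "openin (mtop C) Ws" using frame_open[OF s] by (simp add: ss)
  have UB: "U \<subseteq> B" using WB by (auto simp: U_def)
  have Uo: "openin (mtop C) U" unfolding U_def by (rule openin_Int[OF Wo Wso])
  have hs: "hol_fun C U g" if "hol_fun C A g" "openin (mtop C) A" "U \<subseteq> A" for g A
    unfolding hol_fun_def
  proof clarify
    fix D \<phi> assume "(D, \<phi>) \<in> charts C"
    then have "hol_Cn (mdim C) (\<phi> ` (D \<inter> A)) (\<lambda>z. g (inv_into D \<phi> z))"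
      using that(1) unfolding hol_fun_def by blast
    moreover have "\<phi> ` (D \<inter> U) \<subseteq> \<phi> ` (D \<inter> A)" using that(3) by blast
    ultimately show "hol_Cn (mdim C) (\<phi> ` (D \<inter> U)) (\<lambda>z. g (inv_into D \<phi> z))"
      unfolding hol_Cn_def by (meson subsetD)
  qed
  have co: "chol B z U (\<lambda>x. vec_index (E x a b i) k)" if "k < 2" for a b k
    using i(2) Wo dom_open[OF i(1)]
    by (intro hol_fun_imp_chol[OF C C1 cB Uo UB] hs[OF Eh[OF that]]) (auto simp: U_def intro: openin_Int)
  have cs: "chol B z U (\<lambda>x. vec_index (s1 x i) k)" "chol B z U (\<lambda>x. vec_index (s2 x i) k)" if "k < 2" for k
    using i(2) Wso dom_open[OF i(1)]
    by (intro hol_fun_imp_chol[OF C C1 cB Uo UB] hs[OF sh(1)[OF that]] hs[OF sh(2)[OF that]]; auto simp: U_def intro: openin_Int)+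
  define e where "e = (\<lambda>x a b k. vec_index (E x a b i) k)"
  define m where "m = (\<lambda>x. e x 1 0 0 * e x 0 1 1 - e x 1 0 1 * e x 0 1 0)"
  have lin: "e x a b k = a * e x 1 0 k + b * e x 0 1 k" if x: "x \<in> W" and k: "k < 2" for x a b k
  proof -
    note u = ub[OF x]
    have "E x a b = fadd (fscale a (E x 1 0)) (fscale b (E x 0 1))"
      by (simp add: ub_scale[OF u] ub_add[OF u])
    moreover have "E x c d i \<in> carrier_vec 2" for c d
      using ub_mem[OF u, of c d] i x V unfolding vb_fibre_def by auto
    ultimately show ?thesis using k unfolding e_def fadd_def fscale_def
      by (metis (no_types, lifting) carrier_vecD index_add_vec(1) index_smult_vec(1) index_smult_vec(2))
  qed
  \<comment> \<open>A vector is determined by its coordinates in one trivialization, so the flat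
    basis stays independent there; hence \<open>m\<close> has no zeros.\<close>
  have zero: "a = 0 \<and> b = 0" if x: "x \<in> W" and 0: "e x a b 0 = 0" and 1: "e x a b 1 = 0" for x a b
  proof -
    note u = ub[OF x]
    have ca: "E x c d i \<in> carrier_vec 2" for c d
      using ub_mem[OF u, of c d] i x V unfolding vb_fibre_def by auto
    have "e x 0 0 k = 0" if "k < 2" for k using lin[OF x that, of 0 0] by simp
    then have "E x a b i = E x 0 0 i"
      using 0 1 vec2_surj[OF ca] unfolding e_def by (metis one_less_numeral_iff pos2 semiring_norm(76))
    then have "E x a b = E x 0 0"
      using fibre_eqI[OF ub_mem[OF u] ub_mem[OF u] i(1)] i(2) x by blast
    then show ?thesis by (simp add: ub_inj[OF u])
  qed
  have mnz: "m x \<noteq> 0" if x: "x \<in> W" for x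
  proof
    assume m0: "m x = 0"
    have z: "a = 0 \<and> b = 0" if "a * e x 1 0 0 + b * e x 0 1 0 = 0" "a * e x 1 0 1 + b * e x 0 1 1 = 0" for a b
      using zero[OF x, of a b] that by (simp only: lin[OF x, of 0 a b] lin[OF x, of 1 a b])
    have "e x 0 1 0 = 0 \<and> - e x 1 0 0 = 0"
      by (rule z) (use m0 in \<open>simp_all add: m_def mult.commute\<close>)
    moreover have "e x 0 1 1 = 0 \<and> - e x 1 0 1 = 0"
      by (rule z) (use m0 in \<open>simp_all add: m_def mult.commute\<close>)
    ultimately show False using z[of 1 0] by simp
  qed
  define c1 where "c1 = (\<lambda>(t :: 'c \<Rightarrow> 'i fvec) x. (vec_index (t x i) 0 * e x 0 1 1 - vec_index (t x i) 1 * e x 0 1 0) / m x)"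
  define c2 where "c2 = (\<lambda>(t :: 'c \<Rightarrow> 'i fvec) x. (e x 1 0 0 * vec_index (t x i) 1 - e x 1 0 1 * vec_index (t x i) 0) / m x)"
  have coef: "t x = E x (c1 t x) (c2 t x)" if x: "x \<in> W" and t: "t x \<in> vb_fibre V x" for t :: "'c \<Rightarrow> 'i fvec" and x
  proof -
    obtain a b where ab: "t x = E x a b" using ub_ex[OF ub[OF x] t] by blast
    have t01: "vec_index (t x i) 0 = a * e x 1 0 0 + b * e x 0 1 0" "vec_index (t x i) 1 = a * e x 1 0 1 + b * e x 0 1 1"
      using lin[OF x, of 0 a b] lin[OF x, of 1 a b] unfolding ab e_def by simp_all
    have "c1 t x = a" "c2 t x = b"
      unfolding c1_def c2_def t01 using mnz[OF x] by (simp_all add: m_def field_simps)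
    then show ?thesis using ab by simp
  qed
  have inj: "inj_on z B" using chart_inj[OF C cB] .
  have ch: "chol B z U (c1 t)" "chol B z U (c2 t)" if t: "\<And>k. k < 2 \<Longrightarrow> chol B z U (\<lambda>x. vec_index (t x i) k)" for t
    unfolding c1_def c2_def m_def e_def
    by (intro chol_divide[OF _ _ inj UB] chol_diff chol_mult t co; use mnz in \<open>auto simp: U_def m_def e_def\<close>)+
  have "frame_at (E x) s x (c1 s1 x) (c2 s1 x) (c1 s2 x) (c2 s2 x)" if x: "x \<in> W" "x \<in> fst s" for x
  proof -
    obtain a1 a2 b1 b2 where fa: "frame_at (E x) s x a1 a2 b1 b2"
      using frame_at_exists[OF ub[OF x(1)] s x(2)] by blast
    have "s1 x \<in> vb_fibre V x" "s2 x \<in> vb_fibre V x"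
      using s x(2) unfolding hol_frames_def ss by auto
    from coef[of x s1, OF x(1) this(1)] coef[of x s2, OF x(1) this(2)]
    have "E x a1 a2 = E x (c1 s1 x) (c2 s1 x)" "E x b1 b2 = E x (c1 s2 x) (c2 s2 x)"
      using fa unfolding frame_at_def ss by auto
    then show ?thesis using fa by (auto simp: ub_inj[OF ub[OF x(1)]])
  qed
  moreover have "U = W \<inter> fst s" by (simp add: U_def ss)
  ultimately show thesis
    using that[of "c1 s1" "c2 s1" "c1 s2" "c2 s2"] ch[of s1, OF cs(1)] ch[of s2, OF cs(2)] by simp
qed

text \<open>The exchanged frame contains the one line of each fibre that the first frame misses; the
  closed unit discs of the two together cover the fibre.\<close>

lemma flat_frames:
  assumes fc: "flat_chart C V h W E B z"
  shows "(W, \<lambda>x. E x 1 0, \<lambda>x. E x 0 1) \<in> hol_frames C V" "(W, \<lambda>x. E x 0 1, \<lambda>x. E x 1 0) \<in> hol_frames C V"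
proof -
  have Wo: "openin (mtop C) W" and ub: "\<And>x. x \<in> W \<Longrightarrow> unit_basis V h x (E x)"
    and Eh: "\<And>a b i k. i \<in> vb_idx V \<Longrightarrow> k < 2 \<Longrightarrow> hol_fun C (W \<inter> vb_dom V i) (\<lambda>x. vec_index (E x a b i) k)"
    using fc unfolding flat_chart_def by blast+
  show "(W, \<lambda>x. E x 1 0, \<lambda>x. E x 0 1) \<in> hol_frames C V" "(W, \<lambda>x. E x 0 1, \<lambda>x. E x 1 0) \<in> hol_frames C V"
    unfolding hol_frames_def using Wo Eh V
    by (auto simp: ub_mem[OF ub] ub_scale[OF ub] ub_add[OF ub] ub_inj[OF ub])
qed

end

section \<open>The fibre product\<close>

lemma join_pt1: "v \<in> topspace (Cn n) \<Longrightarrow> join n v (pt1 w) = v(n := w)"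
  by (auto simp: join_def pt1_def topspace_Cn fun_eq_iff PiE_def extensional_def)

locale flat_fibration = flat_bundle C "vb_dual F" h
  for C :: "'c cmfd" and F :: "('c, 'i) vbundle" and h +
  fixes X :: "'x cmfd" and f :: "'x \<Rightarrow> 'c" and LX :: "('x, 'j) lbundle"
  assumes X: "complex_manifold X" and f: "hol_map X C f" and LX: "hol_lbundle X LX"
begin

abbreviation n :: nat where "n \<equiv> mdim X"
abbreviation frames :: "('c, 'i) frame set" where "frames \<equiv> hol_frames C (vb_dual F)"
abbreviation Yt :: "('x \<times> ('c, 'i) ppoint) cmfd" where "Yt \<equiv> fibre_product C X f (proj_bundle C F) fst"
abbreviation Lt :: "('x \<times> ('c, 'i) ppoint, 'j \<times> ('c, 'i) frame) lbundle" where
  "Lt \<equiv> lb_tensor (lb_pullback Yt fst LX) (lb_pullback Yt snd (O1 C F))"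

definition fdom :: "'x set \<Rightarrow> ('c, 'i) frame \<Rightarrow> 'c set \<Rightarrow> ('x \<times> ('c, 'i) ppoint) set" where
  "fdom D s B = {(p, y). p \<in> D \<and> y \<in> frame_dom s \<and> fst y \<in> B \<and> f p = fst y}"

definition fmap :: "('x \<Rightarrow> nat \<Rightarrow> complex) \<Rightarrow> ('c, 'i) frame \<Rightarrow> 'x \<times> ('c, 'i) ppoint \<Rightarrow> nat \<Rightarrow> complex" where
  "fmap \<phi> s = (\<lambda>(p, y). join n (\<phi> p) (pt1 (frame_coord s y)))"

definition fbase :: "'x set \<Rightarrow> ('x \<Rightarrow> nat \<Rightarrow> complex) \<Rightarrow> ('c, 'i) frame \<Rightarrow> 'c set \<Rightarrow> (nat \<Rightarrow> complex) set" where
  "fbase D \<phi> s B = \<phi> ` (D \<inter> {p \<in> points X. f p \<in> B \<inter> fst s})"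

definition base_pt :: "'x set \<Rightarrow> ('x \<Rightarrow> nat \<Rightarrow> complex) \<Rightarrow> (nat \<Rightarrow> complex) \<Rightarrow> 'x" where
  "base_pt D \<phi> z = inv_into D \<phi> (restrict z {..<n})"

definition frame_pt :: "('c, 'i) frame \<Rightarrow> 'x \<Rightarrow> complex \<Rightarrow> ('c, 'i) ppoint" where
  "frame_pt s p w = (f p, fline (frame_vec s (f p) w))"

text \<open>The inverse of the chart \<open>fmap\<close>. The fibre coordinate runs through the
  whole plane, so the image of the chart is a full cylinder over \<open>fbase\<close>.\<close>

definition theta :: "'x set \<Rightarrow> ('x \<Rightarrow> nat \<Rightarrow> complex) \<Rightarrow> ('c, 'i) frame \<Rightarrow> (nat \<Rightarrow> complex) \<Rightarrow> 'x \<times> ('c, 'i) ppoint" where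
  "theta D \<phi> s z = (base_pt D \<phi> z, frame_pt s (base_pt D \<phi> z) (z n))"

lemma mdim_Yt: "mdim Yt = Suc n"
  by (simp add: fibre_product_def proj_bundle_def)

text \<open>A chart of the fibre product drops the base coordinates of the chart of the projective
  bundle, so of the latter only the frame and the domain \<open>B\<close> survive.\<close>

lemma charts_Yt:
  "charts Yt = {(fdom D s B, fmap \<phi> s) | D \<phi> s B. (D, \<phi>) \<in> charts X \<and> s \<in> frames \<and> (\<exists>z. (B, z) \<in> charts C)}"
proof
  have *: "join (mdim C) a b (mdim C + k) = b k" for a b k by (simp add: join_def)
  show "charts Yt \<subseteq> {(fdom D s B, fmap \<phi> s) | D \<phi> s B. (D, \<phi>) \<in> charts X \<and> s \<in> frames \<and> (\<exists>z. (B, z) \<in> charts C)}"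
    unfolding fibre_product_def proj_bundle_def fdom_def fmap_def
    by (auto simp: *) (metis (no_types, lifting))
  show "{(fdom D s B, fmap \<phi> s) | D \<phi> s B. (D, \<phi>) \<in> charts X \<and> s \<in> frames \<and> (\<exists>z. (B, z) \<in> charts C)} \<subseteq> charts Yt"
  proof clarify
    fix D \<phi> s B z assume c: "(D, \<phi>) \<in> charts X" "s \<in> frames" "(B, z) \<in> charts C"
    let ?E = "{y \<in> frame_dom s. fst y \<in> B}" and ?\<psi> = "\<lambda>y. join (mdim C) (z (fst y)) (pt1 (frame_coord s y))"
    have "(?E, ?\<psi>) \<in> charts (proj_bundle C F)" 
      unfolding proj_bundle_def cmfd.select_convs
      by (rule CollectI, rule exI[of _ s], rule exI[of _ B], rule exI[of _ z]) (use c in simp)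
    moreover have "\<exists>(B, z)\<in>charts C. \<forall>y\<in>?E. fst y \<in> B \<and> (\<forall>k<mdim C. ?\<psi> y k = z (fst y) k)"
      by (rule bexI[OF _ c(3)]) (simp add: join_def)
    ultimately have "({(p, y). p \<in> D \<and> y \<in> ?E \<and> f p = fst y},
        \<lambda>(p, y). join n (\<phi> p) (\<lambda>k. ?\<psi> y (mdim C + k))) \<in> charts Yt"
      unfolding fibre_product_def cmfd.select_convs
      by (intro CollectI exI[of _ D] exI[of _ \<phi>] exI[of _ ?E] exI[of _ ?\<psi>] conjI refl c(1))
    moreover have "{(p, y). p \<in> D \<and> y \<in> ?E \<and> f p = fst y} = fdom D s B" by (auto simp: fdom_def)
    ultimately show "(fdom D s B, fmap \<phi> s) \<in> charts Yt" by (simp add: fmap_def *)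
  qed
qed

lemma ppoint_mem:
  assumes s: "s \<in> frames" and p: "p \<in> points X" "f p \<in> fst s"
  shows "(p, frame_pt s p w) \<in> points Yt"
proof -
  note x = frame_points[OF s p(2)]
  obtain e where e: "unit_basis (vb_dual F) h (f p) e" using unit_basis_at[OF x] .
  obtain p1 p2 q1 q2 where fa: "frame_at e s (f p) p1 p2 q1 q2" using frame_at_exists[OF e s p(2)] by blast
  have v: "frame_vec s (f p) w = e (p1 + w * q1) (p2 + w * q2)" by (rule frame_at_vec[OF e fa])
  have "frame_vec s (f p) w \<in> vb_fibre (vb_dual F) (f p)" unfolding v by (rule ub_mem[OF e])
  moreover have "frame_vec s (f p) w \<noteq> fscale 0 (frame_vec s (f p) w)"
    unfolding v ub_scale[OF e] ub_inj[OF e] using frame_at_nz[OF e fa, of w] by auto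
  ultimately show ?thesis
    unfolding fibre_product_def proj_bundle_def frame_pt_def using p x by auto
qed

lemma frame_pt_dom: "f p \<in> fst s \<Longrightarrow> frame_pt s p w \<in> frame_dom s"
  unfolding frame_pt_def frame_dom_def by auto

lemma f_preimage_open: "openin (mtop C) W \<Longrightarrow> openin (mtop X) {p \<in> points X. f p \<in> W}"
  using openin_continuous_map_preimage[of "mtop X" "mtop C" f W] f topspace_mtop[OF X]
  unfolding hol_map_def by simp

lemma LX_dom_open: "i \<in> lb_idx LX \<Longrightarrow> openin (mtop X) (lb_dom LX i)"
  using LX unfolding hol_lbundle_def by meson

lemma LX_dom_sub: "i \<in> lb_idx LX \<Longrightarrow> lb_dom LX i \<subseteq> points X"
  using LX_dom_open openin_subset topspace_mtop[OF X] by metis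

lemma LX_trans_self: "i \<in> lb_idx LX \<Longrightarrow> p \<in> lb_dom LX i \<Longrightarrow> lb_trans LX i i p = 1"
  using LX unfolding hol_lbundle_def by meson

lemma LX_trans_inverse:
  assumes "i \<in> lb_idx LX" "j \<in> lb_idx LX" "p \<in> lb_dom LX i" "p \<in> lb_dom LX j"
  shows "lb_trans LX i j p * lb_trans LX j i p = 1"
proof -
  have "\<forall>i\<in>lb_idx LX. \<forall>j\<in>lb_idx LX. \<forall>k\<in>lb_idx LX. \<forall>x\<in>lb_dom LX i \<inter> lb_dom LX j \<inter> lb_dom LX k.
        lb_trans LX i j x * lb_trans LX j k x = lb_trans LX i k x"
    using LX unfolding hol_lbundle_def by (elim conjE)
  from this[rule_format, of i j i p] show ?thesis using assms LX_trans_self by simp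
qed

lemma lb_idx_Lt: "lb_idx Lt = lb_idx LX \<times> frames"
  by (simp add: lb_tensor_def lb_pullback_def O1_def)

lemma lb_dom_Lt: "lb_dom Lt (i, s) = {q \<in> points Yt. fst q \<in> lb_dom LX i \<and> snd q \<in> frame_dom s}"
  by (auto simp: lb_tensor_def lb_pullback_def O1_def)

lemma lb_trans_Lt: "lb_trans Lt (i, s) (j, t) q = lb_trans LX i j (fst q) * lb_trans (O1 C F) s t (snd q)"
  by (simp add: lb_tensor_def lb_pullback_def)

context
  fixes D \<phi> s B z
  assumes cX: "(D, \<phi>) \<in> charts X" and s: "s \<in> frames" and cC: "(B, z) \<in> charts C"
begin

lemma fbase_open: "openin (Cn n) (fbase D \<phi> s B)"
  unfolding fbase_def
  by (intro openin_chart_image[OF X cX] f_preimage_open openin_Int openin_chart[OF C cC] frame_open s)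

lemma base_pt_fbase:
  assumes "v \<in> cyl n (fbase D \<phi> s B)"
  shows "base_pt D \<phi> v \<in> D" "base_pt D \<phi> v \<in> points X" "f (base_pt D \<phi> v) \<in> B" "f (base_pt D \<phi> v) \<in> fst s"
    "\<phi> (base_pt D \<phi> v) = restrict v {..<n}"
proof -
  obtain p where p: "p \<in> D" "p \<in> points X" "f p \<in> B" "f p \<in> fst s" "restrict v {..<n} = \<phi> p"
    using assms unfolding cyl_def fbase_def by auto
  then have "base_pt D \<phi> v = p" unfolding base_pt_def using chart_inv[OF X cX] by simp
  then show "base_pt D \<phi> v \<in> D" "base_pt D \<phi> v \<in> points X" "f (base_pt D \<phi> v) \<in> B" "f (base_pt D \<phi> v) \<in> fst s"
    "\<phi> (base_pt D \<phi> v) = restrict v {..<n}" using p by simp_all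
qed

lemma theta_fdom:
  assumes v: "v \<in> cyl n (fbase D \<phi> s B)"
  shows "theta D \<phi> s v \<in> fdom D s B" "fmap \<phi> s (theta D \<phi> s v) = v" "theta D \<phi> s v \<in> points Yt"
proof -
  note b = base_pt_fbase[OF v]
  show "theta D \<phi> s v \<in> fdom D s B"
    unfolding theta_def fdom_def using b frame_pt_dom by (simp add: frame_pt_def)
  have vt: "v \<in> topspace (Cn (Suc n))" using v by (simp add: cyl_def)
  have "fmap \<phi> s (theta D \<phi> s v) = join n (restrict v {..<n}) (pt1 (v n))"
    unfolding fmap_def theta_def frame_pt_def using frame_coord_vec[OF s b(4)] b(5) by simp
  also have "\<dots> = (restrict v {..<n})(n := v n)"
    by (rule join_pt1) (auto simp: topspace_Cn)
  also have "\<dots> = v" using vt by (auto simp: topspace_Cn fun_eq_iff PiE_def extensional_def)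
  finally show "fmap \<phi> s (theta D \<phi> s v) = v" .
  show "theta D \<phi> s v \<in> points Yt" unfolding theta_def by (rule ppoint_mem[OF s b(2,4)])
qed

lemma fdom_theta:
  assumes q: "q \<in> fdom D s B"
  shows "fmap \<phi> s q \<in> cyl n (fbase D \<phi> s B)" "theta D \<phi> s (fmap \<phi> s q) = q"
proof -
  obtain p y where qq: "q = (p, y)" and p: "p \<in> D" "y \<in> frame_dom s" "fst y \<in> B" "f p = fst y"
    using q unfolding fdom_def by auto
  obtain w where w: "y = (f p, fline (frame_vec s (f p) w))" "f p \<in> fst s"
    using p(2,4) unfolding frame_dom_def by auto
  note pt = chart_image_topspace[OF X cX p(1)]
  have fm: "fmap \<phi> s q = (\<phi> p)(n := w)"
    unfolding fmap_def qq w(1) using frame_coord_vec[OF s w(2)] join_pt1[OF pt] by simp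
  have fpB: "f p \<in> B" using p(3,4) by simp
  have "p \<in> points X" using chart_subset[OF X cX] p(1) by blast
  then have "\<phi> p \<in> fbase D \<phi> s B"
    unfolding fbase_def by (intro imageI) (simp add: p(1) fpB w(2))
  then show "fmap \<phi> s q \<in> cyl n (fbase D \<phi> s B)"
    unfolding fm by (rule upd_in_cyl[OF fbase_open])
  have "base_pt D \<phi> ((\<phi> p)(n := w)) = p"
    unfolding base_pt_def restrict_upd_Cn[OF pt] by (rule chart_inv[OF X cX p(1)])
  then have "theta D \<phi> s ((\<phi> p)(n := w)) = q"
    unfolding theta_def frame_pt_def qq w(1) by simp
  then show "theta D \<phi> s (fmap \<phi> s q) = q" by (simp only: fm)
qed

lemma fmap_inj: "inj_on (fmap \<phi> s) (fdom D s B)"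
  by (rule inj_on_inverseI[of _ "theta D \<phi> s"]) (rule fdom_theta(2))

lemma fmap_image: "fmap \<phi> s ` (fdom D s B \<inter> Q) = {v \<in> cyl n (fbase D \<phi> s B). theta D \<phi> s v \<in> Q}"
proof
  show "fmap \<phi> s ` (fdom D s B \<inter> Q) \<subseteq> {v \<in> cyl n (fbase D \<phi> s B). theta D \<phi> s v \<in> Q}"
    using fdom_theta by auto
  show "{v \<in> cyl n (fbase D \<phi> s B). theta D \<phi> s v \<in> Q} \<subseteq> fmap \<phi> s ` (fdom D s B \<inter> Q)"
  proof
    fix v assume v: "v \<in> {v \<in> cyl n (fbase D \<phi> s B). theta D \<phi> s v \<in> Q}"
    then have "v \<in> cyl n (fbase D \<phi> s B)" by simp
    note th = theta_fdom[OF this]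
    show "v \<in> fmap \<phi> s ` (fdom D s B \<inter> Q)"
      by (rule image_eqI[where x = "theta D \<phi> s v"]) (use th v in simp_all)
  qed
qed

lemma fmap_inv: "v \<in> cyl n (fbase D \<phi> s B) \<Longrightarrow> inv_into (fdom D s B) (fmap \<phi> s) v = theta D \<phi> s v"
  using theta_fdom fmap_inj by (metis inv_into_f_eq)

text \<open>The image in n+1-space of the part of a chart domain that lies in the trivialization (i,
  s'). The frame \<open>s\<close> of the chart and the frame \<open>s'\<close> of the trivialization
  are chosen independently.\<close>

definition tdom where
  "tdom i s' = {v \<in> cyl n (fbase D \<phi> s B). base_pt D \<phi> v \<in> lb_dom LX i \<and> snd (theta D \<phi> s v) \<in> frame_dom s'}"

lemma fmap_image_dom: "fmap \<phi> s ` (fdom D s B \<inter> lb_dom Lt (i, s')) = tdom i s'"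
  unfolding fmap_image lb_dom_Lt tdom_def using theta_fdom(3) by (auto simp: theta_def)

text \<open>Both frames are expanded in a flat basis near the given point. The generator for
  \<open>s\<close> has coordinates (a, b), affine in the fibre coordinate; \<open>d\<close> is
  Cramer's denominator for \<open>s'\<close>, zero exactly on the lines that \<open>s'\<close>
  misses; (g1, g2) is the generator for \<open>s'\<close>, a multiple of (a, b).\<close>

lemma local_weight:
  assumes s': "s' \<in> frames" and v0: "v0 \<in> cyl n (fbase D \<phi> s B)" and x0: "f (base_pt D \<phi> v0) \<in> fst s'"
  obtains A d g1 g2 where "openin (Cn n) A" "A \<subseteq> fbase D \<phi> s B" "v0 \<in> cyl n A"
    "lhol (Suc n) (cyl n A) d"
    "lhol (Suc n) {v \<in> cyl n A. d v \<noteq> 0} g1" "lhol (Suc n) {v \<in> cyl n A. d v \<noteq> 0} g2"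
    "\<And>v. v \<in> cyl n A \<Longrightarrow> snd (theta D \<phi> s v) \<in> frame_dom s' \<longleftrightarrow> d v \<noteq> 0"
    "\<And>v. v \<in> cyl n A \<Longrightarrow> d v \<noteq> 0 \<Longrightarrow>
       O1_metric h s' (snd (theta D \<phi> s v)) = ereal (ln ((cmod (g1 v))\<^sup>2 + (cmod (g2 v))\<^sup>2)) \<and> (g1 v \<noteq> 0 \<or> g2 v \<noteq> 0)"
proof -
  note b0 = base_pt_fbase[OF v0]
  obtain W E B' z' where W: "f (base_pt D \<phi> v0) \<in> W" and fc: "flat_chart C (vb_dual F) h W E B' z'"
    using flat_chart_at[OF frame_points[OF s b0(4)]] .
  have Wo: "openin (mtop C) W" and cB': "(B', z') \<in> charts C" and WB: "W \<subseteq> B'"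
    and ub: "\<And>x. x \<in> W \<Longrightarrow> unit_basis (vb_dual F) h x (E x)"
    using fc unfolding flat_chart_def by blast+
  obtain p1 p2 q1 q2 where p: "\<And>x. x \<in> W \<Longrightarrow> x \<in> fst s \<Longrightarrow> frame_at (E x) s x (p1 x) (p2 x) (q1 x) (q2 x)"
    and ph: "chol B' z' (W \<inter> fst s) p1" "chol B' z' (W \<inter> fst s) p2" "chol B' z' (W \<inter> fst s) q1" "chol B' z' (W \<inter> fst s) q2"
    using frame_coefficients_hol[OF fc s] by metis
  obtain r1 r2 t1 t2 where r: "\<And>x. x \<in> W \<Longrightarrow> x \<in> fst s' \<Longrightarrow> frame_at (E x) s' x (r1 x) (r2 x) (t1 x) (t2 x)"
    and rh: "chol B' z' (W \<inter> fst s') r1" "chol B' z' (W \<inter> fst s') r2" "chol B' z' (W \<inter> fst s') t1" "chol B' z' (W \<inter> fst s') t2"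
    using frame_coefficients_hol[OF fc s'] by metis
  define U where "U = B \<inter> fst s \<inter> fst s' \<inter> W"
  define A where "A = \<phi> ` (D \<inter> {p \<in> points X. f p \<in> U})"
  have Uo: "openin (mtop C) U"
    unfolding U_def by (intro openin_Int openin_chart[OF C cC] frame_open s s' Wo)
  have Ao: "openin (Cn n) A" unfolding A_def by (rule openin_chart_image[OF X cX f_preimage_open[OF Uo]])
  have AA: "A \<subseteq> fbase D \<phi> s B" unfolding A_def fbase_def U_def by blast
  have v0A: "v0 \<in> cyl n A"
  proof -
    have "base_pt D \<phi> v0 \<in> D \<inter> {p \<in> points X. f p \<in> U}" using b0 x0 W by (simp add: U_def)
    then have "\<phi> (base_pt D \<phi> v0) \<in> A" unfolding A_def by (rule imageI)
    then show ?thesis using v0 b0(5) by (simp add: cyl_def)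
  qed
  define x where "x = (\<lambda>v. f (base_pt D \<phi> v))"
  have xU: "x v \<in> U" if vA: "v \<in> cyl n A" for v
  proof -
    obtain p where "p \<in> D" "f p \<in> U" "restrict v {..<n} = \<phi> p" using vA unfolding cyl_def A_def by auto
    then show ?thesis unfolding x_def base_pt_def using chart_inv[OF X cX] by simp
  qed
  have pull: "lhol (Suc n) (cyl n A) (\<lambda>v. a (x v))" if "chol B' z' U' a" "U \<subseteq> U'" for a U'
  proof -
    have "U \<subseteq> B'" using WB by (auto simp: U_def)
    from lhol_restrict[OF chol_pullback[OF X C C1 f cX cB' this chol_subset[OF that]]]
    show ?thesis unfolding x_def base_pt_def A_def .
  qed
  have pu: "lhol (Suc n) (cyl n A) (\<lambda>v. p1 (x v))" "lhol (Suc n) (cyl n A) (\<lambda>v. p2 (x v))"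
    "lhol (Suc n) (cyl n A) (\<lambda>v. q1 (x v))" "lhol (Suc n) (cyl n A) (\<lambda>v. q2 (x v))"
    "lhol (Suc n) (cyl n A) (\<lambda>v. r1 (x v))" "lhol (Suc n) (cyl n A) (\<lambda>v. r2 (x v))"
    "lhol (Suc n) (cyl n A) (\<lambda>v. t1 (x v))" "lhol (Suc n) (cyl n A) (\<lambda>v. t2 (x v))"
    by (rule pull[OF ph(1)] pull[OF ph(2)] pull[OF ph(3)] pull[OF ph(4)]
        pull[OF rh(1)] pull[OF rh(2)] pull[OF rh(3)] pull[OF rh(4)], force simp: U_def)+
  define a where "a = (\<lambda>v. p1 (x v) + v n * q1 (x v))"
  define b where "b = (\<lambda>v. p2 (x v) + v n * q2 (x v))"
  define d where "d = (\<lambda>v. a v * t2 (x v) - b v * t1 (x v))"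
  define \<delta> where "\<delta> = (\<lambda>v. (r1 (x v) * t2 (x v) - r2 (x v) * t1 (x v)) / d v)"
  have ab: "lhol (Suc n) (cyl n A) a" "lhol (Suc n) (cyl n A) b"
    unfolding a_def b_def by (intro lhol_add lhol_mult lhol_last pu)+
  have d: "lhol (Suc n) (cyl n A) d" unfolding d_def by (intro lhol_diff lhol_mult ab pu)
  let ?A = "{v \<in> cyl n A. d v \<noteq> 0}"
  have sub: "?A \<subseteq> cyl n A" by blast
  have del: "lhol (Suc n) ?A \<delta>"
    unfolding \<delta>_def
    by (intro lhol_divide lhol_diff lhol_mult lhol_subset[OF pu(5) sub] lhol_subset[OF pu(6) sub]
        lhol_subset[OF pu(7) sub] lhol_subset[OF pu(8) sub] lhol_subset[OF d sub]) blast
  have g: "lhol (Suc n) ?A (\<lambda>v. a v * \<delta> v)" "lhol (Suc n) ?A (\<lambda>v. b v * \<delta> v)"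
    by (intro lhol_mult del lhol_subset[OF ab(1) sub] lhol_subset[OF ab(2) sub])+
  have pt: "snd (theta D \<phi> s v) = (x v, fline (E (x v) (a v) (b v)))" "a v \<noteq> 0 \<or> b v \<noteq> 0"
    if v: "v \<in> cyl n A" for v
  proof -
    have xs: "x v \<in> W" "x v \<in> fst s" using xU[OF v] by (auto simp: U_def)
    note fa = p[OF xs]
    have "frame_vec s (x v) (v n) = E (x v) (a v) (b v)"
      unfolding a_def b_def by (rule frame_at_vec[OF ub[OF xs(1)] fa])
    then show "snd (theta D \<phi> s v) = (x v, fline (E (x v) (a v) (b v)))"
      unfolding theta_def frame_pt_def x_def by simp
    show "a v \<noteq> 0 \<or> b v \<noteq> 0" unfolding a_def b_def by (rule frame_at_nz[OF ub[OF xs(1)] fa])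
  qed
  show thesis
  proof (rule that[OF Ao AA v0A d g])
    fix v assume v: "v \<in> cyl n A"
    have xs: "x v \<in> W" "x v \<in> fst s'" using xU[OF v] by (auto simp: U_def)
    note fa = r[OF xs] and u = ub[OF xs(1)] and nz = pt(2)[OF v]
    show "snd (theta D \<phi> s v) \<in> frame_dom s' \<longleftrightarrow> d v \<noteq> 0"
      unfolding pt(1)[OF v] d_def by (rule frame_at_dom(1)[OF u fa nz])
    assume "d v \<noteq> 0"
    from frame_at_gen(2,3)[OF u fa nz this[unfolded d_def]]
    show "O1_metric h s' (snd (theta D \<phi> s v)) = ereal (ln ((cmod (a v * \<delta> v))\<^sup>2 + (cmod (b v * \<delta> v))\<^sup>2)) \<and>
        (a v * \<delta> v \<noteq> 0 \<or> b v * \<delta> v \<noteq> 0)"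
      unfolding pt(1)[OF v] \<delta>_def d_def by blast
  qed
qed

end

end

section \<open>Metrics on the fibre product in coordinates, and the product metric\<close>

lemma lhol_nonzero_open:
  assumes g: "lhol n W g" and W: "openin (Cn n) W"
  shows "openin (Cn n) {z \<in> W. g z \<noteq> 0}"
proof -
  have "openin (subtopology (Cn n) W) {z \<in> topspace (subtopology (Cn n) W). g z \<in> - {0}}"
    by (rule openin_continuous_map_preimage[of _ euclidean]) (use g in \<open>auto simp: lhol_def\<close>)
  moreover have "{z \<in> topspace (subtopology (Cn n) W). g z \<in> - {0}} = {z \<in> W. g z \<noteq> 0}"
    using openin_subset[OF W] by auto
  ultimately show ?thesis using openin_trans_full W by metis
qed

text \<open>Semi-positive weights are upper semicontinuous, so
  \<open>loc_integrable_iff_absint\<close> applies to each of them.\<close>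

lemma singular_metric_iff:
  assumes "semipositive M L \<psi>"
    and op: "\<And>i D \<phi>. i \<in> lb_idx L \<Longrightarrow> (D, \<phi>) \<in> charts M \<Longrightarrow> openin (Cn (mdim M)) (\<phi> ` (D \<inter> lb_dom L i))"
  shows "singular_metric M L \<psi> \<longleftrightarrow>
     (\<forall>i\<in>lb_idx L. \<forall>j\<in>lb_idx L. \<forall>x\<in>lb_dom L i \<inter> lb_dom L j.
        \<psi> i x = \<psi> j x + ereal (ln ((cmod (lb_trans L i j x))\<^sup>2))) \<and>
     (\<forall>i\<in>lb_idx L. \<forall>(D, \<phi>)\<in>charts M. \<forall>K. compactin (Cn (mdim M)) K \<and> K \<subseteq> \<phi> ` (D \<inter> lb_dom L i) \<longrightarrow>
        absint (mdim M) K (\<lambda>z. \<psi> i (inv_into D \<phi> z)) < \<infinity>)"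
proof -
  have *: "loc_integrable (mdim M) (\<phi> ` (D \<inter> lb_dom L i)) (\<lambda>z. \<psi> i (inv_into D \<phi> z)) \<longleftrightarrow>
      (\<forall>K. compactin (Cn (mdim M)) K \<and> K \<subseteq> \<phi> ` (D \<inter> lb_dom L i) \<longrightarrow>
        absint (mdim M) K (\<lambda>z. \<psi> i (inv_into D \<phi> z)) < \<infinity>)"
    if i: "i \<in> lb_idx L" and c: "(D, \<phi>) \<in> charts M" for i D \<phi>
  proof (rule loc_integrable_iff_absint[OF op[OF i c]])
    have "psh (mdim M) (\<phi> ` (D \<inter> lb_dom L i)) (\<lambda>z. \<psi> i (inv_into D \<phi> z))"
      using assms(1) i c unfolding semipositive_def by blast
    then show "usc (Cn (mdim M)) (\<phi> ` (D \<inter> lb_dom L i)) (\<lambda>z. \<psi> i (inv_into D \<phi> z))"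
      unfolding psh_iff by blast
  qed
  show ?thesis
    unfolding singular_metric_def
    by (intro conj_cong refl ball_cong) (auto simp only: *)
qed

context flat_fibration
begin

lemma O1_cocycle:
  assumes "s \<in> frames" "t \<in> frames" "y \<in> frame_dom s" "y \<in> frame_dom t"
  shows "lb_trans (O1 C F) s t y \<noteq> 0"
    and "O1_metric h s y = O1_metric h t y + ereal (ln ((cmod (lb_trans (O1 C F) s t y))\<^sup>2))"
proof -
  have "fst y \<in> fst s" using assms(3) unfolding frame_dom_def by auto
  then obtain e where e: "unit_basis (vb_dual F) h (fst y) e"
    using unit_basis_at frame_points[OF assms(1)] by metis
  show "lb_trans (O1 C F) s t y \<noteq> 0"
    and "O1_metric h s y = O1_metric h t y + ereal (ln ((cmod (lb_trans (O1 C F) s t y))\<^sup>2))"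
    using O1_metric_trans[OF e assms refl] by auto
qed

lemma ln_trans_Lt:
  assumes "(i, s) \<in> lb_idx Lt" "(j, t) \<in> lb_idx Lt" "q \<in> lb_dom Lt (i, s)" "q \<in> lb_dom Lt (j, t)"
  shows "ln ((cmod (lb_trans Lt (i, s) (j, t) q))\<^sup>2) =
    ln ((cmod (lb_trans LX i j (fst q)))\<^sup>2) + ln ((cmod (lb_trans (O1 C F) s t (snd q)))\<^sup>2)"
proof -
  have ij: "i \<in> lb_idx LX" "j \<in> lb_idx LX" "s \<in> frames" "t \<in> frames" using assms(1,2) unfolding lb_idx_Lt by auto
  have q: "fst q \<in> lb_dom LX i" "fst q \<in> lb_dom LX j" "snd q \<in> frame_dom s" "snd q \<in> frame_dom t"
    using assms(3,4) unfolding lb_dom_Lt by auto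
  have "lb_trans LX i j (fst q) \<noteq> 0" using LX_trans_inverse[OF ij(1,2) q(1,2)] by auto
  moreover have "lb_trans (O1 C F) s t (snd q) \<noteq> 0" by (rule O1_cocycle(1)[OF ij(3,4) q(3,4)])
  ultimately show ?thesis
    unfolding lb_trans_Lt norm_mult power_mult_distrib by (intro ln_mult_pos) auto
qed

context
  fixes D \<phi> s B z
  assumes cX: "(D, \<phi>) \<in> charts X" and s: "s \<in> frames" and cC: "(B, z) \<in> charts C"
begin

text \<open>\<open>tdom\<close> need not be a cylinder. The neighbourhood is a cylinder without the
  zeros of \<open>d\<close>, cut with the cylinder over the trivialization \<open>i\<close>; on it
  the formula for the weight and \<open>psh_restrict_add\<close> are both available.\<close>

lemma tdom_local:
  assumes i: "i \<in> lb_idx LX" and s': "s' \<in> frames" and v0: "v0 \<in> tdom D \<phi> s B i s'"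
  obtains B0 g1 g2 where "openin (Cn (Suc n)) B0" "v0 \<in> B0" "B0 \<subseteq> tdom D \<phi> s B i s'"
    "B0 \<subseteq> cyl n (\<phi> ` (D \<inter> lb_dom LX i))"
    "lhol (Suc n) B0 g1" "lhol (Suc n) B0 g2" "\<And>v. v \<in> B0 \<Longrightarrow> g1 v \<noteq> 0 \<or> g2 v \<noteq> 0"
    "\<And>v. v \<in> B0 \<Longrightarrow> O1_metric h s' (snd (theta D \<phi> s v)) = ereal (ln ((cmod (g1 v))\<^sup>2 + (cmod (g2 v))\<^sup>2))"
proof -
  note tdom = tdom_def[OF cX s cC]
  have v0': "v0 \<in> cyl n (fbase D \<phi> s B)" "base_pt D \<phi> v0 \<in> lb_dom LX i" "snd (theta D \<phi> s v0) \<in> frame_dom s'"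
    using v0 unfolding tdom by auto
  have "f (base_pt D \<phi> v0) \<in> fst s'"
    using v0'(3) unfolding theta_def frame_pt_def frame_dom_def by auto
  from local_weight[OF cX s cC s' v0'(1) this] obtain A d g1 g2 where
    A: "openin (Cn n) A" "A \<subseteq> fbase D \<phi> s B" "v0 \<in> cyl n A" and d: "lhol (Suc n) (cyl n A) d"
    and g: "lhol (Suc n) {v \<in> cyl n A. d v \<noteq> 0} g1" "lhol (Suc n) {v \<in> cyl n A. d v \<noteq> 0} g2"
    and dd: "\<And>v. v \<in> cyl n A \<Longrightarrow> snd (theta D \<phi> s v) \<in> frame_dom s' \<longleftrightarrow> d v \<noteq> 0"
    and w: "\<And>v. v \<in> cyl n A \<Longrightarrow> d v \<noteq> 0 \<Longrightarrow>
       O1_metric h s' (snd (theta D \<phi> s v)) = ereal (ln ((cmod (g1 v))\<^sup>2 + (cmod (g2 v))\<^sup>2)) \<and> (g1 v \<noteq> 0 \<or> g2 v \<noteq> 0)"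
    by blast
  define Ai where "Ai = \<phi> ` (D \<inter> lb_dom LX i)"
  have Ai: "openin (Cn n) Ai" unfolding Ai_def by (rule openin_chart_image[OF X cX LX_dom_open[OF i]])
  define B0 where "B0 = {v \<in> cyl n A. d v \<noteq> 0} \<inter> cyl n Ai"
  have bAi: "base_pt D \<phi> v \<in> lb_dom LX i" if v: "v \<in> cyl n Ai" for v
  proof -
    obtain p where "p \<in> D" "p \<in> lb_dom LX i" "restrict v {..<n} = \<phi> p" using v unfolding cyl_def Ai_def by auto
    then show ?thesis unfolding base_pt_def using chart_inv[OF X cX] by simp
  qed
  show thesis
  proof (rule that[of B0 g1 g2])
    show "openin (Cn (Suc n)) B0"
      unfolding B0_def by (intro openin_Int lhol_nonzero_open[OF d] openin_cyl A(1) Ai)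
    have "\<phi> (base_pt D \<phi> v0) \<in> Ai"
      unfolding Ai_def using base_pt_fbase(1)[OF cX s cC v0'(1)] v0'(2) by blast
    then have "v0 \<in> cyl n Ai"
      using v0'(1) base_pt_fbase(5)[OF cX s cC v0'(1)] unfolding cyl_def by simp
    then show "v0 \<in> B0" unfolding B0_def using A(3) dd[OF A(3)] v0'(3) by blast
    show "B0 \<subseteq> tdom D \<phi> s B i s'"
      unfolding B0_def tdom using A(2) dd bAi unfolding cyl_def by auto
    show "B0 \<subseteq> cyl n (\<phi> ` (D \<inter> lb_dom LX i))" unfolding B0_def Ai_def by blast
    have "B0 \<subseteq> {v \<in> cyl n A. d v \<noteq> 0}" unfolding B0_def by blast
    then show "lhol (Suc n) B0 g1" "lhol (Suc n) B0 g2" using g lhol_subset by blast+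
    show "g1 v \<noteq> 0 \<or> g2 v \<noteq> 0" if "v \<in> B0" for v using w that unfolding B0_def by blast
    show "O1_metric h s' (snd (theta D \<phi> s v)) = ereal (ln ((cmod (g1 v))\<^sup>2 + (cmod (g2 v))\<^sup>2))" if "v \<in> B0" for v
      using w that unfolding B0_def by blast
  qed
qed

lemma tdom_open:
  assumes "i \<in> lb_idx LX" "s' \<in> frames"
  shows "openin (Cn (Suc n)) (tdom D \<phi> s B i s')"
proof (subst openin_subopen, intro ballI)
  fix v assume "v \<in> tdom D \<phi> s B i s'"
  from tdom_local[OF assms this] show "\<exists>T. openin (Cn (Suc n)) T \<and> v \<in> T \<and> T \<subseteq> tdom D \<phi> s B i s'" by metis
qed

text \<open>Near each point the weight is a function of the base variables plus the logarithm of the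
  squared norm of a holomorphic pair; both conclusions are local.\<close>

lemma product_weight:
  assumes i: "i \<in> lb_idx LX" and s': "s' \<in> frames"
    and u: "psh n (\<phi> ` (D \<inter> lb_dom LX i)) (\<lambda>v. k i (inv_into D \<phi> v))"
    and ai: "\<And>K. compactin (Cn n) K \<Longrightarrow> K \<subseteq> \<phi> ` (D \<inter> lb_dom LX i) \<Longrightarrow> absint n K (\<lambda>v. k i (inv_into D \<phi> v)) < \<infinity>"
  defines "w \<equiv> \<lambda>v. k i (base_pt D \<phi> v) + O1_metric h s' (snd (theta D \<phi> s v))"
  shows "psh (Suc n) (tdom D \<phi> s B i s') w"
    and "compactin (Cn (Suc n)) K \<Longrightarrow> K \<subseteq> tdom D \<phi> s B i s' \<Longrightarrow> absint (Suc n) K w < \<infinity>"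
proof -
  define Ai where "Ai = \<phi> ` (D \<inter> lb_dom LX i)"
  have Ai: "openin (Cn n) Ai" unfolding Ai_def by (rule openin_chart_image[OF X cX LX_dom_open[OF i]])
  have loc: "\<exists>B0 w'. openin (Cn (Suc n)) B0 \<and> v0 \<in> B0 \<and> B0 \<subseteq> tdom D \<phi> s B i s' \<and> (\<forall>v\<in>B0. w v = w' v) \<and>
      psh (Suc n) B0 w' \<and> (\<forall>K. compactin (Cn (Suc n)) K \<and> K \<subseteq> B0 \<longrightarrow> absint (Suc n) K w' < \<infinity>)"
    if v0: "v0 \<in> tdom D \<phi> s B i s'" for v0
  proof -
    from tdom_local[OF i s' v0] obtain B0 g1 g2 where
      B0: "openin (Cn (Suc n)) B0" "v0 \<in> B0" "B0 \<subseteq> tdom D \<phi> s B i s'" "B0 \<subseteq> cyl n Ai"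
      and g: "lhol (Suc n) B0 g1" "lhol (Suc n) B0 g2" "\<And>v. v \<in> B0 \<Longrightarrow> g1 v \<noteq> 0 \<or> g2 v \<noteq> 0"
      and O: "\<And>v. v \<in> B0 \<Longrightarrow> O1_metric h s' (snd (theta D \<phi> s v)) = ereal (ln ((cmod (g1 v))\<^sup>2 + (cmod (g2 v))\<^sup>2))"
      unfolding Ai_def by blast
    define w' where "w' = (\<lambda>v. k i (inv_into D \<phi> (restrict v {..<n})) + ereal (ln ((cmod (g1 v))\<^sup>2 + (cmod (g2 v))\<^sup>2)))"
    note ln = lhol_log_norm[OF g(1,2) B0(1) g(3)]
    have "psh (Suc n) B0 w'"
      unfolding w'_def by (rule psh_restrict_add[OF Ai u[folded Ai_def] B0(1,4) ln])
    moreover have "absint (Suc n) K w' < \<infinity>" if K: "compactin (Cn (Suc n)) K" "K \<subseteq> B0" for K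
      unfolding w'_def
    proof (rule absint_restrict_add[OF Ai _ B0(1,4) ln(1) _ K])
      show "usc (Cn n) Ai (\<lambda>v. k i (inv_into D \<phi> v))" using u unfolding psh_iff Ai_def by blast
      show "absint n L (\<lambda>v. k i (inv_into D \<phi> v)) < \<infinity>" if "compactin (Cn n) L" "L \<subseteq> Ai" for L
        using ai[of L] that unfolding Ai_def by blast
    qed
    moreover have "w v = w' v" if "v \<in> B0" for v
      unfolding w_def w'_def O[OF that] base_pt_def ..
    ultimately show ?thesis using B0(1-3) by blast
  qed
  show p: "psh (Suc n) (tdom D \<phi> s B i s') w"
  proof (rule psh_local)
    fix v0 assume "v0 \<in> tdom D \<phi> s B i s'"
    from loc[OF this] show "\<exists>A v. openin (Cn (Suc n)) A \<and> v0 \<in> A \<and> A \<subseteq> tdom D \<phi> s B i s' \<and>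
        (\<forall>z\<in>A. w z = v z) \<and> psh (Suc n) A v" by meson
  qed
  assume K: "compactin (Cn (Suc n)) K" "K \<subseteq> tdom D \<phi> s B i s'"
  show "absint (Suc n) K w < \<infinity>"
  proof (rule absint_local[OF tdom_open[OF i s'] _ _ K])
    show "usc (Cn (Suc n)) (tdom D \<phi> s B i s') w" using p unfolding psh_iff by blast
    fix v0 assume "v0 \<in> tdom D \<phi> s B i s'"
    from loc[OF this] obtain B0 w' where B0: "openin (Cn (Suc n)) B0" "v0 \<in> B0" "B0 \<subseteq> tdom D \<phi> s B i s'"
      "\<And>v. v \<in> B0 \<Longrightarrow> w v = w' v" "\<And>K. compactin (Cn (Suc n)) K \<Longrightarrow> K \<subseteq> B0 \<Longrightarrow> absint (Suc n) K w' < \<infinity>"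
      by meson
    have "absint (Suc n) L w < \<infinity>" if "compactin (Cn (Suc n)) L" "L \<subseteq> B0" for L
      using B0(5)[OF that] absint_cong[of L w w' "Suc n"] B0(4) that(2) by (metis subsetD)
    then show "\<exists>A. openin (Cn (Suc n)) A \<and> v0 \<in> A \<and> A \<subseteq> tdom D \<phi> s B i s' \<and>
        (\<forall>K. compactin (Cn (Suc n)) K \<and> K \<subseteq> A \<longrightarrow> absint (Suc n) K w < \<infinity>)"
      using B0(1-3) by blast
  qed
qed

lemma fmap_inv_tdom: "v \<in> tdom D \<phi> s B i s' \<Longrightarrow> inv_into (fdom D s B) (fmap \<phi> s) v = theta D \<phi> s v"
  unfolding tdom_def[OF cX s cC] by (rule fmap_inv[OF cX s cC]) blast

end

lemma Yt_dom_open: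
  assumes "I \<in> lb_idx Lt" "(D, \<phi>) \<in> charts Yt"
  shows "openin (Cn (mdim Yt)) (\<phi> ` (D \<inter> lb_dom Lt I))"
proof -
  obtain i s' where I: "I = (i, s')" "i \<in> lb_idx LX" "s' \<in> frames" using assms(1) unfolding lb_idx_Lt by auto
  obtain D0 \<phi>0 s B z where c: "D = fdom D0 s B" "\<phi> = fmap \<phi>0 s" "(D0, \<phi>0) \<in> charts X" "s \<in> frames" "(B, z) \<in> charts C"
    using assms(2) unfolding charts_Yt by blast
  show ?thesis
    unfolding c(1,2) I(1) fmap_image_dom[OF c(3-5)] mdim_Yt by (rule tdom_open[OF c(3-5) I(2,3)])
qed

lemma X_dom_open:
  assumes "i \<in> lb_idx LX" "(D, \<phi>) \<in> charts X"
  shows "openin (Cn n) (\<phi> ` (D \<inter> lb_dom LX i))"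
  by (rule openin_chart_image[OF X assms(2) LX_dom_open[OF assms(1)]])

text \<open>Trades the abstract inverse of a chart for \<open>theta\<close>, in which base point and
  fibre coordinate are visible.\<close>

lemma semipositive_Lt_iff:
  "semipositive Yt Lt \<psi> \<longleftrightarrow> (\<forall>i\<in>lb_idx LX. \<forall>s'\<in>frames. \<forall>(D, \<phi>)\<in>charts X. \<forall>s\<in>frames. \<forall>(B, z)\<in>charts C.
     psh (Suc n) (tdom D \<phi> s B i s') (\<lambda>v. \<psi> (i, s') (theta D \<phi> s v)))" (is "_ \<longleftrightarrow> ?R")
proof -
  have *: "psh (mdim Yt) (fmap \<phi> s ` (fdom D s B \<inter> lb_dom Lt (i, s'))) (\<lambda>v. \<psi> (i, s') (inv_into (fdom D s B) (fmap \<phi> s) v))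
     \<longleftrightarrow> psh (Suc n) (tdom D \<phi> s B i s') (\<lambda>v. \<psi> (i, s') (theta D \<phi> s v))"
    if c: "(D, \<phi>) \<in> charts X" "s \<in> frames" "(B, z) \<in> charts C" and i: "i \<in> lb_idx LX" "s' \<in> frames" for D \<phi> s B z i s'
  proof -
    have eq: "\<psi> (i, s') (inv_into (fdom D s B) (fmap \<phi> s) v) = \<psi> (i, s') (theta D \<phi> s v)"
      if "v \<in> tdom D \<phi> s B i s'" for v
      using fmap_inv_tdom[OF c that] by simp
    show ?thesis
      unfolding fmap_image_dom[OF c] mdim_Yt
    proof
      assume P: "psh (Suc n) (tdom D \<phi> s B i s') (\<lambda>v. \<psi> (i, s') (inv_into (fdom D s B) (fmap \<phi> s) v))"
      show "psh (Suc n) (tdom D \<phi> s B i s') (\<lambda>v. \<psi> (i, s') (theta D \<phi> s v))"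
        by (rule psh_cong[OF tdom_open[OF c i] _ P]) (simp add: eq)
    next
      assume P: "psh (Suc n) (tdom D \<phi> s B i s') (\<lambda>v. \<psi> (i, s') (theta D \<phi> s v))"
      show "psh (Suc n) (tdom D \<phi> s B i s') (\<lambda>v. \<psi> (i, s') (inv_into (fdom D s B) (fmap \<phi> s) v))"
        by (rule psh_cong[OF tdom_open[OF c i] _ P]) (simp add: eq)
    qed
  qed
  show ?thesis
  proof
    assume S: "semipositive Yt Lt \<psi>"
    show ?R
    proof clarify
      fix i s' D \<phi> s B z assume i: "i \<in> lb_idx LX" "s' \<in> frames" and c: "(D, \<phi>) \<in> charts X" "s \<in> frames" "(B, z) \<in> charts C"
      have "(i, s') \<in> lb_idx Lt" "(fdom D s B, fmap \<phi> s) \<in> charts Yt"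
        unfolding lb_idx_Lt charts_Yt using i c by blast+
      then have "psh (mdim Yt) (fmap \<phi> s ` (fdom D s B \<inter> lb_dom Lt (i, s'))) (\<lambda>v. \<psi> (i, s') (inv_into (fdom D s B) (fmap \<phi> s) v))"
        using S unfolding semipositive_def by blast
      then show "psh (Suc n) (tdom D \<phi> s B i s') (\<lambda>v. \<psi> (i, s') (theta D \<phi> s v))"
        using *[OF c i] by blast
    qed
  next
    assume R: ?R
    show "semipositive Yt Lt \<psi>"
      unfolding semipositive_def
    proof clarify
      fix i s' D' \<phi>' assume "(i, s') \<in> lb_idx Lt" and c': "(D', \<phi>') \<in> charts Yt"
      then have i: "i \<in> lb_idx LX" "s' \<in> frames" unfolding lb_idx_Lt by auto
      obtain D \<phi> s B z where c: "D' = fdom D s B" "\<phi>' = fmap \<phi> s" "(D, \<phi>) \<in> charts X" "s \<in> frames" "(B, z) \<in> charts C"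
        using c' unfolding charts_Yt by blast
      show "psh (mdim Yt) (\<phi>' ` (D' \<inter> lb_dom Lt (i, s'))) (\<lambda>z. \<psi> (i, s') (inv_into D' \<phi>' z))"
        unfolding c(1,2) *[OF c(3-5) i] using R i c(3-5) by blast
    qed
  qed
qed

lemma singular_Lt_iff:
  assumes "semipositive Yt Lt \<psi>"
  shows "singular_metric Yt Lt \<psi> \<longleftrightarrow>
     (\<forall>I\<in>lb_idx Lt. \<forall>J\<in>lb_idx Lt. \<forall>q\<in>lb_dom Lt I \<inter> lb_dom Lt J.
        \<psi> I q = \<psi> J q + ereal (ln ((cmod (lb_trans Lt I J q))\<^sup>2))) \<and>
     (\<forall>i\<in>lb_idx LX. \<forall>s'\<in>frames. \<forall>(D, \<phi>)\<in>charts X. \<forall>s\<in>frames. \<forall>(B, z)\<in>charts C.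
        \<forall>K. compactin (Cn (Suc n)) K \<and> K \<subseteq> tdom D \<phi> s B i s' \<longrightarrow>
          absint (Suc n) K (\<lambda>v. \<psi> (i, s') (theta D \<phi> s v)) < \<infinity>)" (is "_ \<longleftrightarrow> ?P \<and> ?R")
proof -
  have *: "absint (Suc n) K (\<lambda>v. \<psi> (i, s') (inv_into (fdom D s B) (fmap \<phi> s) v)) = absint (Suc n) K (\<lambda>v. \<psi> (i, s') (theta D \<phi> s v))"
    if c: "(D, \<phi>) \<in> charts X" "s \<in> frames" "(B, z) \<in> charts C" and K: "K \<subseteq> tdom D \<phi> s B i s'" for D \<phi> s B z i s' K
  proof (rule absint_cong)
    fix v assume "v \<in> K"
    then have "v \<in> tdom D \<phi> s B i s'" using K by blast
    from fmap_inv_tdom[OF c this]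
    show "\<psi> (i, s') (inv_into (fdom D s B) (fmap \<phi> s) v) = \<psi> (i, s') (theta D \<phi> s v)" by simp
  qed
  let ?Q = "\<forall>i\<in>lb_idx Lt. \<forall>(D, \<phi>)\<in>charts Yt. \<forall>K. compactin (Cn (mdim Yt)) K \<and> K \<subseteq> \<phi> ` (D \<inter> lb_dom Lt i) \<longrightarrow>
        absint (mdim Yt) K (\<lambda>z. \<psi> i (inv_into D \<phi> z)) < \<infinity>"
  have "?Q \<longleftrightarrow> ?R"
  proof
    assume Q: ?Q
    show ?R
    proof clarify
      fix i s' D \<phi> s B z K assume i: "i \<in> lb_idx LX" "s' \<in> frames" and c: "(D, \<phi>) \<in> charts X" "s \<in> frames" "(B, z) \<in> charts C"
        and K: "compactin (Cn (Suc n)) K" "K \<subseteq> tdom D \<phi> s B i s'"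
      have I: "(i, s') \<in> lb_idx Lt" "(fdom D s B, fmap \<phi> s) \<in> charts Yt"
        unfolding lb_idx_Lt charts_Yt using i c by blast+
      from Q[rule_format, OF I(1) I(2), simplified, rule_format] K
      show "absint (Suc n) K (\<lambda>v. \<psi> (i, s') (theta D \<phi> s v)) < \<infinity>"
        unfolding fmap_image_dom[OF c] mdim_Yt *[OF c K(2), symmetric] by simp
    qed
  next
    assume R: ?R
    show ?Q
    proof clarify
      fix i s' D' \<phi>' K assume "(i, s') \<in> lb_idx Lt" and c': "(D', \<phi>') \<in> charts Yt"
        and K: "compactin (Cn (mdim Yt)) K" "K \<subseteq> \<phi>' ` (D' \<inter> lb_dom Lt (i, s'))"
      then have i: "i \<in> lb_idx LX" "s' \<in> frames" unfolding lb_idx_Lt by auto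
      obtain D \<phi> s B z where c: "D' = fdom D s B" "\<phi>' = fmap \<phi> s" "(D, \<phi>) \<in> charts X" "s \<in> frames" "(B, z) \<in> charts C"
        using c' unfolding charts_Yt by blast
      have K': "compactin (Cn (Suc n)) K" "K \<subseteq> tdom D \<phi> s B i s'"
        using K unfolding c(1,2) fmap_image_dom[OF c(3-5)] mdim_Yt by auto
      show "absint (mdim Yt) K (\<lambda>z. \<psi> (i, s') (inv_into D' \<phi>' z)) < \<infinity>"
        unfolding c(1,2) mdim_Yt *[OF c(3-5) K'(2)] using R i c(3-5) K' by blast
    qed
  qed
  moreover have "singular_metric Yt Lt \<psi> \<longleftrightarrow> ?P \<and> ?Q"
    by (rule singular_metric_iff[OF assms]) (rule Yt_dom_open)
  ultimately show ?thesis by (simp only:)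
qed

lemma product_metric:
  assumes k: "singular_metric X LX k" "semipositive X LX k"
  defines "w \<equiv> metric_tensor (metric_pullback fst k) (metric_pullback snd (O1_metric h))"
  shows "semipositive Yt Lt w" and "singular_metric Yt Lt w"
proof -
  have w: "w (i, s) q = k i (fst q) + O1_metric h s (snd q)" for i s q
    by (simp add: w_def metric_tensor_def metric_pullback_def)
  have kp: "psh n (\<phi> ` (D \<inter> lb_dom LX i)) (\<lambda>v. k i (inv_into D \<phi> v))"
    if "i \<in> lb_idx LX" "(D, \<phi>) \<in> charts X" for i D \<phi>
    using k(2) that unfolding semipositive_def by blast
  have "singular_metric X LX k \<longleftrightarrow>
     (\<forall>i\<in>lb_idx LX. \<forall>j\<in>lb_idx LX. \<forall>x\<in>lb_dom LX i \<inter> lb_dom LX j.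
        k i x = k j x + ereal (ln ((cmod (lb_trans LX i j x))\<^sup>2))) \<and>
     (\<forall>i\<in>lb_idx LX. \<forall>(D, \<phi>)\<in>charts X. \<forall>K. compactin (Cn n) K \<and> K \<subseteq> \<phi> ` (D \<inter> lb_dom LX i) \<longrightarrow>
        absint n K (\<lambda>z. k i (inv_into D \<phi> z)) < \<infinity>)"
    by (rule singular_metric_iff[OF k(2)]) (rule X_dom_open)
  note ks = this[THEN iffD1, OF k(1)]
  have ka: "absint n K (\<lambda>v. k i (inv_into D \<phi> v)) < \<infinity>"
    if "i \<in> lb_idx LX" "(D, \<phi>) \<in> charts X" "compactin (Cn n) K" "K \<subseteq> \<phi> ` (D \<inter> lb_dom LX i)" for i D \<phi> K
    using ks that by blast
  have kc: "k i p = k j p + ereal (ln ((cmod (lb_trans LX i j p))\<^sup>2))"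
    if "i \<in> lb_idx LX" "j \<in> lb_idx LX" "p \<in> lb_dom LX i" "p \<in> lb_dom LX j" for i j p
    using ks that by blast
  have wt: "w (i, s') (theta D \<phi> s v) = k i (base_pt D \<phi> v) + O1_metric h s' (snd (theta D \<phi> s v))" for i s' D \<phi> s v
    unfolding w by (simp add: theta_def)
  show S: "semipositive Yt Lt w"
    unfolding semipositive_Lt_iff
  proof clarify
    fix i s' D \<phi> s B z assume i: "i \<in> lb_idx LX" "s' \<in> frames" and c: "(D, \<phi>) \<in> charts X" "s \<in> frames" "(B, z) \<in> charts C"
    show "psh (Suc n) (tdom D \<phi> s B i s') (\<lambda>v. w (i, s') (theta D \<phi> s v))"
      unfolding wt by (rule product_weight(1)[where k = k, OF c i kp[OF i(1) c(1)] ka[OF i(1) c(1)]])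
  qed
  show "singular_metric Yt Lt w"
    unfolding singular_Lt_iff[OF S]
  proof (intro conjI)
    show "\<forall>I\<in>lb_idx Lt. \<forall>J\<in>lb_idx Lt. \<forall>q\<in>lb_dom Lt I \<inter> lb_dom Lt J.
        w I q = w J q + ereal (ln ((cmod (lb_trans Lt I J q))\<^sup>2))"
    proof (intro ballI)
      fix I J q assume I: "I \<in> lb_idx Lt" "J \<in> lb_idx Lt" and q: "q \<in> lb_dom Lt I \<inter> lb_dom Lt J"
      obtain i s j t where ij: "I = (i, s)" "J = (j, t)" "i \<in> lb_idx LX" "j \<in> lb_idx LX" "s \<in> frames" "t \<in> frames"
        using I unfolding lb_idx_Lt by auto
      have q': "fst q \<in> lb_dom LX i" "fst q \<in> lb_dom LX j" "snd q \<in> frame_dom s" "snd q \<in> frame_dom t"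
        using q unfolding ij lb_dom_Lt by auto
      have "ln ((cmod (lb_trans Lt I J q))\<^sup>2) =
          ln ((cmod (lb_trans LX i j (fst q)))\<^sup>2) + ln ((cmod (lb_trans (O1 C F) s t (snd q)))\<^sup>2)"
        using I q unfolding ij by (intro ln_trans_Lt) auto
      then show "w I q = w J q + ereal (ln ((cmod (lb_trans Lt I J q))\<^sup>2))"
        unfolding ij w kc[OF ij(3,4) q'(1,2)] O1_cocycle(2)[OF ij(5,6) q'(3,4)]
        by (simp only: plus_ereal.simps(1)[symmetric] add_ac)
    qed
    show "\<forall>i\<in>lb_idx LX. \<forall>s'\<in>frames. \<forall>(D, \<phi>)\<in>charts X. \<forall>s\<in>frames. \<forall>(B, z)\<in>charts C.
        \<forall>K. compactin (Cn (Suc n)) K \<and> K \<subseteq> tdom D \<phi> s B i s' \<longrightarrow>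
          absint (Suc n) K (\<lambda>v. w (i, s') (theta D \<phi> s v)) < \<infinity>"
    proof clarify
      fix i s' D \<phi> s B z K assume i: "i \<in> lb_idx LX" "s' \<in> frames" and c: "(D, \<phi>) \<in> charts X" "s \<in> frames" "(B, z) \<in> charts C"
        and K: "compactin (Cn (Suc n)) K" "K \<subseteq> tdom D \<phi> s B i s'"
      show "absint (Suc n) K (\<lambda>v. w (i, s') (theta D \<phi> s v)) < \<infinity>"
        unfolding wt by (rule product_weight(2)[where k = k, OF c i kp[OF i(1) c(1)] ka[OF i(1) c(1)] K])
    qed
  qed
qed

end

section \<open>The supremum over the fibres, and minimality\<close>

context flat_fibration
begin

text \<open>A real-valued form of the weight, which can be subtracted from extended reals without
  meeting \<infinity> - \<infinity>.\<close>

definition O1w :: "('c, 'i) frame \<Rightarrow> ('c, 'i) ppoint \<Rightarrow> real" where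
  "O1w s y = ln (Re (h (fst y) (frame_gen s y) (frame_gen s y)))"

lemma O1_metric_eq: "O1_metric h s y = ereal (O1w s y)"
  by (simp add: O1_metric_def O1w_def)

text \<open>At a given point of the fibre product this difference is the same for all frames
  \<open>s\<close> containing it; a supremum over frames and coordinates is therefore one over
  points of the fibre.\<close>

definition rel_weight :: "('x \<times> ('c, 'i) ppoint, 'j \<times> ('c, 'i) frame) weights \<Rightarrow> 'j \<Rightarrow> ('c, 'i) frame \<Rightarrow> 'x \<Rightarrow> ('c, 'i) ppoint \<Rightarrow> ereal" where
  "rel_weight \<psi> i s p y = \<psi> (i, s) (p, y) + ereal (- O1w s y)"

text \<open>The supremum over the fibre of a metric on \<open>p\<^sub>1\<^sup>*L\<^sub>X \<otimes> p\<^sub>2\<^sup>*\<O>(1)\<close> relative to the metric of \<open>\<O>(1)\<close>.\<close>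

definition push :: "('x \<times> ('c, 'i) ppoint, 'j \<times> ('c, 'i) frame) weights \<Rightarrow> ('x, 'j) weights" where
  "push \<psi> i p = (SUP (s, w)\<in>{(s, w). s \<in> frames \<and> f p \<in> fst s}. rel_weight \<psi> i s p (frame_pt s p w))"

lemma rel_weight_le_push:
  assumes "s \<in> frames" "f p \<in> fst s"
  shows "rel_weight \<psi> i s p (frame_pt s p w) \<le> push \<psi> i p"
  unfolding push_def by (rule SUP_upper2[of "(s, w)"]) (use assms in auto)

lemma push_le:
  assumes "\<And>s w. s \<in> frames \<Longrightarrow> f p \<in> fst s \<Longrightarrow> rel_weight \<psi> i s p (frame_pt s p w) \<le> c"
  shows "push \<psi> i p \<le> c"
  unfolding push_def by (rule SUP_least) (use assms in auto)

lemma mem_lb_dom_Lt: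
  assumes "i \<in> lb_idx LX" "p \<in> lb_dom LX i" "s \<in> frames" "f p \<in> fst s" "frame_pt s p w \<in> frame_dom t"
  shows "(p, frame_pt s p w) \<in> lb_dom Lt (i, t)"
  unfolding lb_dom_Lt using ppoint_mem[OF assms(3) _ assms(4)] LX_dom_sub[OF assms(1)] assms(2,5) by auto

context
  fixes \<psi> :: "('x \<times> ('c, 'i) ppoint, 'j \<times> ('c, 'i) frame) weights"
  assumes sing: "singular_metric Yt Lt \<psi>" and semi: "semipositive Yt Lt \<psi>"
begin

text \<open>The cocycle of \<open>Lt\<close> splits, and its O(1) part is also that of
  \<open>O1w\<close>; it cancels in the difference, so only the cocycle of \<open>LX\<close>
  remains.\<close>

lemma rel_weight_trans:
  assumes ij: "i \<in> lb_idx LX" "j \<in> lb_idx LX" "s \<in> frames" "t \<in> frames"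
    and q: "(p, y) \<in> lb_dom Lt (i, s)" "(p, y) \<in> lb_dom Lt (j, t)"
  shows "rel_weight \<psi> i s p y = rel_weight \<psi> j t p y + ereal (ln ((cmod (lb_trans LX i j p))\<^sup>2))"
proof -
  have I: "(i, s) \<in> lb_idx Lt" "(j, t) \<in> lb_idx Lt" unfolding lb_idx_Lt using ij by auto
  have "\<psi> (i, s) (p, y) = \<psi> (j, t) (p, y) + ereal (ln ((cmod (lb_trans Lt (i, s) (j, t) (p, y)))\<^sup>2))"
    using sing I q unfolding singular_metric_def by blast
  moreover note ln_trans_Lt[OF I q]
  moreover have "O1w s y = O1w t y + ln ((cmod (lb_trans (O1 C F) s t y))\<^sup>2)"
    using O1_cocycle(2)[OF ij(3,4), of y] q unfolding lb_dom_Lt O1_metric_eq by simp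
  ultimately show ?thesis
    unfolding rel_weight_def by (cases "\<psi> (j, t) (p, y)") auto
qed

lemma push_trans:
  assumes ij: "i \<in> lb_idx LX" "j \<in> lb_idx LX" and p: "p \<in> lb_dom LX i" "p \<in> lb_dom LX j"
  shows "push \<psi> i p = push \<psi> j p + ereal (ln ((cmod (lb_trans LX i j p))\<^sup>2))"
proof -
  have le: "push \<psi> i p \<le> push \<psi> j p + ereal (ln ((cmod (lb_trans LX i j p))\<^sup>2))"
    if "i \<in> lb_idx LX" "j \<in> lb_idx LX" "p \<in> lb_dom LX i" "p \<in> lb_dom LX j" for i j
  proof (rule push_le)
    fix s w assume s: "s \<in> frames" "f p \<in> fst s"
    note d = frame_pt_dom[of p s w, OF s(2)]
    have "rel_weight \<psi> i s p (frame_pt s p w) =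
        rel_weight \<psi> j s p (frame_pt s p w) + ereal (ln ((cmod (lb_trans LX i j p))\<^sup>2))"
      using that s by (intro rel_weight_trans mem_lb_dom_Lt d) auto
    also have "\<dots> \<le> push \<psi> j p + ereal (ln ((cmod (lb_trans LX i j p))\<^sup>2))"
      by (intro add_right_mono rel_weight_le_push s)
    finally show "rel_weight \<psi> i s p (frame_pt s p w) \<le> push \<psi> j p + ereal (ln ((cmod (lb_trans LX i j p))\<^sup>2))" .
  qed
  \<comment> \<open>The opposite inequality is \<open>le\<close> with i and j exchanged, because the
    two transition functions are inverse to each other.\<close>
  have inv: "lb_trans LX i j p * lb_trans LX j i p = 1" by (rule LX_trans_inverse[OF ij p])
  then have "(cmod (lb_trans LX i j p))\<^sup>2 * (cmod (lb_trans LX j i p))\<^sup>2 = 1"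
    by (metis norm_mult norm_one power_mult_distrib power_one)
  moreover have "lb_trans LX i j p \<noteq> 0" "lb_trans LX j i p \<noteq> 0" using inv by auto
  ultimately have "ln ((cmod (lb_trans LX i j p))\<^sup>2) + ln ((cmod (lb_trans LX j i p))\<^sup>2) = 0"
    using ln_mult_pos[of "(cmod (lb_trans LX i j p))\<^sup>2" "(cmod (lb_trans LX j i p))\<^sup>2"] by simp
  then have "ln ((cmod (lb_trans LX j i p))\<^sup>2) = - ln ((cmod (lb_trans LX i j p))\<^sup>2)" by simp
  with le[OF ij(2,1) p(2,1)] have "push \<psi> j p \<le> push \<psi> i p + ereal (- ln ((cmod (lb_trans LX i j p))\<^sup>2))" by simp
  then have "push \<psi> j p + ereal (ln ((cmod (lb_trans LX i j p))\<^sup>2)) \<le> push \<psi> i p"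
    by (cases "push \<psi> i p"; cases "push \<psi> j p") auto
  with le[OF ij p] show ?thesis by (rule antisym)
qed

text \<open>A line [a : b] has coordinate b/a in the first frame and a/b in the second, and one of
  them is defined with modulus at most 1. The supremum over all frames and coordinates thus becomes
  one over two compact discs, the form that \<open>psh_compact_sup\<close> takes.\<close>

lemma push_flat:
  assumes i: "i \<in> lb_idx LX" and p: "p \<in> lb_dom LX i" and fc: "flat_chart C (vb_dual F) h W E B z" and fp: "f p \<in> W"
  defines "s1 \<equiv> (W, \<lambda>x. E x 1 0, \<lambda>x. E x 0 1)" and "s2 \<equiv> (W, \<lambda>x. E x 0 1, \<lambda>x. E x 1 0)"
  shows "push \<psi> i p = max (SUP w\<in>cball 0 1. \<psi> (i, s1) (p, frame_pt s1 p w) + ereal (- ln (1 + (cmod w)\<^sup>2)))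
    (SUP w\<in>cball 0 1. \<psi> (i, s2) (p, frame_pt s2 p w) + ereal (- ln (1 + (cmod w)\<^sup>2)))"
proof -
  have s12: "s1 \<in> frames" "s2 \<in> frames" unfolding s1_def s2_def by (rule flat_frames[OF fc])+
  have fs: "f p \<in> fst s1" "f p \<in> fst s2" using fp by (auto simp: s1_def s2_def)
  have ub: "unit_basis (vb_dual F) h (f p) (E (f p))" using fc fp unfolding flat_chart_def by blast
  have fa1: "frame_at (E (f p)) s1 (f p) 1 0 0 1" and fa2: "frame_at (E (f p)) s2 (f p) 0 1 1 0"
    using fp by (auto simp: frame_at_def s1_def s2_def)
  have vec: "frame_vec s1 (f p) w = E (f p) 1 w" "frame_vec s2 (f p) w = E (f p) w 1" for w
    using frame_at_vec[OF ub fa1, of w] frame_at_vec[OF ub fa2, of w] by auto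
  have pt: "frame_pt s1 p w = (f p, fline (E (f p) 1 w))" "frame_pt s2 p w = (f p, fline (E (f p) w 1))" for w
    unfolding frame_pt_def vec by auto
  have gen: "frame_gen s (frame_pt s p w) = frame_vec s (f p) w" if "s \<in> frames" "f p \<in> fst s" for s w
    unfolding frame_gen_def frame_pt_def using frame_coord_vec[OF that] by simp
  have O: "O1w s1 (frame_pt s1 p w) = ln (1 + (cmod w)\<^sup>2)" "O1w s2 (frame_pt s2 p w) = ln (1 + (cmod w)\<^sup>2)" for w
    unfolding O1w_def gen[OF s12(1) fs(1)] gen[OF s12(2) fs(2)] vec
    by (simp_all add: frame_pt_def ub_norm[OF ub] add.commute del: of_real_add of_real_power)
  have r: "\<psi> (i, s1) (p, frame_pt s1 p w) + ereal (- ln (1 + (cmod w)\<^sup>2)) = rel_weight \<psi> i s1 p (frame_pt s1 p w)"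
    "\<psi> (i, s2) (p, frame_pt s2 p w) + ereal (- ln (1 + (cmod w)\<^sup>2)) = rel_weight \<psi> i s2 p (frame_pt s2 p w)" for w
    unfolding rel_weight_def O by auto
  let ?m = "max (SUP w\<in>cball 0 1. rel_weight \<psi> i s1 p (frame_pt s1 p w)) (SUP w\<in>cball 0 1. rel_weight \<psi> i s2 p (frame_pt s2 p w))"
  show ?thesis
    unfolding r
  proof (rule antisym)
    show "?m \<le> push \<psi> i p"
      by (intro max.boundedI SUP_least rel_weight_le_push s12 fs)
    show "push \<psi> i p \<le> ?m"
    proof (rule push_le)
      fix s w assume s: "s \<in> frames" "f p \<in> fst s"
      obtain p1 p2 q1 q2 where fa: "frame_at (E (f p)) s (f p) p1 p2 q1 q2"
        using frame_at_exists[OF ub s] by blast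
      define a b where "a = p1 + w * q1" and "b = p2 + w * q2"
      have y: "frame_pt s p w = (f p, fline (E (f p) a b))"
        unfolding frame_pt_def frame_at_vec[OF ub fa] a_def b_def ..
      have nz: "a \<noteq> 0 \<or> b \<noteq> 0" unfolding a_def b_def by (rule frame_at_nz[OF ub fa])
      have one: "lb_trans LX i i p = 1" by (rule LX_trans_self[OF i p])
      have eq: "rel_weight \<psi> i s p (frame_pt s p w) = rel_weight \<psi> i t p (frame_pt t p w')"
        if t: "t \<in> frames" "f p \<in> fst t" and pp: "frame_pt s p w = frame_pt t p w'" for t w'
      proof -
        have "(p, frame_pt s p w) \<in> lb_dom Lt (i, s)" by (intro mem_lb_dom_Lt i p s frame_pt_dom)
        moreover have "(p, frame_pt s p w) \<in> lb_dom Lt (i, t)" unfolding pp by (intro mem_lb_dom_Lt i p t frame_pt_dom)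
        ultimately have "rel_weight \<psi> i s p (frame_pt s p w) = rel_weight \<psi> i t p (frame_pt s p w) + ereal (ln ((cmod (lb_trans LX i i p))\<^sup>2))"
          by (intro rel_weight_trans i s t)
        then show ?thesis unfolding one pp by simp
      qed
      show "rel_weight \<psi> i s p (frame_pt s p w) \<le> ?m"
      proof (cases "cmod b \<le> cmod a")
        case True
        then have a: "a \<noteq> 0" using nz by auto
        have "fline (E (f p) 1 (b / a)) = fline (E (f p) a b)"
          using ub_fline[OF ub nz, of 1 "b / a"] a by auto
        then have "frame_pt s p w = frame_pt s1 p (b / a)" unfolding y pt by simp
        from eq[OF s12(1) fs(1) this] have "rel_weight \<psi> i s p (frame_pt s p w) = rel_weight \<psi> i s1 p (frame_pt s1 p (b / a))" .
        also have "\<dots> \<le> (SUP w\<in>cball 0 1. rel_weight \<psi> i s1 p (frame_pt s1 p w))"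
          using True a by (intro SUP_upper) (simp add: norm_divide)
        finally show ?thesis by (rule order_trans) (rule max.cobounded1)
      next
        case False
        then have b: "b \<noteq> 0" by auto
        have "fline (E (f p) (a / b) 1) = fline (E (f p) a b)"
          using ub_fline[OF ub nz, of "a / b" 1] b by auto
        then have "frame_pt s p w = frame_pt s2 p (a / b)" unfolding y pt by simp
        from eq[OF s12(2) fs(2) this] have "rel_weight \<psi> i s p (frame_pt s p w) = rel_weight \<psi> i s2 p (frame_pt s2 p (a / b))" .
        also have "\<dots> \<le> (SUP w\<in>cball 0 1. rel_weight \<psi> i s2 p (frame_pt s2 p w))"
          using False b by (intro SUP_upper) (simp add: norm_divide)
        finally show ?thesis by (rule order_trans) (rule max.cobounded2)
      qed
    qed
  qed
qed

text \<open>Over \<open>W\<close> a flat frame serves as chart and as trivialization at once. The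
  weight then lives on a full cylinder, and \<open>push_flat\<close> writes the supremum as a
  maximum of two suprema to which the lemmas on n-space apply.\<close>

lemma push_local:
  assumes i: "i \<in> lb_idx LX" and cX: "(D, \<phi>) \<in> charts X" and v0: "v0 \<in> \<phi> ` (D \<inter> lb_dom LX i)"
  shows "\<exists>A u. openin (Cn n) A \<and> v0 \<in> A \<and> A \<subseteq> \<phi> ` (D \<inter> lb_dom LX i) \<and>
    (\<forall>v\<in>A. push \<psi> i (inv_into D \<phi> v) = u v) \<and> psh n A u \<and>
    (\<forall>K. compactin (Cn n) K \<and> K \<subseteq> A \<longrightarrow> absint n K u < \<infinity>)"
proof -
  obtain p0 where p0: "p0 \<in> D" "p0 \<in> lb_dom LX i" "v0 = \<phi> p0" using v0 by auto
  have p0X: "p0 \<in> points X" using LX_dom_sub[OF i] p0(2) by blast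
  have "f p0 \<in> points C"
    using f p0X topspace_mtop[OF X] topspace_mtop[OF C] unfolding hol_map_def continuous_map_def by auto
  then obtain W E B z where W: "f p0 \<in> W" and fc: "flat_chart C (vb_dual F) h W E B z"
    using flat_chart_at by metis
  have Wo: "openin (mtop C) W" and cC: "(B, z) \<in> charts C" and WB: "W \<subseteq> B"
    using fc unfolding flat_chart_def by blast+
  define A where "A = \<phi> ` (D \<inter> (lb_dom LX i \<inter> {p \<in> points X. f p \<in> W}))"
  have A: "openin (Cn n) A"
    unfolding A_def by (intro openin_chart_image[OF X cX] openin_Int LX_dom_open i f_preimage_open Wo)
  have v0A: "v0 \<in> A" unfolding A_def using p0 p0X W by blast
  have AA: "A \<subseteq> \<phi> ` (D \<inter> lb_dom LX i)" unfolding A_def by blast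
  have Ap: "inv_into D \<phi> v \<in> D" "inv_into D \<phi> v \<in> lb_dom LX i" "inv_into D \<phi> v \<in> points X" "f (inv_into D \<phi> v) \<in> W"
    "\<phi> (inv_into D \<phi> v) = v" if v: "v \<in> A" for v
  proof -
    obtain p where p: "p \<in> D" "p \<in> lb_dom LX i" "p \<in> points X" "f p \<in> W" "v = \<phi> p"
      using v unfolding A_def by blast
    have "inv_into D \<phi> v = p" unfolding p(5) by (rule chart_inv[OF X cX p(1)])
    then show "inv_into D \<phi> v \<in> D" "inv_into D \<phi> v \<in> lb_dom LX i" "inv_into D \<phi> v \<in> points X" "f (inv_into D \<phi> v) \<in> W"
      "\<phi> (inv_into D \<phi> v) = v" using p by simp_all
  qed
  define c where "c = (\<lambda>w :: complex. - ln (1 + (cmod w)\<^sup>2))"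
  have cc: "continuous_on UNIV c"
  proof -
    have "1 + (cmod w)\<^sup>2 \<noteq> 0" for w using zero_le_power2[of "cmod w"] by linarith
    then show ?thesis unfolding c_def by (intro continuous_intros) auto
  qed
  define S where "S = (\<lambda>s v. SUP w\<in>cball 0 1. \<psi> (i, s) (theta D \<phi> s (v(n := w))) + ereal (c w))"
  have vt: "v \<in> topspace (Cn n)" if "v \<in> A" for v using that openin_subset[OF A] by blast
  \<comment> \<open>With the same frame for chart and trivialization no line is missed, so nothing
    is removed from the cylinder.\<close>
  have td: "tdom D \<phi> s B i s = cyl n A" if s: "s \<in> frames" "fst s = W" for s
  proof -
    note tdom = tdom_def[OF cX s(1) cC] and bp = base_pt_fbase[OF cX s(1) cC]
    show ?thesis
    proof (intro equalityI subsetI)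
      fix v assume "v \<in> tdom D \<phi> s B i s"
      then have v: "v \<in> cyl n (fbase D \<phi> s B)" "base_pt D \<phi> v \<in> lb_dom LX i" unfolding tdom by auto
      have "\<phi> (base_pt D \<phi> v) \<in> A"
        unfolding A_def using bp[OF v(1)] v(2) s(2) by blast
      then show "v \<in> cyl n A" using v(1) bp(5)[OF v(1)] unfolding cyl_def by simp
    next
      fix v assume v: "v \<in> cyl n A"
      then have r: "restrict v {..<n} \<in> A" and vtop: "v \<in> topspace (Cn (Suc n))" unfolding cyl_def by auto
      note q = Ap[OF r]
      have "A \<subseteq> fbase D \<phi> s B" unfolding A_def fbase_def s(2) using WB by blast
      then have "v \<in> cyl n (fbase D \<phi> s B)" using v unfolding cyl_def by blast
      moreover have "base_pt D \<phi> v \<in> lb_dom LX i" unfolding base_pt_def by (rule q(2))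
      moreover have "snd (theta D \<phi> s v) \<in> frame_dom s"
        unfolding theta_def snd_conv by (rule frame_pt_dom) (use q(4) s(2) in \<open>simp add: base_pt_def\<close>)
      ultimately show "v \<in> tdom D \<phi> s B i s" unfolding tdom by blast
    qed
  qed
  have up: "psh (Suc n) (cyl n A) (\<lambda>v. \<psi> (i, s) (theta D \<phi> s v))" if s: "s \<in> frames" "fst s = W" for s
    unfolding td[OF s, symmetric] using semi[unfolded semipositive_Lt_iff] i s(1) cX cC by blast
  have ua: "absint (Suc n) L (\<lambda>v. \<psi> (i, s) (theta D \<phi> s v)) < \<infinity>"
    if s: "s \<in> frames" "fst s = W" and L: "compactin (Cn (Suc n)) L" "L \<subseteq> cyl n A" for s L
    using sing[unfolded singular_Lt_iff[OF semi]] i s(1) cX cC L unfolding td[OF s, symmetric] by blast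
  have Sp: "psh n A (S s)" if s: "s \<in> frames" "fst s = W" for s
    unfolding S_def by (rule psh_compact_sup[OF A up[OF s] _ _ cc]) auto
  have Sa: "absint n L (S s) < \<infinity>" if s: "s \<in> frames" "fst s = W" and L: "compactin (Cn n) L" "L \<subseteq> A" for s L
    unfolding S_def
  proof (rule absint_compact_sup[OF A up[OF s] _ _ _ cc L])
    show "absint (Suc n) L (\<lambda>v. \<psi> (i, s) (theta D \<phi> s v)) < \<infinity>"
      if "compactin (Cn (Suc n)) L" "L \<subseteq> cyl n A" for L by (rule ua[OF s that])
    \<comment> \<open>Positive area of the disc guarantees an integrable slice with parameter in
      it.\<close>
    show "emeasure lborel (cball 0 1 :: complex set) > 0"
      by (subst emeasure_cball) (auto simp: ennreal_zero_less_mult_iff unit_ball_vol_pos)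
  qed simp
  define s1 s2 where "s1 = (W, \<lambda>x. E x 1 0, \<lambda>x. E x 0 1)" and "s2 = (W, \<lambda>x. E x 0 1, \<lambda>x. E x 1 0)"
  have s1: "s1 \<in> frames" "fst s1 = W" and s2: "s2 \<in> frames" "fst s2 = W"
    using flat_frames[OF fc] unfolding s1_def s2_def by simp_all
  define u where "u = (\<lambda>v. max (S s1 v) (S s2 v))"
  have "push \<psi> i (inv_into D \<phi> v) = u v" if v: "v \<in> A" for v
  proof -
    have "theta D \<phi> s (v(n := w)) = (inv_into D \<phi> v, frame_pt s (inv_into D \<phi> v) w)" for s w
      unfolding theta_def base_pt_def restrict_upd_Cn[OF vt[OF v]] by simp
    then show ?thesis
      using push_flat[OF i Ap(2)[OF v] fc Ap(4)[OF v], folded s1_def s2_def] unfolding u_def S_def c_def by simp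
  qed
  moreover have "psh n A u" unfolding u_def by (rule psh_max[OF Sp[OF s1] Sp[OF s2]])
  moreover have "absint n K u < \<infinity>" if K: "compactin (Cn n) K" "K \<subseteq> A" for K
    unfolding u_def
    by (rule absint_max[OF A _ _ K Sa[OF s1 K] Sa[OF s2 K]]) (use Sp[OF s1] Sp[OF s2] in \<open>simp_all add: psh_iff\<close>)
  ultimately show ?thesis using A v0A AA by blast
qed

lemma push_metric: "semipositive X LX (push \<psi>)" "singular_metric X LX (push \<psi>)"
proof -
  have p: "psh n (\<phi> ` (D \<inter> lb_dom LX i)) (\<lambda>v. push \<psi> i (inv_into D \<phi> v))"
    if "i \<in> lb_idx LX" "(D, \<phi>) \<in> charts X" for i D \<phi>
  proof (rule psh_local)
    fix v assume "v \<in> \<phi> ` (D \<inter> lb_dom LX i)"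
    from push_local[OF that this] show "\<exists>A u. openin (Cn n) A \<and> v \<in> A \<and> A \<subseteq> \<phi> ` (D \<inter> lb_dom LX i) \<and>
        (\<forall>v\<in>A. push \<psi> i (inv_into D \<phi> v) = u v) \<and> psh n A u" by meson
  qed
  then show S: "semipositive X LX (push \<psi>)" unfolding semipositive_def by blast
  have "singular_metric X LX (push \<psi>) \<longleftrightarrow>
     (\<forall>i\<in>lb_idx LX. \<forall>j\<in>lb_idx LX. \<forall>x\<in>lb_dom LX i \<inter> lb_dom LX j.
        push \<psi> i x = push \<psi> j x + ereal (ln ((cmod (lb_trans LX i j x))\<^sup>2))) \<and>
     (\<forall>i\<in>lb_idx LX. \<forall>(D, \<phi>)\<in>charts X. \<forall>K. compactin (Cn n) K \<and> K \<subseteq> \<phi> ` (D \<inter> lb_dom LX i) \<longrightarrow>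
        absint n K (\<lambda>z. push \<psi> i (inv_into D \<phi> z)) < \<infinity>)"
    by (rule singular_metric_iff[OF S]) (rule X_dom_open)
  moreover have "absint n K (\<lambda>z. push \<psi> i (inv_into D \<phi> z)) < \<infinity>"
    if i: "i \<in> lb_idx LX" and c: "(D, \<phi>) \<in> charts X" and K: "compactin (Cn n) K" "K \<subseteq> \<phi> ` (D \<inter> lb_dom LX i)" for i D \<phi> K
  proof (rule absint_local[OF X_dom_open[OF i c] _ _ K])
    show "usc (Cn n) (\<phi> ` (D \<inter> lb_dom LX i)) (\<lambda>v. push \<psi> i (inv_into D \<phi> v))"
      using p[OF i c] unfolding psh_iff by blast
    fix v assume "v \<in> \<phi> ` (D \<inter> lb_dom LX i)"
    from push_local[OF i c this] obtain A u where A: "openin (Cn n) A" "v \<in> A" "A \<subseteq> \<phi> ` (D \<inter> lb_dom LX i)"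
      "\<And>v. v \<in> A \<Longrightarrow> push \<psi> i (inv_into D \<phi> v) = u v"
      "\<And>K. compactin (Cn n) K \<Longrightarrow> K \<subseteq> A \<Longrightarrow> absint n K u < \<infinity>" by meson
    have "absint n L (\<lambda>v. push \<psi> i (inv_into D \<phi> v)) < \<infinity>" if L: "compactin (Cn n) L" "L \<subseteq> A" for L
    proof -
      have "absint n L (\<lambda>v. push \<psi> i (inv_into D \<phi> v)) = absint n L u"
        by (rule absint_cong) (use A(4) L(2) in blast)
      then show ?thesis using A(5)[OF L] by simp
    qed
    then show "\<exists>A. openin (Cn n) A \<and> v \<in> A \<and> A \<subseteq> \<phi> ` (D \<inter> lb_dom LX i) \<and>
        (\<forall>K. compactin (Cn n) K \<and> K \<subseteq> A \<longrightarrow> absint n K (\<lambda>v. push \<psi> i (inv_into D \<phi> v)) < \<infinity>)"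
      using A(1-3) by blast
  qed
  ultimately show "singular_metric X LX (push \<psi>)" using push_trans by blast
qed

end

text \<open>Supplies the neighbourhood for the comparison on the fibre product: all points of one
  trivialization over \<open>W\<close>. In coordinates it is \<open>tdom\<close> cut with the
  cylinder over \<open>W\<close>.\<close>

lemma Yt_open_preimage:
  assumes i: "i \<in> lb_idx LX" and s': "s' \<in> frames" and W: "openin (mtop X) W"
  shows "openin (mtop Yt) {q \<in> lb_dom Lt (i, s'). fst q \<in> W}"
proof -
  have inj: "inj_on \<phi> D" if "(D, \<phi>) \<in> charts Yt" for D \<phi>
    using that unfolding charts_Yt by (auto intro: fmap_inj)
  have "openin (Cn (mdim Yt)) (\<phi>' ` (D' \<inter> {q \<in> lb_dom Lt (i, s'). fst q \<in> W}))" if c': "(D', \<phi>') \<in> charts Yt" for D' \<phi>'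
  proof -
    obtain D \<phi> s B z where c: "D' = fdom D s B" "\<phi>' = fmap \<phi> s" "(D, \<phi>) \<in> charts X" "s \<in> frames" "(B, z) \<in> charts C"
      using c' unfolding charts_Yt by blast
    note tdom = tdom_def[OF c(3-5)] and bp = base_pt_fbase[OF c(3-5)]
    have "fmap \<phi> s ` (fdom D s B \<inter> {q \<in> lb_dom Lt (i, s'). fst q \<in> W}) =
        tdom D \<phi> s B i s' \<inter> cyl n (\<phi> ` (D \<inter> W))"
      unfolding fmap_image[OF c(3-5)]
    proof (intro equalityI subsetI)
      fix v assume "v \<in> {v \<in> cyl n (fbase D \<phi> s B). theta D \<phi> s v \<in> {q \<in> lb_dom Lt (i, s'). fst q \<in> W}}"
      then have v: "v \<in> cyl n (fbase D \<phi> s B)" "base_pt D \<phi> v \<in> lb_dom LX i" "snd (theta D \<phi> s v) \<in> frame_dom s'" "base_pt D \<phi> v \<in> W"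
        unfolding lb_dom_Lt theta_def by auto
      have "\<phi> (base_pt D \<phi> v) \<in> \<phi> ` (D \<inter> W)" using bp(1)[OF v(1)] v(4) by blast
      then have "v \<in> cyl n (\<phi> ` (D \<inter> W))" using v(1) bp(5)[OF v(1)] unfolding cyl_def by simp
      then show "v \<in> tdom D \<phi> s B i s' \<inter> cyl n (\<phi> ` (D \<inter> W))" unfolding tdom using v by blast
    next
      fix v assume v: "v \<in> tdom D \<phi> s B i s' \<inter> cyl n (\<phi> ` (D \<inter> W))"
      then have v': "v \<in> cyl n (fbase D \<phi> s B)" "base_pt D \<phi> v \<in> lb_dom LX i" "snd (theta D \<phi> s v) \<in> frame_dom s'"
        unfolding tdom by auto
      obtain p where "p \<in> D" "p \<in> W" "restrict v {..<n} = \<phi> p" using v unfolding cyl_def by auto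
      then have "base_pt D \<phi> v \<in> W" unfolding base_pt_def using chart_inv[OF X c(3)] by simp
      then show "v \<in> {v \<in> cyl n (fbase D \<phi> s B). theta D \<phi> s v \<in> {q \<in> lb_dom Lt (i, s'). fst q \<in> W}}"
        using v' theta_fdom(3)[OF c(3-5) v'(1)] unfolding lb_dom_Lt by (simp add: theta_def)
    qed
    then show ?thesis
      unfolding c(1,2) mdim_Yt
      using openin_Int[OF tdom_open[OF c(3-5) i s'] openin_cyl[OF openin_chart_image[OF X c(3) W]]] by simp
  qed
  moreover have "{q \<in> lb_dom Lt (i, s'). fst q \<in> W} \<subseteq> points Yt" unfolding lb_dom_Lt by blast
  ultimately show ?thesis using openin_mtop_inj[of Yt, OF inj] by blast
qed

text \<open>For a competitor \<psi>, the metric \<open>push \<psi>\<close> competes on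
  \<open>X\<close>, so it is at most k + A over some \<open>W\<close>. Adding the weight of O(1)
  back bounds \<psi> by the product weight with the same \<open>A\<close>.\<close>

lemma product_metric_minimal:
  assumes k: "minimal_singular_metric X LX k"
  shows "minimal_singular_metric Yt Lt (metric_tensor (metric_pullback fst k) (metric_pullback snd (O1_metric h)))"
    (is "minimal_singular_metric _ _ ?w")
  unfolding minimal_singular_metric_def
proof (intro conjI allI impI ballI)
  have k': "singular_metric X LX k" "semipositive X LX k" using k unfolding minimal_singular_metric_def by blast+
  show "singular_metric Yt Lt ?w" "semipositive Yt Lt ?w" using product_metric[OF k'] by blast+
  fix \<psi> I q assume \<psi>: "singular_metric Yt Lt \<psi> \<and> semipositive Yt Lt \<psi>" and I: "I \<in> lb_idx Lt" and q: "q \<in> lb_dom Lt I"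
  obtain i s where ij: "I = (i, s)" "i \<in> lb_idx LX" "s \<in> frames" using I unfolding lb_idx_Lt by auto
  have qi: "fst q \<in> lb_dom LX i" using q unfolding ij(1) lb_dom_Lt by blast
  have "less_sing_at X (fst q) (push \<psi> i) (k i)"
    using k push_metric \<psi> ij(2) qi unfolding minimal_singular_metric_def by blast
  then obtain A W where W: "openin (mtop X) W" "fst q \<in> W" and A: "\<And>p. p \<in> W \<Longrightarrow> push \<psi> i p \<le> k i p + ereal A"
    unfolding less_sing_at_def by blast
  show "less_sing_at Yt q (\<psi> I) (?w I)"
    unfolding less_sing_at_def ij(1)
  proof (intro exI conjI ballI)
    show "openin (mtop Yt) {q \<in> lb_dom Lt (i, s). fst q \<in> W}" by (rule Yt_open_preimage[OF ij(2,3) W(1)])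
    show "q \<in> {q \<in> lb_dom Lt (i, s). fst q \<in> W}" using q W(2) unfolding ij(1) by blast
    fix r assume r: "r \<in> {q \<in> lb_dom Lt (i, s). fst q \<in> W}"
    obtain p y where py: "r = (p, y)" by (cases r)
    have y: "y \<in> frame_dom s" "f p = fst y" and pW: "p \<in> W"
      using r unfolding py lb_dom_Lt by (auto simp: fibre_product_def)
    obtain w where w: "y = frame_pt s p w" "f p \<in> fst s"
      using y unfolding frame_dom_def frame_pt_def by auto
    have "rel_weight \<psi> i s p y \<le> k i p + ereal A"
      unfolding w(1) by (rule order_trans[OF rel_weight_le_push[OF ij(3) w(2)] A[OF pW]])
    then have "\<psi> (i, s) r \<le> k i p + ereal A + ereal (O1w s y)"
      unfolding rel_weight_def py by (cases "\<psi> (i, s) (p, y)"; cases "k i p") auto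
    then show "\<psi> (i, s) r \<le> ?w (i, s) r + ereal A"
      unfolding metric_tensor_def metric_pullback_def py by (simp add: O1_metric_eq add_ac)
  qed
qed

end

theorem theorem4p1:
  fixes C :: "'c cmfd" and F :: "('c, 'i) vbundle"
    and hF :: "'c \<Rightarrow> 'i fvec \<Rightarrow> 'i fvec \<Rightarrow> complex"
    and Y :: "('c, 'i) ppoint cmfd" and LY :: "(('c, 'i) ppoint, ('c, 'i) frame) lbundle"
    and X :: "'x cmfd" and f :: "'x \<Rightarrow> 'c" and LX :: "('x, 'j) lbundle" and hLX :: "('x, 'j) weights"
    and Yt :: "('x \<times> ('c, 'i) ppoint) cmfd"
    and Lt :: "('x \<times> ('c, 'i) ppoint, 'j \<times> ('c, 'i) frame) lbundle"
  assumes "compact_curve C" and "genus C > 1"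
    and "hol_vbundle C F" and "vb_rank F = 2" and "vb_degree C F = 0"
    and "\<And>m. m \<ge> 1 \<Longrightarrow> stable_vbundle C (sym_power m F)"
    and "unitary_flat_metric C (vb_dual F) hF"
    and "hol_fibre_bundle X C f"
    and "hol_lbundle X LX" and "pseudo_effective X LX"
    and "minimal_singular_metric X LX hLX"
  defines "Y \<equiv> proj_bundle C F" and "LY \<equiv> O1 C F"
  defines "Yt \<equiv> fibre_product C X f Y fst"
  defines "Lt \<equiv> lb_tensor (lb_pullback Yt fst LX) (lb_pullback Yt snd LY)"
  shows "minimal_singular_metric Yt Lt
           (metric_tensor (metric_pullback fst hLX) (metric_pullback snd (O1_metric hF)))"
proof -
  have C: "complex_manifold C" "mdim C = 1" using assms(1) unfolding compact_curve_def by blast+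
  have X: "complex_manifold X" "hol_map X C f" using assms(8) unfolding hol_fibre_bundle_def by blast+
  have F: "\<And>i. i \<in> vb_idx F \<Longrightarrow> openin (mtop C) (vb_dom F i)" "\<Union> (vb_dom F ` vb_idx F) = points C"
    using assms(3) unfolding hol_vbundle_def by blast+
  \<comment> \<open>\<open>vb_dual\<close> changes only the transition matrices, so the dual has the
    rank, index set and domains of F.\<close>
  interpret flat_fibration C F hF X f LX
    by unfold_locales (use C X F assms(4,7,9) in \<open>simp_all add: vb_dual_def\<close>)
  show ?thesis
    unfolding Lt_def Yt_def Y_def LY_def by (rule product_metric_minimal[OF assms(11)])
qed

end
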